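(* Let $(\alpha,\beta)\in[0,1)\times(0,1)$ and let $f\in\mathcal{A}^{+}_{\alpha,\beta}$ be such that $Z_f=\{1\}\times\overline{\mathbb{D}}$. Then $I_{\mathcal{A}^{+}_{\alpha,\beta}}(f)=I_{\mathcal{A}^{+}_{\alpha,\beta}}(\{1\}\times\overline{\mathbb{D}})$ if and only if for every $w\in\overline{\mathbb{D}}$ the function $f(\cdot,w)$ is outer.
   Context: $\mathbb{D}$ is the open unit disc of $\mathbb{C}$. $\mathcal{A}(\mathbb{D}^n)$ is the algebra of functions continuous on $\overline{\mathbb{D}}^n$ and holomorphic on $\mathbb{D}^n$, with the sup norm. For $\alpha,\beta\ge 0$, $\mathcal{A}^{+}_{\alpha,\beta}$ is the Banach algebra (pointwise product) of all $f(z,w)=\sum_{n,m\ge 0}a_{n,m}z^nw^m\in\mathcal{A}(\mathbb{D}^2)$ with $\|f\|_{\alpha,\beta}:=\sum_{n,m\ge0}|a_{n,m}|(1+n)^{\alpha}(1+m)^{\beta}<\infty$. For a Banach algebra $B\subset\mathcal{A}(\mathbb{D}^2)$, $f\in B$ and a closed set $E\subset\overline{\mathbb{D}}^2$: $I_B(f)=\overline{fB}$ (closure in the norm of $B$) is the closed ideal generated by $f$; $Z_f=\{z\in\overline{\mathbb{D}}^2: f(z)=0\}$; $I_B(E)=\{g\in B: g|_E=0\}$. A function $h\in\mathcal{A}(\mathbb{D})$, $h\not\equiv0$, is outer if there is $c\in\mathbb{C}$ with $|c|=1$ such that $h(z)=c\exp\int_0^{2\pi}\frac{e^{i\theta}+z}{e^{i\theta}-z}\log|h(e^{i\theta})|\frac{d\theta}{2\pi}$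 for all $z\in\mathbb{D}$. *)

theory Defs
  imports "HOL-Complex_Analysis.Complex_Analysis"
begin

abbreviation bidisc :: "(complex \<times> complex) set" where
  "bidisc \<equiv> ball 0 1 \<times> ball 0 1"

abbreviation closed_bidisc :: "(complex \<times> complex) set" where
  "closed_bidisc \<equiv> cball 0 1 \<times> cball 0 1"

text \<open>Functions are total in HOL; only their values on the closed disc or bidisc matter.
  Below no normalisation of the values outside is imposed, so each algebra or ideal is a set
  of total functions closed under changing values outside the closed (bi)disc, and the
  equality of two such sets is the equality of the corresponding sets of functions on the
  closed (bi)disc.\<close>

definition disc_algebra :: "(complex \<Rightarrow> complex) set" where
  "disc_algebra = {h. continuous_on (cball 0 1) h \<and> h holomorphic_on ball 0 1}"

text \<open>Holomorphy in two variables: a complex-linear total derivative exists at each point.\<close>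

definition holomorphic2_on ::
    "(complex \<times> complex \<Rightarrow> complex) \<Rightarrow> (complex \<times> complex) set \<Rightarrow> bool" where
  "holomorphic2_on f S \<longleftrightarrow>
     (\<forall>p\<in>S. \<exists>a b. (f has_derivative (\<lambda>(h, k). a * h + b * k)) (at p within S))"

definition bidisc_algebra :: "(complex \<times> complex \<Rightarrow> complex) set" where
  "bidisc_algebra = {f. continuous_on closed_bidisc f \<and> holomorphic2_on f bidisc}"

definition power_series_of ::
    "(complex \<times> complex \<Rightarrow> complex) \<Rightarrow> (nat \<times> nat \<Rightarrow> complex) \<Rightarrow> bool" where
  "power_series_of f a \<longleftrightarrow>
     (\<forall>(z, w)\<in>bidisc. ((\<lambda>(n, m). a (n, m) * z ^ n * w ^ m) has_sum f (z, w)) UNIV)"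

definition taylor_coeff ::
    "(complex \<times> complex \<Rightarrow> complex) \<Rightarrow> nat \<times> nat \<Rightarrow> complex" where
  "taylor_coeff f = (THE a. power_series_of f a)"

definition weighted_term ::
    "real \<Rightarrow> real \<Rightarrow> (nat \<times> nat \<Rightarrow> complex) \<Rightarrow> nat \<times> nat \<Rightarrow> real" where
  "weighted_term \<alpha> \<beta> a =
     (\<lambda>(n, m). norm (a (n, m)) * (1 + real n) powr \<alpha> * (1 + real m) powr \<beta>)"

definition weighted_algebra ::
    "real \<Rightarrow> real \<Rightarrow> (complex \<times> complex \<Rightarrow> complex) set" where
  "weighted_algebra \<alpha> \<beta> =
     {f \<in> bidisc_algebra. \<exists>a. power_series_of f a \<and> weighted_term \<alpha> \<beta> a summable_on UNIV}"

definition weighted_norm ::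
    "real \<Rightarrow> real \<Rightarrow> (complex \<times> complex \<Rightarrow> complex) \<Rightarrow> real" where
  "weighted_norm \<alpha> \<beta> f = (\<Sum>\<^sub>\<infinity>p. weighted_term \<alpha> \<beta> (taylor_coeff f) p)"

text \<open>In the next two definitions the algebra is given by its carrier \<open>B\<close> and norm \<open>nrm\<close>.\<close>

definition closure_in ::
    "(complex \<times> complex \<Rightarrow> complex) set \<Rightarrow> ((complex \<times> complex \<Rightarrow> complex) \<Rightarrow> real) \<Rightarrow>
     (complex \<times> complex \<Rightarrow> complex) set \<Rightarrow> (complex \<times> complex \<Rightarrow> complex) set" where
  "closure_in B nrm S = {g \<in> B. \<forall>e>0. \<exists>s\<in>S. nrm (\<lambda>p. g p - s p) < e}"

definition closed_ideal_gen ::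
    "(complex \<times> complex \<Rightarrow> complex) set \<Rightarrow> ((complex \<times> complex \<Rightarrow> complex) \<Rightarrow> real) \<Rightarrow>
     (complex \<times> complex \<Rightarrow> complex) \<Rightarrow> (complex \<times> complex \<Rightarrow> complex) set" where
  "closed_ideal_gen B nrm f = closure_in B nrm ((\<lambda>h p. f p * h p) ` B)"

definition zero_set :: "(complex \<times> complex \<Rightarrow> complex) \<Rightarrow> (complex \<times> complex) set" where
  "zero_set f = {p \<in> closed_bidisc. f p = 0}"

definition vanishing_ideal ::
    "(complex \<times> complex \<Rightarrow> complex) set \<Rightarrow> (complex \<times> complex) set \<Rightarrow>
     (complex \<times> complex \<Rightarrow> complex) set" where
  "vanishing_ideal B E = {g \<in> B. \<forall>p\<in>E. g p = 0}"

text \<open>For nonzero \<open>h\<close> in the disc algebra, \<open>log |h|\<close> is integrable on the circle and \<open>h\<close>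
  vanishes there only on a null set, so neither the value \<open>0\<close> of the integral of a
  non-integrable function nor the convention \<open>ln 0 = 0\<close> matters.\<close>

definition outer_function :: "(complex \<Rightarrow> complex) \<Rightarrow> bool" where
  "outer_function h \<longleftrightarrow> h \<in> disc_algebra \<and> (\<exists>z\<in>cball 0 1. h z \<noteq> 0) \<and>
     (\<exists>c. norm c = 1 \<and>
       (\<forall>z\<in>ball 0 1. h z = c * exp (LBINT \<theta>:{0..2 * pi}.
          (cis \<theta> + z) / (cis \<theta> - z) * complex_of_real (ln (norm (h (cis \<theta>))) / (2 * pi)))))"

text \<open>The coefficients are unique, so \<^const>\<open>taylor_coeff\<close> is meaningful.\<close>

lemma power_series_coeffs_zero:
  fixes c :: "nat \<Rightarrow> complex"
  assumes "\<And>z. norm z < 1 \<Longrightarrow> ((\<lambda>n. c n * z ^ n) has_sum 0) UNIV"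
  shows "c n = 0"
proof -
  have s: "(\<lambda>n. c n * z ^ n) sums 0" if "norm z < 1" for z
    using assms[OF that] by (rule has_sum_imp_sums)
  have "(\<lambda>_. 0 :: complex) has_fps_expansion Abs_fps c"
  proof (rule has_fps_expansionI)
    have "eventually (\<lambda>z::complex. z \<in> ball 0 1) (nhds 0)"
      by (intro eventually_nhds_in_open) auto
    then show "eventually (\<lambda>u. (\<lambda>n. fps_nth (Abs_fps c) n * u ^ n) sums 0) (nhds 0)"
      by eventually_elim (use s in auto)
  qed
  moreover have "(\<lambda>_. 0 :: complex) has_fps_expansion 0" by simp
  ultimately have "Abs_fps c = 0" by (rule fps_expansion_unique_complex)
  then show ?thesis by (metis fps_nth_Abs_fps fps_zero_nth)
qed

lemma power_series_of_unique:
  assumes "power_series_of f a" "power_series_of f b"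
  shows "a = b"
proof -
  define d where "d = (\<lambda>p. a p - b p)"
  have d: "((\<lambda>(n, m). (d (n, m) * w ^ m) * z ^ n) has_sum 0) (UNIV \<times> UNIV)"
    if "norm z < 1" "norm w < 1" for z w
  proof -
    have "((\<lambda>(n, m). a (n, m) * z ^ n * w ^ m) has_sum f (z, w)) UNIV"
      and "((\<lambda>(n, m). b (n, m) * z ^ n * w ^ m) has_sum f (z, w)) UNIV"
      using assms that by (auto simp: power_series_of_def)
    from has_sum_add[OF this(1) has_sum_uminusI[OF this(2)]] show ?thesis
      by (simp add: case_prod_unfold d_def algebra_simps)
  qed
  have inner: "(\<lambda>m. d (n, m) * w ^ m) summable_on UNIV" if w: "norm w < 1" for n w
  proof -
    have "(\<lambda>p. (\<lambda>(n, m). (d (n, m) * w ^ m) * (1/2) ^ n) p) summable_on (UNIV \<times> UNIV)"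
      using d[of "1/2" w] w by (auto intro: has_sum_imp_summable)
    then have "(\<lambda>m. (d (n, m) * w ^ m) * (1/2) ^ n) summable_on UNIV"
      using summable_on_SigmaD1[of "\<lambda>n m. (d (n, m) * w ^ m) * (1/2) ^ n" UNIV "\<lambda>_. UNIV" n]
      by auto
    then show ?thesis by (subst (asm) summable_on_cmult_left') auto
  qed
  have zero: "(\<Sum>\<^sub>\<infinity>m. d (n, m) * w ^ m) = 0" if w: "norm w < 1" for n w
  proof (rule power_series_coeffs_zero)
    fix z :: complex assume z: "norm z < 1"
    show "((\<lambda>n. (\<Sum>\<^sub>\<infinity>m. d (n, m) * w ^ m) * z ^ n) has_sum 0) UNIV"
    proof (rule has_sum_SigmaD[OF d[OF z w]])
      fix n
      show "((\<lambda>m. (\<lambda>(n, m). (d (n, m) * w ^ m) * z ^ n) (n, m)) has_sum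
          (\<Sum>\<^sub>\<infinity>m. d (n, m) * w ^ m) * z ^ n) UNIV"
        using inner[OF w, of n] by (auto intro: has_sum_cmult_left)
    qed
  qed
  have "d (n, m) = 0" for n m
  proof (rule power_series_coeffs_zero[of "\<lambda>m. d (n, m)"])
    fix w :: complex assume w: "norm w < 1"
    show "((\<lambda>m. d (n, m) * w ^ m) has_sum 0) UNIV"
      using has_sum_infsum[OF inner[OF w, of n]] by (simp only: zero[OF w])
  qed
  then show ?thesis by (auto simp: d_def fun_eq_iff)
qed

lemma taylor_coeff_eq: "power_series_of f a \<Longrightarrow> taylor_coeff f = a"
  unfolding taylor_coeff_def by (blast intro: the_equality power_series_of_unique)

end

theory Submission
  imports Defs "HOL-Real_Asymp.Real_Asymp" "HOL-Library.Function_Algebras"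
begin

text \<open>
  If the two ideals coincide, then \<open>z - 1\<close> is, for each fixed \<open>w\<close>, a uniform limit of multiples of
  \<open>k = f(\<cdot>, w)\<close>. The Poisson-Jensen inequality for the cofactors, which on the circle are of size about
  \<open>\<bar>z - 1\<bar> / \<bar>k\<bar>\<close>, then forces equality in Jensen's inequality for \<open>k\<close>, that is, \<open>k\<close> is outer.

  Conversely, it suffices that \<open>z - 1\<close> lies in the closed ideal generated by \<open>f\<close>. Otherwise a
  functional \<open>\<phi>\<close> annihilates the ideal but not \<open>z - 1\<close>. Modulo \<open>f\<close>, the element \<open>1 + u (z - 1)\<close> has
  an inverse \<open>c\<^sub>u\<close> for every complex \<open>u\<close>, so that \<open>E(u) = \<phi>(c\<^sub>u)\<close> is entire with
  \<open>E'(0) = - \<phi>(z - 1)\<close>. For \<open>Re u < 1/2\<close> the inverse is a geometric series in \<open>z\<close>, of norm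
  \<open>O(\<bar>u\<bar>\<^sup>\<alpha>)\<close> on the negative axis. For \<open>Re u > 1/2\<close> put \<open>\<mu> = 1 - 1/u\<close>, a point of the disc; then
  \<open>(f - f(\<mu>, \<cdot>)) / (\<mu> - z)\<close>, divided by \<open>f(\<mu>, \<cdot>)\<close>, inverts \<open>z - \<mu>\<close> modulo \<open>f\<close>. Since \<open>\<beta> > 0\<close>, the norm of
  \<open>1 / f(\<mu>, \<cdot>)\<close> is controlled by a power of \<open>1 / min \<bar>f(\<mu>, \<cdot>)\<bar>\<close>, and outerness bounds this minimum
  below by \<open>exp(- o(1 / (1 - \<bar>\<mu>\<bar>)))\<close>, uniformly in \<open>w\<close> by a Dini argument. A Phragmen-Lindeloef
  argument shows that \<open>E\<close> is a polynomial, and by the growth on the negative axis, with \<open>\<alpha> < 1\<close>, it is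
  constant. Hence \<open>\<phi>(z - 1) = 0\<close>, a contradiction.
\<close>


section \<open>A Phragmen-Lindeloef argument\<close>

text \<open>The obstacle is the line \<open>Re u = 1/2\<close>, where \<open>\<mu>\<close> reaches
  the circle and the ratio \<open>- u / (1 - u)\<close> of the geometric series reaches modulus 1:
  both estimates of \<open>E\<close> blow up there. A barrier on squares with two vertices on the
  line first carries the bounds across it and gives growth of order two. Since
  \<open>1 - \<bar>\<mu>\<bar>^2 = (2 * Re u - 1) / \<bar>u\<bar>^2\<close>, the factor
  \<open>exp(o(1 / (1 - \<bar>\<mu>\<bar>)))\<close> becomes \<open>exp(o(\<bar>u\<bar>))\<close> in
  a cone around the positive axis, and the sectors between this cone and the imaginary axis are
  narrower than a right angle, so that order two is admissible in them. The polynomial has degree at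
  most 3 because the geometric series is \<open>O(\<bar>u\<bar>^3)\<close> for large
  \<open>u\<close> with \<open>Re u \<le> 0\<close>. Inversion must be polynomial in the reciprocal
  of the minimum modulus because a fixed power of \<open>exp(o(1 / (1 - \<bar>\<mu>\<bar>)))\<close>
  is again of this kind. The reduction to \<open>z - 1\<close> truncates the power series of an
  element of the vanishing ideal and subtracts from the polynomial its restriction to
  \<open>z = 1\<close>.\<close>

text \<open>The auxiliary factor is \<open>exp(- \<epsilon> v\<^sup>3)\<close>; on the cone, \<open>Re (v\<^sup>3) \<ge> (Re v)\<^sup>3 / 4\<close>.\<close>

lemma PL_cone:
  fixes g :: "complex \<Rightarrow> complex"
  assumes hol: "g holomorphic_on {v. \<bar>Im v\<bar> \<le> Re v / 2}"
    and growth: "\<And>v. \<bar>Im v\<bar> \<le> Re v / 2 \<Longrightarrow> norm (g v) \<le> exp (C * (1 + norm v ^ 2))"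
    and bd: "\<And>v. \<bar>Im v\<bar> = Re v / 2 \<Longrightarrow> norm (g v) \<le> M" and M: "M > 0"
    and v: "\<bar>Im v\<bar> \<le> Re v / 2"
  shows "norm (g v) \<le> M"
proof -
  define D where "D = {v. \<bar>Im v\<bar> \<le> Re v / 2}"
  have cube: "Re (z ^ 3) \<ge> Re z ^ 3 / 4" if "z \<in> D" for z
  proof -
    have nn: "Re z \<ge> 0" using that by (auto simp: D_def)
    have "Re (z ^ 3) = Re z ^ 3 - 3 * (Re z * (Im z)\<^sup>2)"
      by (simp add: power3_eq_cube power2_eq_square algebra_simps)
    moreover have "(Im z)\<^sup>2 \<le> (Re z / 2)\<^sup>2"
      using that by (intro iffD1[OF abs_le_square_iff]) (auto simp: D_def)
    then have "Re z * (Im z)\<^sup>2 \<le> Re z * (Re z / 2)\<^sup>2" using nn by (rule mult_left_mono)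
    moreover have "Re z * (Re z / 2)\<^sup>2 = Re z ^ 3 / 4"
      by (simp add: power3_eq_cube power2_eq_square)
    ultimately show ?thesis by linarith
  qed
  have nrm: "norm z ^ 2 \<le> 2 * Re z ^ 2" if "z \<in> D" for z
  proof -
    have "(Im z)\<^sup>2 \<le> (Re z)\<^sup>2"
      using that by (intro iffD1[OF abs_le_square_iff]) (auto simp: D_def)
    then show ?thesis by (simp add: cmod_power2)
  qed
  have main: "norm (g v) * exp (- \<epsilon> * Re (v ^ 3)) \<le> M" if \<epsilon>: "\<epsilon> > 0" for \<epsilon>
  proof -
    define G where "G = (\<lambda>z. g z * exp (- of_real \<epsilon> * z ^ 3))"
    have nG: "norm (G z) = norm (g z) * exp (- \<epsilon> * Re (z ^ 3))" for z
      by (simp add: G_def norm_mult norm_exp_eq_Re)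
    \<comment> \<open>On the vertical side \<open>Re z = R\<close> the growth exponent is at most
      quadratic in \<open>R\<close>, because \<open>norm z ^ 2 \<le> 2 * R ^ 2\<close> in the cone,
      while the auxiliary factor contributes \<open>- \<epsilon> * R ^ 3 / 4\<close>; far enough out
      the product drops below \<open>M\<close>.\<close>
    have "eventually (\<lambda>R. exp (C' * (1 + 2 * R ^ 2)) * exp (- \<epsilon> * (R ^ 3 / 4)) < M) at_top"
      if "C' > 0" for C' :: real
    proof (rule order_tendstoD(2)[OF _ M])
      show "((\<lambda>R. exp (C' * (1 + 2 * R ^ 2)) * exp (- \<epsilon> * (R ^ 3 / 4))) \<longlongrightarrow> 0) at_top"
        using \<epsilon> that by real_asymp
    qed
    from this[of "\<bar>C\<bar> + 1"] have "eventually (\<lambda>R. exp ((\<bar>C\<bar> + 1) * (1 + 2 * R ^ 2)) * exp (- \<epsilon> * (R ^ 3 / 4)) < M \<and> R \<ge> Re v) at_top"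
      by (intro eventually_conj eventually_ge_at_top) auto
    then obtain R where R: "exp ((\<bar>C\<bar> + 1) * (1 + 2 * R ^ 2)) * exp (- \<epsilon> * (R ^ 3 / 4)) < M" "R \<ge> Re v"
      by (auto simp: eventually_at_top_linorder)
    define T where "T = {z. \<bar>Im z\<bar> \<le> Re z / 2 \<and> Re z \<le> R}"
    have TD: "T \<subseteq> D" by (auto simp: T_def D_def)
    have closedT: "closed T" unfolding T_def
      by (auto intro!: closed_Collect_conj closed_Collect_le continuous_intros)
    have bT: "bounded T"
    proof (rule boundedI)
      fix z assume z: "z \<in> T"
      then show "norm z \<le> 2 * R" using cmod_le[of z] by (auto simp: T_def)
    qed
    have frT: "\<bar>Im z\<bar> = Re z / 2 \<or> Re z = R" "z \<in> T" if "z \<in> frontier T" for z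
    proof -
      show zT: "z \<in> T" using that closedT frontier_subset_closed by blast
      show "\<bar>Im z\<bar> = Re z / 2 \<or> Re z = R"
      proof (rule ccontr)
        assume "\<not> ?thesis"
        then have "z \<in> {z. \<bar>Im z\<bar> < Re z / 2 \<and> Re z < R}" using zT by (auto simp: T_def)
        moreover have "open {z. \<bar>Im z\<bar> < Re z / 2 \<and> Re z < R}"
          by (auto intro!: open_Collect_conj open_Collect_less continuous_intros)
        moreover have "{z. \<bar>Im z\<bar> < Re z / 2 \<and> Re z < R} \<subseteq> T" by (auto simp: T_def)
        ultimately have "z \<in> interior T" by (meson interior_maximal subsetD)
        then show False using that by (simp add: frontier_def)
      qed
    qed
    have holG: "G holomorphic_on D" unfolding G_def D_def using hol by (intro holomorphic_intros)
    have "norm (G v) \<le> M"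
    proof (rule maximum_modulus_frontier[where S = T and f = G])
      show "G holomorphic_on interior T"
        using holG TD interior_subset holomorphic_on_subset by (metis subset_trans)
      show "continuous_on (closure T) G"
        using holG TD closedT by (metis closure_closed holomorphic_on_imp_continuous_on holomorphic_on_subset)
      show "bounded T" by (rule bT)
      show "v \<in> T" using v R by (auto simp: T_def)
      fix z assume z: "z \<in> frontier T"
      show "norm (G z) \<le> M"
      proof (cases "\<bar>Im z\<bar> = Re z / 2")
        case True
        have "Re (z ^ 3) \<ge> 0"
        proof -
          have "z \<in> D" "Re z \<ge> 0" using frT[OF z] TD True by auto
          then show ?thesis using cube[of z] by (meson divide_nonneg_nonneg order_trans zero_le_numeral zero_le_power)
        qed
        then have "norm (g z) * exp (- \<epsilon> * Re (z ^ 3)) \<le> M * 1"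
          using bd[OF True] \<epsilon> M by (intro mult_mono) auto
        then show ?thesis by (simp add: nG)
      next
        case False
        then have zR: "Re z = R" "z \<in> D" using frT[OF z] TD by auto
        have "norm (g z) \<le> exp (C * (1 + norm z ^ 2))" using growth zR(2) by (auto simp: D_def)
        also have "\<dots> \<le> exp ((\<bar>C\<bar> + 1) * (1 + 2 * R ^ 2))"
          using nrm[OF zR(2)] zR(1) by (auto intro!: mult_mono)
        finally have "norm (g z) * exp (- \<epsilon> * Re (z ^ 3)) \<le> exp ((\<bar>C\<bar> + 1) * (1 + 2 * R ^ 2)) * exp (- \<epsilon> * (R ^ 3 / 4))"
          using cube[OF zR(2)] zR(1) \<epsilon> by (intro mult_mono) auto
        then show ?thesis using R nG by simp
      qed
    qed
    then show ?thesis by (simp add: nG)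
  qed
  have "((\<lambda>\<epsilon>. norm (g v) * exp (- \<epsilon> * Re (v ^ 3))) \<longlongrightarrow> norm (g v) * exp (- 0 * Re (v ^ 3))) (at_right 0)"
    by (intro tendsto_intros)
  then have "norm (g v) * exp (- 0 * Re (v ^ 3)) \<le> M"
    by (rule tendsto_upperbound) (use main in \<open>auto simp: eventually_at_filter\<close>)
  then show ?thesis by simp
qed

text \<open>Division by \<open>1 + \<epsilon> * u\<close>, of modulus at least 1 in the half-plane
  and tending to infinity, makes a bounded function small on large arcs. The gain is that the crude
  bound \<open>B\<close> disappears from the conclusion; in the application \<open>B\<close> depends
  on a parameter that later tends to 0, whereas \<open>M\<close> does not.\<close>

lemma PL_halfplane_bounded:
  fixes g :: "complex \<Rightarrow> complex"
  assumes hol: "g holomorphic_on {u. Re u \<ge> 0}"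
    and bdd: "\<And>u. Re u \<ge> 0 \<Longrightarrow> norm (g u) \<le> B"
    and im: "\<And>u. Re u = 0 \<Longrightarrow> norm (g u) \<le> M" and M: "M > 0"
    and u: "Re u \<ge> 0"
  shows "norm (g u) \<le> M"
proof -
  have main: "norm (g u) / norm (1 + of_real \<epsilon> * u) \<le> M" if \<epsilon>: "\<epsilon> > 0" for \<epsilon>
  proof -
    define G where "G = (\<lambda>z. g z / (1 + of_real \<epsilon> * z))"
    have nz: "norm (1 + of_real \<epsilon> * z) \<ge> 1" if "Re z \<ge> 0" for z
    proof -
      have "1 \<le> Re (1 + of_real \<epsilon> * z)" using that \<epsilon> by simp
      also have "\<dots> \<le> norm (1 + of_real \<epsilon> * z)" by (rule complex_Re_le_cmod)
      finally show ?thesis .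
    qed
    \<comment> \<open>On the arc \<open>norm z = R\<close> this gives \<open>norm (1 + \<epsilon> *
      z) \<ge> \<epsilon> * R - 1 \<ge> \<bar>B\<bar> / M\<close>, and the half-disc contains
      \<open>u\<close>.\<close>
    define R where "R = norm u + (\<bar>B\<bar> / M + 1) / \<epsilon>"
    have R: "R \<ge> norm u" "\<epsilon> * R - 1 \<ge> \<bar>B\<bar> / M"
      using \<epsilon> M by (auto simp: R_def field_simps)
    define T where "T = {z. Re z \<ge> 0 \<and> norm z \<le> R}"
    have closedT: "closed T" unfolding T_def
      by (auto intro!: closed_Collect_conj closed_Collect_le continuous_intros)
    have bT: "bounded T" by (rule boundedI[of _ R]) (auto simp: T_def)
    have frT: "Re z = 0 \<or> norm z = R" "z \<in> T" if "z \<in> frontier T" for z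
    proof -
      show zT: "z \<in> T" using that closedT frontier_subset_closed by blast
      show "Re z = 0 \<or> norm z = R"
      proof (rule ccontr)
        assume "\<not> ?thesis"
        then have "z \<in> {z. Re z > 0 \<and> norm z < R}" using zT by (auto simp: T_def)
        moreover have "open {z. Re z > 0 \<and> norm z < R}"
          by (auto intro!: open_Collect_conj open_Collect_less continuous_intros)
        moreover have "{z. Re z > 0 \<and> norm z < R} \<subseteq> T" by (auto simp: T_def)
        ultimately have "z \<in> interior T" by (meson interior_maximal subsetD)
        then show False using that by (simp add: frontier_def)
      qed
    qed
    have holG: "G holomorphic_on {u. Re u \<ge> 0}"
      unfolding G_def using hol nz by (intro holomorphic_intros) force+
    have sub: "T \<subseteq> {u. Re u \<ge> 0}" by (auto simp: T_def)
    have "norm (G u) \<le> M"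
    proof (rule maximum_modulus_frontier[where S = T and f = G])
      show "G holomorphic_on interior T"
        using holG sub interior_subset holomorphic_on_subset by (metis subset_trans)
      show "continuous_on (closure T) G"
        using holG sub closedT by (metis closure_closed holomorphic_on_imp_continuous_on holomorphic_on_subset)
      show "bounded T" by (rule bT)
      show "u \<in> T" using u R by (auto simp: T_def)
      fix z assume z: "z \<in> frontier T"
      have zT: "Re z \<ge> 0" using frT(2)[OF z] by (simp add: T_def)
      show "norm (G z) \<le> M"
      proof (cases "Re z = 0")
        case True
        have "norm (g z) \<le> M * norm (1 + of_real \<epsilon> * z)"
          using im[OF True] nz[OF zT] M by (metis mult.right_neutral mult_left_mono order_trans less_imp_le)
        then show ?thesis using nz[OF zT] M by (simp add: G_def norm_divide divide_simps)
      next
        case False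
        then have zR: "norm z = R" using frT(1)[OF z] by simp
        have "\<epsilon> * R - 1 \<le> norm (1 + of_real \<epsilon> * z)"
          using norm_triangle_ineq2[of "of_real \<epsilon> * z" "- 1"] \<epsilon> zR by (simp add: norm_mult add.commute)
        then have "\<bar>B\<bar> / M \<le> norm (1 + of_real \<epsilon> * z)" using R(2) by simp
        then have "\<bar>B\<bar> \<le> M * norm (1 + of_real \<epsilon> * z)" using M by (simp add: field_simps)
        then have "norm (g z) \<le> M * norm (1 + of_real \<epsilon> * z)" using bdd[OF zT] by simp
        then show ?thesis using nz[OF zT] M by (simp add: G_def norm_divide divide_simps)
      qed
    qed
    then show ?thesis by (simp add: G_def norm_divide)
  qed
  have "((\<lambda>\<epsilon>. norm (g u) / norm (1 + of_real \<epsilon> * u)) \<longlongrightarrow> norm (g u) / norm (1 + of_real 0 * u)) (at_right 0)"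
    by (intro tendsto_intros) simp
  then have "norm (g u) / norm (1 + of_real 0 * u) \<le> M"
    by (rule tendsto_upperbound) (use main in \<open>auto simp: eventually_at_filter\<close>)
  then show ?thesis by simp
qed

text \<open>The point lies in a sector of half-opening \<open>pi / 4\<close>, where the squared
  modulus is at most twice the squared real part. The square in the next lemma is seen from its
  upper and lower vertices within such a sector.\<close>

lemma Re_inverse_diag:
  assumes "t > 0" "\<bar>a\<bar> \<le> t"
  shows "Re (1 / Complex t a) \<ge> 1 / (2 * t)"
proof -
  have "a\<^sup>2 \<le> t\<^sup>2" using assms by (intro iffD1[OF abs_le_square_iff]) auto
  then have "t\<^sup>2 + a\<^sup>2 \<le> 2 * t\<^sup>2" "t\<^sup>2 + a\<^sup>2 > 0" using assms by (auto simp: add_pos_nonneg)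
  have "1 / (2 * t) = t / (2 * t\<^sup>2)" using assms by (simp add: power2_eq_square)
  also have "\<dots> \<le> t / (t\<^sup>2 + a\<^sup>2)"
    using \<open>t\<^sup>2 + a\<^sup>2 \<le> 2 * t\<^sup>2\<close> \<open>t\<^sup>2 + a\<^sup>2 > 0\<close> assms by (intro divide_left_mono) auto
  finally show ?thesis by (simp add: Re_divide)
qed

text \<open>The square has two vertices on the line where the bound blows up. The sides meet there at a right angle,
  so that \<open>exp(- D / (2 + \<i> v) - D / (2 - \<i> v))\<close> absorbs the blow-up.\<close>

lemma bound_across_line:
  fixes F :: "complex \<Rightarrow> complex"
  assumes hol: "F holomorphic_on UNIV"
    and bd: "\<And>v. \<bar>Re v\<bar> + \<bar>Im v\<bar> = 2 \<Longrightarrow> Re v \<noteq> 0 \<Longrightarrow> norm (F v) \<le> exp (D / (2 * \<bar>Re v\<bar>))"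
    and D: "D > 0" and a: "\<bar>a\<bar> \<le> 1"
  shows "norm (F (of_real a)) \<le> exp D"
proof -
  define Q where "Q = {v. \<bar>Re v\<bar> + \<bar>Im v\<bar> \<le> 2}"
  have closedQ: "closed Q" unfolding Q_def by (intro closed_Collect_le continuous_intros)
  have bQ: "bounded Q"
  proof (rule boundedI)
    fix z assume z: "z \<in> Q"
    then show "norm z \<le> 2" using cmod_le[of z] by (auto simp: Q_def)
  qed
  have "compact (F ` Q)"
    using closedQ bQ hol holomorphic_on_imp_continuous_on holomorphic_on_subset
    by (intro compact_continuous_image) (auto simp: compact_eq_bounded_closed)
  then have "bounded (F ` Q)" by (rule compact_imp_bounded)
  then obtain M0 where M0: "\<And>z. z \<in> Q \<Longrightarrow> norm (F z) \<le> M0"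
    unfolding bounded_iff by auto
  define M where "M = max M0 1"
  have M: "M \<ge> 1" "\<And>z. z \<in> Q \<Longrightarrow> norm (F z) \<le> M" using M0 by (force simp: M_def)+
  \<comment> \<open>Depth at which the two critical vertices are cut off. It is so small that the
    qualitative bound \<open>M\<close> obtained from compactness is at most
    \<open>exp (D / (2 * s))\<close> on the horizontal cuts; so \<open>M\<close> leaves no trace in
    the result.\<close>
  define s where "s = min 1 (D / (2 * (ln M + 1)))"
  have lnM: "ln M + 1 > 0" using M(1) ln_ge_zero[of M] by linarith
  have s: "s > 0" "s \<le> 1" using D lnM by (auto simp: s_def)
  have sM: "ln M \<le> D / (2 * s)"
  proof -
    have "s \<le> D / (2 * (ln M + 1))" by (simp add: s_def)
    then have "2 * s * (ln M + 1) \<le> D" using lnM by (simp add: field_simps)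
    then have "ln M + 1 \<le> D / (2 * s)" using s by (simp add: field_simps)
    then show ?thesis by simp
  qed
  define T where "T = {v. \<bar>Re v\<bar> + \<bar>Im v\<bar> \<le> 2 \<and> \<bar>Im v\<bar> \<le> 2 - s}"
  have TQ: "T \<subseteq> Q" by (auto simp: T_def Q_def)
  have closedT: "closed T" unfolding T_def
    by (auto intro!: closed_Collect_conj closed_Collect_le continuous_intros)
  have bT: "bounded T" using TQ bQ bounded_subset by blast
  have frT: "\<bar>Re z\<bar> + \<bar>Im z\<bar> = 2 \<or> \<bar>Im z\<bar> = 2 - s" "z \<in> T" if "z \<in> frontier T" for z
  proof -
    show zT: "z \<in> T" using that closedT frontier_subset_closed by blast
    show "\<bar>Re z\<bar> + \<bar>Im z\<bar> = 2 \<or> \<bar>Im z\<bar> = 2 - s"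
    proof (rule ccontr)
      assume "\<not> ?thesis"
      then have "z \<in> {v. \<bar>Re v\<bar> + \<bar>Im v\<bar> < 2 \<and> \<bar>Im v\<bar> < 2 - s}" using zT by (auto simp: T_def)
      moreover have "open {v. \<bar>Re v\<bar> + \<bar>Im v\<bar> < 2 \<and> \<bar>Im v\<bar> < 2 - s}"
        by (auto intro!: open_Collect_conj open_Collect_less continuous_intros)
      moreover have "{v. \<bar>Re v\<bar> + \<bar>Im v\<bar> < 2 \<and> \<bar>Im v\<bar> < 2 - s} \<subseteq> T" by (auto simp: T_def)
      ultimately have "z \<in> interior T" by (meson interior_maximal subsetD)
      then show False using that by (simp add: frontier_def)
    qed
  qed
  have c1: "2 + \<i> * v = Complex (2 - Im v) (Re v)" and c2: "2 - \<i> * v = Complex (2 + Im v) (- Re v)" for v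
    by (simp_all add: complex_eq_iff)
  define G where "G = (\<lambda>v. F v * exp (- of_real D * (1 / (2 + \<i> * v)) - of_real D * (1 / (2 - \<i> * v))))"
  define h where "h = (\<lambda>v. D * Re (1 / (2 + \<i> * v)) + D * Re (1 / (2 - \<i> * v)))"
  have "Re (of_real D / x) = D * Re (1 / x)" for x by (simp add: Re_divide)
  then have nG: "norm (G v) = norm (F v) * exp (- h v)" for v
    by (simp add: G_def norm_mult norm_exp_eq_Re h_def)
  have holG: "G holomorphic_on T"
    unfolding G_def
  proof (intro holomorphic_intros holomorphic_on_subset[OF hol])
    show "2 + \<i> * v \<noteq> 0" "2 - \<i> * v \<noteq> 0" if "v \<in> T" for v
      unfolding c1 c2 using that s by (auto simp: T_def complex_eq_iff)
  qed auto
  \<comment> \<open>Both reciprocals have nonnegative real part on \<open>T\<close>, so the one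
    belonging to the vertex on the same side as \<open>z\<close> may be used alone.\<close>
  have hlow: "h z \<ge> D / (2 * (2 - \<bar>Im z\<bar>))" if z: "z \<in> T" for z
  proof -
    have p: "2 - Im z > 0" "2 + Im z > 0" "\<bar>Re z\<bar> \<le> 2 - Im z" "\<bar>- Re z\<bar> \<le> 2 + Im z"
      using z s by (auto simp: T_def)
    have r: "Re (1 / (2 + \<i> * z)) \<ge> 1 / (2 * (2 - Im z))" "Re (1 / (2 - \<i> * z)) \<ge> 1 / (2 * (2 + Im z))"
      unfolding c1 c2 using Re_inverse_diag p by blast+
    have r0: "Re (1 / (2 + \<i> * z)) \<ge> 0" "Re (1 / (2 - \<i> * z)) \<ge> 0"
      using r p by (meson divide_nonneg_pos mult_pos_pos order_trans zero_le_one zero_less_numeral)+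
    show ?thesis
    proof (cases "Im z \<ge> 0")
      case True
      have "D * (1 / (2 * (2 - Im z))) + 0 \<le> h z"
        unfolding h_def using r r0 D by (intro add_mono mult_left_mono mult_nonneg_nonneg) auto
      then show ?thesis using True by simp
    next
      case False
      have "0 + D * (1 / (2 * (2 + Im z))) \<le> h z"
        unfolding h_def using r r0 D by (intro add_mono mult_left_mono mult_nonneg_nonneg) auto
      then show ?thesis using False by simp
    qed
  qed
  have "norm (G (of_real a)) \<le> 1"
  proof (rule maximum_modulus_frontier[where S = T and f = G])
    show "G holomorphic_on interior T"
      using holG interior_subset holomorphic_on_subset by blast
    show "continuous_on (closure T) G"
      using holG closedT by (metis closure_closed holomorphic_on_imp_continuous_on)
    show "bounded T" by (rule bT)
    show "of_real a \<in> T" using a s by (auto simp: T_def)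
    fix z assume z: "z \<in> frontier T"
    note zT = frT(2)[OF z]
    have "norm (F z) \<le> exp (D / (2 * (2 - \<bar>Im z\<bar>)))"
    proof (cases "\<bar>Im z\<bar> = 2 - s")
      case True
      have "norm (F z) \<le> M" using M(2) zT TQ by auto
      also have "\<dots> = exp (ln M)" using M(1) by simp
      also have "\<dots> \<le> exp (D / (2 * s))" using sM by simp
      finally show ?thesis using True by simp
    next
      case False
      then have *: "\<bar>Re z\<bar> + \<bar>Im z\<bar> = 2" using frT(1)[OF z] by simp
      moreover have "\<bar>Im z\<bar> \<le> 2 - s" using zT by (simp add: T_def)
      ultimately have "Re z \<noteq> 0" "\<bar>Re z\<bar> = 2 - \<bar>Im z\<bar>" using s by auto
      then show ?thesis using bd[OF *] by simp
    qed
    also have "\<dots> \<le> exp (h z)" using hlow[OF zT] by simp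
    finally show "norm (G z) \<le> 1" unfolding nG by (simp add: exp_minus divide_simps)
  qed
  then have "norm (F (of_real a)) \<le> exp (h (of_real a))" unfolding nG by (simp add: exp_minus divide_simps)
  also have "h (of_real a) \<le> D"
  proof -
    have "Re (1 / Complex 2 b) \<le> 1 / 2" for b
    proof -
      have "2 / (4 + b\<^sup>2) \<le> 2 / 4" by (intro divide_left_mono) (auto simp: add_pos_nonneg)
      then show ?thesis by (simp add: Re_divide)
    qed
    then have "Re (1 / (2 + \<i> * of_real a)) \<le> 1/2" "Re (1 / (2 - \<i> * of_real a)) \<le> 1/2"
      unfolding c1 c2 by simp_all
    then have "h (of_real a) \<le> D * (1/2) + D * (1/2)"
      unfolding h_def using D by (intro add_mono mult_left_mono) auto
    then show ?thesis by simp
  qed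
  finally show ?thesis by simp
qed

text \<open>Near the line the square of \<open>bound_across_line\<close> is centred at the point
  \<open>c\<close> of the line at the height of \<open>u\<close>, where
  \<open>\<bar>2 * Re (c + v) - 1\<bar> = 2 * \<bar>Re v\<bar>\<close>; further away the hypothesis
  already suffices. The factor 19 comes from \<open>1 + (3 + y)^2 \<le> 19 + 2 * y^2\<close> with
  \<open>y = \<bar>Im u\<bar>\<close>, since the boundary of the square stays within modulus
  \<open>3 + y\<close>.\<close>

lemma order_two_bound:
  fixes E :: "complex \<Rightarrow> complex"
  assumes hol: "E holomorphic_on UNIV"
    and bd: "\<And>u. Re u \<noteq> 1/2 \<Longrightarrow> norm (E u) \<le> exp (A * (1 + norm u ^ 2) / \<bar>2 * Re u - 1\<bar>)"
    and A: "A > 0"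
  shows "norm (E u) \<le> exp (19 * A * (1 + norm u ^ 2))"
proof (cases "\<bar>Re u - 1/2\<bar> \<le> 1")
  case True
  define c where "c = Complex (1/2) (Im u)"
  define D where "D = A * (1 + (3 + \<bar>Im u\<bar>) ^ 2)"
  have "norm (E (c + of_real (Re u - 1/2))) \<le> exp D"
  proof (rule bound_across_line[where F = "\<lambda>v. E (c + v)"])
    show "(\<lambda>v. E (c + v)) holomorphic_on UNIV"
      by (intro holomorphic_intros holomorphic_on_compose_gen[OF _ hol, unfolded o_def]) auto
    show "D > 0" using A by (auto simp: D_def add_pos_nonneg)
    show "\<bar>Re u - 1/2\<bar> \<le> 1" by fact
    fix v assume v: "\<bar>Re v\<bar> + \<bar>Im v\<bar> = 2" "Re v \<noteq> 0"
    have "norm (c + v) \<le> norm c + norm v" by (rule norm_triangle_ineq)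
    also have "norm c \<le> 1/2 + \<bar>Im u\<bar>" using cmod_le[of c] by (simp add: c_def)
    also have "norm v \<le> 2" using cmod_le[of v] v by simp
    finally have "norm (c + v) \<le> 3 + \<bar>Im u\<bar>" by simp
    then have "norm (c + v) ^ 2 \<le> (3 + \<bar>Im u\<bar>) ^ 2" by (intro power_mono) auto
    then have "A * (1 + norm (c + v) ^ 2) \<le> D" using A by (simp add: D_def)
    moreover have "norm (E (c + v)) \<le> exp (A * (1 + norm (c + v) ^ 2) / \<bar>2 * Re (c + v) - 1\<bar>)"
      by (rule bd) (use v in \<open>auto simp: c_def\<close>)
    moreover have "\<bar>2 * Re (c + v) - 1\<bar> = 2 * \<bar>Re v\<bar>" by (simp add: c_def abs_mult)
    ultimately show "norm (E (c + v)) \<le> exp (D / (2 * \<bar>Re v\<bar>))"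
      by (smt (verit) divide_right_mono exp_le_cancel_iff)
  qed
  also have "c + of_real (Re u - 1/2) = u" by (simp add: c_def complex_eq_iff)
  also have "D \<le> 19 * A * (1 + norm u ^ 2)"
  proof -
    have "\<bar>Im u\<bar> ^ 2 \<le> norm u ^ 2" by (intro power_mono abs_Im_le_cmod) auto
    moreover have "(3 + \<bar>Im u\<bar>) ^ 2 \<le> 18 + 2 * \<bar>Im u\<bar> ^ 2"
      using zero_le_power2[of "3 - \<bar>Im u\<bar>"] by (simp add: power2_eq_square algebra_simps)
    ultimately have "1 + (3 + \<bar>Im u\<bar>) ^ 2 \<le> 19 * (1 + norm u ^ 2)"
      using zero_le_power2[of "norm u"] by argo
    then show ?thesis using A by (simp add: D_def)
  qed
  finally show ?thesis by simp
next
  case False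
  then have *: "\<bar>2 * Re u - 1\<bar> \<ge> 1" by linarith
  have p: "A * (1 + norm u ^ 2) > 0" using A by (intro mult_pos_pos) (auto simp: add_pos_nonneg)
  have "A * (1 + norm u ^ 2) / \<bar>2 * Re u - 1\<bar> \<le> A * (1 + norm u ^ 2) / 1"
    using * p by (intro divide_left_mono) auto
  also have "\<dots> \<le> 19 * A * (1 + norm u ^ 2)" using p by simp
  finally have "exp (A * (1 + norm u ^ 2) / \<bar>2 * Re u - 1\<bar>) \<le> exp (19 * A * (1 + norm u ^ 2))" by simp
  moreover have "Re u \<noteq> 1/2" using * by auto
  ultimately show ?thesis using bd order_trans by blast
qed


text \<open>The order-two bound legitimises Phragmen-Lindeloef in sectors narrower than a right
  angle. Cubic growth on the closed left half-plane is thereby transferred to the right one,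
  Liouville's theorem leaves a polynomial of degree at most 3, and division by powers of
  \<open>t\<close> along \<open>u = - t\<close> removes the coefficients from the top because
  \<open>\<alpha> < 1\<close>.\<close>

lemma entire_constant:
  fixes E :: "complex \<Rightarrow> complex"
  assumes hol: "E holomorphic_on UNIV"
    and left: "\<And>u. Re u < 1/2 \<Longrightarrow>
      norm (E u) \<le> C0 * (norm (1 - u) * (norm (1 - u) + norm u) ^ 2 / (1 - 2 * Re u) ^ 2)"
    and neg: "\<And>t. t > 0 \<Longrightarrow> norm (E (- of_real t)) \<le> C1 * (1 + t) powr \<alpha>"
    and right: "\<And>\<epsilon>. \<epsilon> > 0 \<Longrightarrow>
      \<exists>C. \<forall>u. Re u > 1/2 \<longrightarrow> norm (E u) \<le> C * exp (\<epsilon> * norm u ^ 2 / (2 * Re u - 1))"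
    and \<alpha>: "\<alpha> < 1" and C0: "C0 > 0"
  shows "E u = E 0"
proof -
  obtain C where C: "\<And>u. Re u > 1/2 \<Longrightarrow> norm (E u) \<le> C * exp (1 * norm u ^ 2 / (2 * Re u - 1))"
    using right[of 1] by auto
  define K where "K = max (max C (18 * C0)) 1"
  have K: "K \<ge> C" "K \<ge> 18 * C0" "K \<ge> 1" by (auto simp: K_def)
  \<comment> \<open>Both half-planes give \<open>norm (E u) \<le> K * exp (2 * X)\<close> with
    \<open>X = (1 + norm u ^ 2) / \<bar>2 * Re u - 1\<bar>\<close>. As \<open>2 * X \<ge> 1\<close>,
    the factor \<open>K\<close> is at most \<open>exp (2 * ln K * X)\<close>, whence the first term
    of \<open>A\<close>.\<close>
  define A where "A = 2 * ln K + 2"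
  have A: "A > 0" using ln_ge_zero[OF K(3)] by (simp add: A_def)
  have bd: "norm (E u) \<le> exp (A * (1 + norm u ^ 2) / \<bar>2 * Re u - 1\<bar>)" if u: "Re u \<noteq> 1/2" for u
  proof -
    define x where "x = \<bar>2 * Re u - 1\<bar>"
    define Y where "Y = 1 + norm u ^ 2"
    define X where "X = Y / x"
    have x: "x > 0" using u by (auto simp: x_def)
    have Re: "\<bar>Re u\<bar> \<le> norm u" by (rule abs_Re_le_cmod)
    have n2: "2 * norm u \<le> Y"
      using zero_le_power2[of "norm u - 1"] by (simp add: Y_def power2_eq_square algebra_simps)
    have Y1: "Y \<ge> 1" by (simp add: Y_def)
    have "x \<le> 2 * \<bar>Re u\<bar> + 1" by (simp add: x_def)
    also have "\<dots> \<le> 2 * Y" using Re n2 Y1 by linarith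
    finally have X: "2 * X \<ge> 1" using x by (simp add: X_def field_simps)
    have KX: "K * exp (2 * X) \<le> exp (A * X)"
    proof -
      have "ln K * 1 \<le> ln K * (2 * X)" using X K(3) by (intro mult_left_mono) auto
      then have "ln K + 2 * X \<le> A * X" by (simp add: A_def algebra_simps)
      moreover have "K * exp (2 * X) = exp (ln K + 2 * X)" using K(3) by (simp add: exp_add)
      ultimately show ?thesis by simp
    qed
    have "norm (E u) \<le> K * exp (2 * X)"
    proof (cases "Re u > 1/2")
      case True
      then have xx: "2 * Re u - 1 = x" by (simp add: x_def)
      have "norm (E u) \<le> C * exp (1 * norm u ^ 2 / x)" using C[OF True] xx by simp
      also have "\<dots> \<le> K * exp (2 * X)"
      proof (rule mult_mono)
        have "norm u ^ 2 / x \<le> Y / x" using x by (intro divide_right_mono) (auto simp: Y_def)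
        also have "\<dots> \<le> 2 * X" using X by (simp add: X_def)
        finally show "exp (1 * norm u ^ 2 / x) \<le> exp (2 * X)" by simp
      qed (use K in auto)
      finally show ?thesis .
    next
      case False
      then have xx: "1 - 2 * Re u = x" by (simp add: x_def)
      have n1: "norm (1 - u) \<le> 1 + norm u" using norm_triangle_ineq4[of 1 u] by simp
      have nY: "1 + 2 * norm u \<le> 2 * Y" using n2 Y1 by simp
      have sq: "(1 + 2 * norm u) ^ 2 \<le> 9 * Y"
      proof -
        have "(1 + 2 * norm u) ^ 2 = 1 + 2 * (2 * norm u) + 4 * norm u ^ 2"
          by (simp add: power2_eq_square algebra_simps)
        also have "\<dots> \<le> 9 * Y" using n2 zero_le_power2[of "norm u"] unfolding Y_def by argo
        finally show ?thesis .
      qed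
      have "norm (1 - u) * (norm (1 - u) + norm u) ^ 2 \<le> (2 * Y) * (9 * Y)"
      proof (rule mult_mono)
        show "norm (1 - u) \<le> 2 * Y" using n1 nY norm_ge_zero[of u] by linarith
        have "(norm (1 - u) + norm u) ^ 2 \<le> (1 + 2 * norm u) ^ 2" using n1 by (intro power_mono) auto
        then show "(norm (1 - u) + norm u) ^ 2 \<le> 9 * Y" using sq by (rule order_trans)
      qed (use Y1 in auto)
      then have "norm (1 - u) * (norm (1 - u) + norm u) ^ 2 / x ^ 2 \<le> (2 * Y) * (9 * Y) / x ^ 2"
        by (intro divide_right_mono) auto
      also have "\<dots> = 18 * X ^ 2" by (simp add: X_def power2_eq_square)
      finally have "norm (E u) \<le> C0 * (18 * X ^ 2)"
        using left[of u] False u C0 xx by (smt (verit) mult_left_mono)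
      also have "\<dots> = (18 * C0) * X ^ 2" by simp
      also have "\<dots> \<le> K * exp (2 * X)"
      proof (rule mult_mono)
        have "X \<le> exp X" using exp_ge_add_one_self[of X] by linarith
        then have "X ^ 2 \<le> exp X ^ 2" using X by (intro power_mono) auto
        then show "X ^ 2 \<le> exp (2 * X)" by (simp add: exp_double)
      qed (use K in auto)
      finally show ?thesis .
    qed
    also note KX
    finally show ?thesis by (simp add: X_def Y_def x_def)
  qed
  define C' where "C' = 19 * A"
  have growth: "norm (E u) \<le> exp (C' * (1 + norm u ^ 2))" for u
    using order_two_bound[OF hol bd A] by (simp add: C'_def)
  \<comment> \<open>For \<open>Re u \<le> 0\<close> the denominator is at least 1 and
    \<open>norm u \<le> norm (1 - u)\<close>, so the squared sum is at most
    \<open>(2 * norm (1 - u)) ^ 2\<close>; this is the 4.\<close>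
  define M0 where "M0 = 4 * C0"
  have lft: "norm (E u) \<le> M0 * norm (1 - u) ^ 3" if u: "Re u \<le> 0" for u
  proof -
    have "norm u ^ 2 \<le> norm (1 - u) ^ 2" using u unfolding cmod_power2 by (simp add: power2_eq_square algebra_simps)
    then have nu: "norm u \<le> norm (1 - u)" by (rule power2_le_imp_le) simp
    have "norm (E u) \<le> C0 * (norm (1 - u) * (norm (1 - u) + norm u) ^ 2 / (1 - 2 * Re u) ^ 2)"
      using left u by simp
    also have "\<dots> \<le> C0 * (norm (1 - u) * (norm (1 - u) + norm u) ^ 2 / 1)"
      using u C0 by (intro mult_left_mono divide_left_mono) auto
    also have "\<dots> \<le> C0 * (norm (1 - u) * (norm (1 - u) + norm (1 - u)) ^ 2 / 1)"
      using nu C0 by (intro mult_left_mono divide_right_mono power_mono add_mono) auto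
    finally show ?thesis by (simp add: M0_def power3_eq_cube power2_eq_square algebra_simps)
  qed
  have rgt: "norm (E u) \<le> M0 * norm (1 + u) ^ 3" if u: "Re u \<ge> 0" for u
  proof -
    have n1: "norm (1 + u) \<ge> 1" if "Re u \<ge> 0" for u
      using complex_Re_le_cmod[of "1 + u"] that by simp
    have main: "norm (E u) * exp (- \<epsilon> * Re u) / norm (1 + u) ^ 3 \<le> M0" if \<epsilon>: "\<epsilon> > 0" for \<epsilon>
    proof -
      \<comment> \<open>The cubic denominator matches the bound on the imaginary axis, where
        \<open>norm (1 - u) = norm (1 + u)\<close>. The exponential cancels the growth
        \<open>exp (\<epsilon> * Re u)\<close> that the hypothesis \<open>right\<close> leaves in
        the cone around the positive axis.\<close>
      define g where "g = (\<lambda>u. E u * exp (- of_real \<epsilon> * u) / (1 + u) ^ 3)"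
      have ng: "norm (g u) = norm (E u) * exp (- \<epsilon> * Re u) / norm (1 + u) ^ 3" for u
        by (simp add: g_def norm_mult norm_divide norm_power norm_exp_eq_Re)
      have ngE: "norm (g u) \<le> norm (E u) * exp (- \<epsilon> * Re u)" if "Re u \<ge> 0" for u
      proof -
        have "1 ^ 3 \<le> norm (1 + u) ^ 3" using n1[OF that] by (intro power_mono) auto
        then have "norm (E u) * exp (- \<epsilon> * Re u) / norm (1 + u) ^ 3 \<le> norm (E u) * exp (- \<epsilon> * Re u) / 1"
          using n1[OF that] by (intro divide_left_mono) auto
        then show ?thesis by (simp add: ng)
      qed
      have ngE': "norm (g u) \<le> norm (E u)" if "Re u \<ge> 0" for u
      proof -
        have "norm (E u) * exp (- \<epsilon> * Re u) \<le> norm (E u) * 1"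
          using that \<epsilon> by (intro mult_left_mono) auto
        then show ?thesis using ngE[OF that] by simp
      qed
      have holg: "g holomorphic_on {u. Re u \<ge> 0}"
        unfolding g_def
      proof (intro holomorphic_intros holomorphic_on_subset[OF hol])
        fix u assume "u \<in> {u. Re u \<ge> 0}"
        then show "(1 + u) ^ 3 \<noteq> 0" using n1[of u] by auto
      qed auto
      have gim: "norm (g u) \<le> M0" if u: "Re u = 0" for u
      proof -
        have "norm (1 - u) = norm (1 + u)" using u by (simp add: cmod_def)
        then have "norm (E u) \<le> M0 * norm (1 + u) ^ 3" using lft[of u] u by simp
        moreover have "norm (1 + u) > 0" using n1[of u] u by linarith
        ultimately show ?thesis by (simp add: ng u pos_divide_le_eq)
      qed
      obtain C2 where C2: "\<And>u. Re u > 1/2 \<Longrightarrow> norm (E u) \<le> C2 * exp ((\<epsilon> / 2) * norm u ^ 2 / (2 * Re u - 1))"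
        using right[of "\<epsilon> / 2"] \<epsilon> by auto
      obtain C3 where C3: "\<And>u. norm u \<le> 3 \<Longrightarrow> norm (E u) \<le> C3"
      proof -
        have "compact (E ` cball 0 3)"
          using hol holomorphic_on_imp_continuous_on holomorphic_on_subset
          by (intro compact_continuous_image) auto
        then have "bounded (E ` cball 0 3)" by (rule compact_imp_bounded)
        then obtain B where "\<And>y. y \<in> E ` cball 0 3 \<Longrightarrow> norm y \<le> B" unfolding bounded_iff by blast
        then show thesis by (intro that[of B]) auto
      qed
      define M1 where "M1 = max M0 (max C2 C3)"
      have M1: "M1 > 0" "M0 \<le> M1" using C0 by (auto simp: M1_def M0_def)
      \<comment> \<open>In this cone and for \<open>Re u \<ge> 1\<close> one has
        \<open>norm u ^ 2 \<le> 2 * Re u ^ 2\<close> and \<open>2 * Re u - 1 \<ge> Re u\<close>, so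
        \<open>right\<close> with parameter \<open>\<epsilon> / 2\<close> has exponent at most
        \<open>\<epsilon> * Re u\<close>.\<close>
      have mid: "norm (g u) \<le> M1" if u: "\<bar>Im u\<bar> \<le> 3/4 * Re u" for u
      proof (cases "Re u \<ge> 1")
        case True
        have "(Im u)\<^sup>2 \<le> (3/4 * Re u)\<^sup>2" using u by (intro iffD1[OF abs_le_square_iff]) auto
        also have "(3/4 * Re u)\<^sup>2 = 9/16 * (Re u)\<^sup>2" by (simp add: power2_eq_square)
        finally have n: "norm u ^ 2 \<le> 2 * Re u ^ 2"
          unfolding cmod_power2 using zero_le_power2[of "Re u"] by linarith
        have "norm u ^ 2 / (2 * Re u - 1) \<le> (2 * Re u ^ 2) / Re u"
          using n True by (intro frac_le) auto
        also have "\<dots> = 2 * Re u" using True by (simp add: power2_eq_square)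
        finally have "(\<epsilon> / 2) * (norm u ^ 2 / (2 * Re u - 1)) \<le> (\<epsilon> / 2) * (2 * Re u)"
          using \<epsilon> by (intro mult_left_mono) auto
        then have e: "(\<epsilon> / 2) * norm u ^ 2 / (2 * Re u - 1) \<le> \<epsilon> * Re u" by simp
        have "norm (g u) \<le> norm (E u) * exp (- \<epsilon> * Re u)" using ngE True by simp
        also have "\<dots> \<le> (C2 * exp ((\<epsilon> / 2) * norm u ^ 2 / (2 * Re u - 1))) * exp (- \<epsilon> * Re u)"
          using C2[of u] True by (intro mult_right_mono) auto
        also have "\<dots> \<le> (M1 * exp (\<epsilon> * Re u)) * exp (- \<epsilon> * Re u)"
          using e M1 by (intro mult_right_mono mult_mono) (auto simp: M1_def)
        also have "\<dots> = M1" by (simp add: exp_minus)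
        finally show ?thesis .
      next
        case False
        then have "norm u \<le> 3" "Re u \<ge> 0" using u cmod_le[of u] by auto
        then show ?thesis using C3[of u] ngE'[of u] by (simp add: M1_def)
      qed
      \<comment> \<open>Multiplication by \<open>d\<close> carries the edges of the cone
        \<open>\<bar>Im v\<bar> \<le> Re v / 2\<close> onto one half of the imaginary axis and a ray
        of slope \<open>3/4\<close> or \<open>- 3/4\<close>, two places where \<open>g\<close> is
        already bounded. This is the origin of the slope in \<open>mid\<close>.\<close>
      have cone: "norm (g (d * v)) \<le> M1"
        if d: "d = Complex (1/2) s" "\<bar>s\<bar> = 1" and v: "\<bar>Im v\<bar> \<le> Re v / 2" for d s v
      proof (rule PL_cone[where g = "\<lambda>v. g (d * v)"])
        have Re0: "Re (d * v) \<ge> 0" if "\<bar>Im v\<bar> \<le> Re v / 2" for v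
        proof -
          have "s * Im v \<le> \<bar>s * Im v\<bar>" by simp
          also have "\<dots> \<le> Re v / 2" using d(2) that by (simp add: abs_mult)
          finally show ?thesis using d(1) by simp
        qed
        then show "(\<lambda>v. g (d * v)) holomorphic_on {v. \<bar>Im v\<bar> \<le> Re v / 2}"
          by (intro holomorphic_on_compose_gen[OF _ holg, unfolded o_def] holomorphic_intros) auto
        have nd: "norm d ^ 2 = 5/4"
        proof -
          have "s ^ 2 = 1" using d(2) by (metis one_power2 power2_abs)
          then show ?thesis unfolding d(1) cmod_power2 by (simp add: power_divide)
        qed
        show "norm (g (d * v)) \<le> exp ((2 * C') * (1 + norm v ^ 2))" if v: "\<bar>Im v\<bar> \<le> Re v / 2" for v
        proof -
          have C': "C' > 0" using A by (simp add: C'_def)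
          have "norm (g (d * v)) \<le> exp (C' * (1 + norm (d * v) ^ 2))"
            using ngE'[OF Re0[OF v]] growth[of "d * v"] by simp
          also have "1 + norm (d * v) ^ 2 \<le> 2 * (1 + norm v ^ 2)"
            using zero_le_power2[of "norm v"] by (simp add: norm_mult power_mult_distrib nd)
          finally show ?thesis using C' by (simp add: algebra_simps)
        qed
        show "norm (g (d * v)) \<le> M1" if v: "\<bar>Im v\<bar> = Re v / 2" for v
        proof -
          have s: "s = 1 \<or> s = -1" using d(2) by linarith
          have i: "Im v = Re v / 2 \<or> Im v = - (Re v / 2)" "Re v \<ge> 0" using v by linarith+
          have "Re (d * v) = 0 \<or> \<bar>Im (d * v)\<bar> \<le> 3/4 * Re (d * v)"
            using s i d(1) by auto
          then show ?thesis using gim mid M1(2) by (meson order_trans)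
        qed
      qed (use v M1 in auto)
      have all: "norm (g u) \<le> M1" if u: "Re u \<ge> 0" for u
      proof (cases "\<bar>Im u\<bar> \<le> 3/4 * Re u")
        case True then show ?thesis by (rule mid)
      next
        case False
        define s :: real where "s = (if Im u \<ge> 0 then 1 else -1)"
        define d where "d = Complex (1/2) s"
        \<comment> \<open>This is \<open>u / d\<close>, computed with
          \<open>norm d ^ 2 = 5/4\<close>.\<close>
        define v where "v = Complex ((Re u / 2 + s * Im u) * (4/5)) ((Im u / 2 - s * Re u) * (4/5))"
        have "d * v = u" by (auto simp: d_def v_def s_def complex_eq_iff algebra_simps)
        moreover have "\<bar>Im v\<bar> \<le> Re v / 2"
        proof (cases "Im u \<ge> 0")
          case True
          then have "Re v = 2/5 * Re u + 4/5 * Im u" "Im v = 2/5 * Im u - 4/5 * Re u"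
            by (simp_all add: v_def s_def field_simps)
          moreover have "Im u > 3/4 * Re u" using False True by simp
          ultimately show ?thesis unfolding abs_le_iff using u by (intro conjI; linarith)
        next
          case neg: False
          then have "Re v = 2/5 * Re u - 4/5 * Im u" "Im v = 2/5 * Im u + 4/5 * Re u"
            by (simp_all add: v_def s_def field_simps)
          moreover have "- Im u > 3/4 * Re u" using False neg by simp
          ultimately show ?thesis unfolding abs_le_iff using u by (intro conjI; linarith)
        qed
        ultimately show ?thesis using cone[OF d_def, of v] by (simp add: s_def)
      qed
      \<comment> \<open>The bound \<open>M1\<close> depends on \<open>\<epsilon>\<close> through
        \<open>C2\<close>; passing to \<open>M0\<close>, which comes from the imaginary axis, makes
        the limit as \<open>\<epsilon>\<close> tends to 0 possible.\<close>
      have "norm (g u) \<le> M0"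
        by (rule PL_halfplane_bounded[OF holg all gim _ u]) (use C0 in \<open>auto simp: M0_def\<close>)
      then show ?thesis by (simp add: ng)
    qed
    have "((\<lambda>\<epsilon>. norm (E u) * exp (- \<epsilon> * Re u) / norm (1 + u) ^ 3)
        \<longlongrightarrow> norm (E u) * exp (- 0 * Re u) / norm (1 + u) ^ 3) (at_right 0)"
      using n1[OF u] by (intro tendsto_intros) auto
    then have "norm (E u) * exp (- 0 * Re u) / norm (1 + u) ^ 3 \<le> M0"
      by (rule tendsto_upperbound) (use main in \<open>auto simp: eventually_at_filter\<close>)
    then show ?thesis using n1[OF u] by (simp add: divide_simps split: if_splits)
  qed
  have cubic: "norm (E u) \<le> (8 * M0) * norm u ^ 3" if u: "1 \<le> norm u" for u
  proof -
    have M0: "M0 > 0" using C0 by (simp add: M0_def)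
    have *: "M0 * norm w ^ 3 \<le> (8 * M0) * norm u ^ 3" if "norm w \<le> 2 * norm u" for w :: complex
    proof -
      have "norm w ^ 3 \<le> (2 * norm u) ^ 3" using that by (intro power_mono) auto
      then show ?thesis using M0 by (simp add: power_mult_distrib)
    qed
    have "norm (1 - u) \<le> 2 * norm u" "norm (1 + u) \<le> 2 * norm u"
      using norm_triangle_ineq4[of 1 u] norm_triangle_ineq[of 1 u] u by auto
    then show ?thesis using lft[of u] rgt[of u] * by (meson linear order_trans)
  qed
  obtain c where c: "\<And>u. E u = (\<Sum>k\<le>3. c k * u ^ k)"
    using Liouville_polynomial[OF hol cubic] by metis
  then have E: "E u = c 0 + c 1 * u + c 2 * u ^ 2 + c 3 * u ^ 3" for u
    by (simp add: eval_nat_numeral)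
  have lim0: "((\<lambda>t. E (- of_real t) / of_real t ^ k) \<longlongrightarrow> 0) at_top" if "k \<ge> 1" for k
  proof (rule Lim_null_comparison)
    show "eventually (\<lambda>t. norm (E (- of_real t) / of_real t ^ k) \<le> \<bar>C1\<bar> * ((1 + t) powr \<alpha> / t)) at_top"
      using eventually_ge_at_top[of 1]
    proof eventually_elim
      case (elim t)
      have "t ^ 1 \<le> t ^ k" using elim that by (intro power_increasing) auto
      then have "(\<bar>C1\<bar> * (1 + t) powr \<alpha>) / t ^ k \<le> (\<bar>C1\<bar> * (1 + t) powr \<alpha>) / t"
        using elim by (intro divide_left_mono) auto
      moreover have "norm (E (- of_real t)) \<le> \<bar>C1\<bar> * (1 + t) powr \<alpha>"
        using neg[of t] elim by (smt (verit) mult_right_mono powr_ge_zero)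
      then have "norm (E (- of_real t)) / t ^ k \<le> (\<bar>C1\<bar> * (1 + t) powr \<alpha>) / t ^ k"
        using elim by (intro divide_right_mono) auto
      ultimately show ?case using elim by (simp add: norm_divide norm_power)
    qed
    have "((\<lambda>t::real. (1 + t) powr \<alpha> / t) \<longlongrightarrow> 0) at_top" using \<alpha> by real_asymp
    then show "((\<lambda>t. \<bar>C1\<bar> * ((1 + t) powr \<alpha> / t)) \<longlongrightarrow> 0) at_top"
      by (rule tendsto_mult_right_zero)
  qed
  have inv: "((\<lambda>t. a / of_real t ^ k) \<longlongrightarrow> 0) at_top" if "k \<ge> 1" for k :: nat and a :: complex
  proof (rule Lim_null_comparison)
    show "eventually (\<lambda>t. norm (a / of_real t ^ k) \<le> norm a * (1 / t)) at_top"
      using eventually_ge_at_top[of 1]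
    proof eventually_elim
      case (elim t)
      have "t ^ 1 \<le> t ^ k" using elim that by (intro power_increasing) auto
      then have "norm a / t ^ k \<le> norm a / t" using elim by (intro divide_left_mono) auto
      then show ?case using elim by (simp add: norm_divide norm_power)
    qed
    have "((\<lambda>t::real. 1 / t) \<longlongrightarrow> 0) at_top" by real_asymp
    then show "((\<lambda>t. norm a * (1 / t)) \<longlongrightarrow> 0) at_top" by (rule tendsto_mult_right_zero)
  qed
  have c3: "c 3 = 0"
  proof -
    have "((\<lambda>t. E (- of_real t) / of_real t ^ 3 - c 0 / of_real t ^ 3 + c 1 / of_real t ^ 2 - c 2 / of_real t ^ 1)
        \<longlongrightarrow> 0 - 0 + 0 - 0) at_top"
      by (intro tendsto_intros lim0 inv) auto
    moreover have "eventually (\<lambda>t. E (- of_real t) / of_real t ^ 3 - c 0 / of_real t ^ 3 + c 1 / of_real t ^ 2 - c 2 / of_real t ^ 1 = - c 3) at_top"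
      using eventually_gt_at_top[of 0]
      by eventually_elim (simp add: E field_simps power2_eq_square power3_eq_cube)
    ultimately have "((\<lambda>t::real. - c 3) \<longlongrightarrow> 0) at_top" by (simp add: tendsto_cong)
    then show ?thesis by (simp add: tendsto_const_iff)
  qed
  have c2: "c 2 = 0"
  proof -
    have "((\<lambda>t. E (- of_real t) / of_real t ^ 2 - c 0 / of_real t ^ 2 + c 1 / of_real t ^ 1)
        \<longlongrightarrow> 0 - 0 + 0) at_top"
      by (intro tendsto_intros lim0 inv) auto
    moreover have "eventually (\<lambda>t. E (- of_real t) / of_real t ^ 2 - c 0 / of_real t ^ 2 + c 1 / of_real t ^ 1 = c 2) at_top"
      using eventually_gt_at_top[of 0]
      by eventually_elim (simp add: E c3 field_simps power2_eq_square)
    ultimately have "((\<lambda>t::real. c 2) \<longlongrightarrow> 0) at_top" by (simp add: tendsto_cong)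
    then show ?thesis by (simp add: tendsto_const_iff)
  qed
  have c1: "c 1 = 0"
  proof -
    have "((\<lambda>t. E (- of_real t) / of_real t ^ 1 - c 0 / of_real t ^ 1) \<longlongrightarrow> 0 - 0) at_top"
      by (intro tendsto_intros lim0 inv) auto
    moreover have "eventually (\<lambda>t. E (- of_real t) / of_real t ^ 1 - c 0 / of_real t ^ 1 = - c 1) at_top"
      using eventually_gt_at_top[of 0]
      by eventually_elim (simp add: E c3 c2 field_simps)
    ultimately have "((\<lambda>t::real. - c 1) \<longlongrightarrow> 0) at_top" by (simp add: tendsto_cong)
    then show ?thesis by (simp add: tendsto_const_iff)
  qed
  show ?thesis using c1 by (simp add: E c2 c3)
qed

section \<open>The Poisson-Jensen inequality\<close>

text \<open>The measure is not normalised: its total mass is \<open>2 \<pi>\<close>.\<close>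

abbreviation circle_space :: "real measure" where
  "circle_space \<equiv> restrict_space lborel {0..2 * pi}"

definition poisson_kernel :: "complex \<Rightarrow> real \<Rightarrow> real" where
  "poisson_kernel z \<theta> = Re ((cis \<theta> + z) / (cis \<theta> - z))"

lemma cis_minus_nz: "norm z < 1 \<Longrightarrow> cis \<theta> - z \<noteq> 0"
  using norm_cis[of \<theta>] by (metis eq_iff_diff_eq_0 less_irrefl)

lemma norm_cis_minus_ge: "1 - norm z \<le> norm (cis \<theta> - z)"
  using norm_triangle_ineq2[of "cis \<theta>" z] by simp

lemma poisson_kernel_eq: "poisson_kernel z \<theta> = (1 - norm z ^ 2) / norm (cis \<theta> - z) ^ 2"
proof -
  have *: "(a + c) * (a - c) + (b + d) * (b - d) = (a\<^sup>2 + b\<^sup>2) - (c\<^sup>2 + d\<^sup>2)" for a b c d :: real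
    by (simp add: power2_eq_square algebra_simps)
  have "(Re (cis \<theta>) + Re z) * (Re (cis \<theta>) - Re z) + (Im (cis \<theta>) + Im z) * (Im (cis \<theta>) - Im z)
      = 1 - ((Re z)\<^sup>2 + (Im z)\<^sup>2)"
    unfolding * by simp
  then show ?thesis unfolding poisson_kernel_def Re_divide cmod_power2 by simp
qed

lemma poisson_kernel_nonneg: "norm z < 1 \<Longrightarrow> 0 \<le> poisson_kernel z \<theta>"
  unfolding poisson_kernel_eq by (intro divide_nonneg_nonneg) (auto intro: power_le_one)

lemma schwarz_kernel_bound:
  assumes "norm z < 1"
  shows "norm ((cis \<theta> + z) / (cis \<theta> - z)) \<le> 2 / (1 - norm z)"
proof -
  have "norm (cis \<theta> + z) \<le> 2" using norm_triangle_ineq[of "cis \<theta>" z] assms by simp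
  then show ?thesis using norm_cis_minus_ge[of z \<theta>] assms
    unfolding norm_divide by (intro frac_le) auto
qed

lemma poisson_kernel_le: "norm z < 1 \<Longrightarrow> poisson_kernel z \<theta> \<le> 2 / (1 - norm z)"
  unfolding poisson_kernel_def using schwarz_kernel_bound[of z \<theta>] complex_Re_le_cmod order_trans by blast

lemma continuous_on_schwarz_kernel:
  "norm z < 1 \<Longrightarrow> continuous_on S (\<lambda>\<theta>. (cis \<theta> + z) / (cis \<theta> - z))"
  by (intro continuous_intros) (use cis_minus_nz in auto)

lemma continuous_on_poisson_kernel: "norm z < 1 \<Longrightarrow> continuous_on S (poisson_kernel z)"
  unfolding poisson_kernel_def by (intro continuous_on_Re continuous_on_schwarz_kernel)

lemma circle_integral_eq: "(LBINT \<theta>:{0..2 * pi}. g \<theta>) = (\<integral>\<theta>. g \<theta> \<partial>circle_space)"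
  for g :: "real \<Rightarrow> 'a::{banach, second_countable_topology}"
  unfolding set_lebesgue_integral_def by (subst integral_restrict_space) auto

lemma circle_integrable_iff: "integrable circle_space g \<longleftrightarrow> set_integrable lborel {0..2 * pi} g"
  for g :: "real \<Rightarrow> 'a::{banach, second_countable_topology}"
  unfolding set_integrable_def by (subst integrable_restrict_space) auto

lemma circle_integrable_continuous:
  fixes g :: "real \<Rightarrow> 'a::{banach, second_countable_topology}"
  shows "continuous_on {0..2 * pi} g \<Longrightarrow> integrable circle_space g"
  unfolding circle_integrable_iff by (rule borel_integrable_atLeastAtMost')

lemma circle_has_integral:
  fixes g :: "real \<Rightarrow> 'a::euclidean_space"
  assumes "continuous_on {0..2 * pi} g"
  shows "(\<integral>\<theta>. g \<theta> \<partial>circle_space) = integral {0..2 * pi} g"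
  using set_borel_integral_eq_integral(2)[of "{0..2 * pi}" g] borel_integrable_atLeastAtMost'[OF assms]
  by (simp add: circle_integral_eq)

lemma circle_measurable_continuous:
  "continuous_on {0..2 * pi} g \<Longrightarrow> g \<in> borel_measurable circle_space"
  for g :: "real \<Rightarrow> 'a::{banach, second_countable_topology}"
  by (rule borel_measurable_integrable[OF circle_integrable_continuous])

text \<open>The two endpoints are discarded as a null set. In the interval they are the only
  parameters with \<open>cis \<theta> = 1\<close>, the one point where the functions considered
  later may vanish.\<close>

lemma AE_circle:
  assumes "\<And>\<theta>. 0 < \<theta> \<Longrightarrow> \<theta> < 2 * pi \<Longrightarrow> P \<theta>"
  shows "AE \<theta> in circle_space. P \<theta>"
proof -
  have "AE \<theta> in lborel. \<theta> \<noteq> 0 \<and> \<theta> \<noteq> 2 * pi"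
    by (intro eventually_conj AE_lborel_singleton)
  then show ?thesis
    by (subst AE_restrict_space_iff, simp, elim eventually_mono) (use assms in force)
qed

lemma cis_neq_one: "0 < \<theta> \<Longrightarrow> \<theta> < 2 * pi \<Longrightarrow> cis \<theta> \<noteq> 1"
proof
  assume *: "0 < \<theta>" "\<theta> < 2 * pi" "cis \<theta> = 1"
  then have "cos \<theta> = 1" by (metis cis.simps(1) one_complex.simps(1))
  then obtain n :: int where "\<theta> = n * 2 * pi" using cos_one_2pi_int by auto
  with * have "0 < n" "n < 1" by (auto simp: zero_less_mult_iff)
  then show False by linarith
qed

text \<open>On the circle the kernel splits as \<open>\<zeta> / (\<zeta> - z) + cnj z * \<zeta> / (1
  - cnj z * \<zeta>)\<close>. The first summand yields Cauchy's formula at \<open>z\<close>; the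
  second is Cauchy's formula at 0 for a function that is holomorphic on the closed disc and vanishes
  at 0.\<close>

lemma poisson_integral_entire:
  fixes Q :: "complex \<Rightarrow> complex"
  assumes Q: "Q holomorphic_on UNIV" and z: "norm z < 1"
  shows "(\<integral>\<theta>. of_real (poisson_kernel z \<theta>) * Q (cis \<theta>) \<partial>circle_space) = 2 * pi * Q z"
proof -
  have QS: "Q holomorphic_on S" for S using Q holomorphic_on_subset by blast
  have nz: "1 - cnj z * w \<noteq> 0" if "norm w \<le> 1" for w
  proof
    assume "1 - cnj z * w = 0"
    then have "norm (cnj z * w) = 1" by (metis eq_iff_diff_eq_0 norm_one)
    moreover have "norm (cnj z) * norm w \<le> norm z * 1" using that by (intro mult_mono) auto
    ultimately show False using z by (simp add: norm_mult)
  qed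
  define f where "f = (\<lambda>w. Q w * cnj z * w / (1 - cnj z * w))"
  have fh: "f holomorphic_on cball 0 1"
    unfolding f_def using nz by (intro holomorphic_intros QS) auto
  have "((\<lambda>u. f u / (u - 0)) has_contour_integral (2 * of_real pi * \<i> * f 0)) (circlepath 0 1)"
    by (rule Cauchy_integral_circlepath)
       (use fh holomorphic_on_imp_continuous_on holomorphic_on_subset ball_subset_cball in \<open>auto simp: dist_norm\<close>)
  then have 1: "((\<lambda>t. f (cis t) / cis t * \<i> * cis t) has_integral 0) {0..2 * pi}"
    unfolding circlepath_def by (subst (asm) has_contour_integral_part_circlepath_iff) (auto simp: f_def)
  have "((\<lambda>u. Q u / (u - z)) has_contour_integral (2 * of_real pi * \<i> * Q z)) (circlepath 0 1)"
    by (rule Cauchy_integral_circlepath)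
       (use QS holomorphic_on_imp_continuous_on z in \<open>auto simp: dist_norm\<close>)
  then have 2: "((\<lambda>t. Q (cis t) / (cis t - z) * \<i> * cis t) has_integral (2 * of_real pi * \<i> * Q z)) {0..2 * pi}"
    unfolding circlepath_def by (subst (asm) has_contour_integral_part_circlepath_iff) auto
  have pk: "of_real (poisson_kernel z t) = cis t / (cis t - z) + cnj z * cis t / (1 - cnj z * cis t)" for t
  proof -
    have c1: "cis t * cnj (cis t) = 1" by (simp add: complex_norm_square[symmetric])
    have "cnj z * cis t / (1 - cnj z * cis t) = (cnj z * cis t) / (cis t * (cnj (cis t) - cnj z))"
      using c1 by (simp add: algebra_simps)
    also have "\<dots> = cnj z / cnj (cis t - z)" by simp
    also have "\<dots> = cnj (z / (cis t - z))" by simp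
    finally have e: "cnj z * cis t / (1 - cnj z * cis t) = cnj (z / (cis t - z))" .
    have d: "cis t / (cis t - z) - z / (cis t - z) = 1"
      using cis_minus_nz[OF z, of t] by (simp add: diff_divide_distrib[symmetric])
    then have im: "Im (cis t / (cis t - z)) = Im (z / (cis t - z))"
      by (metis eq_iff_diff_eq_0 minus_complex.simps(2) one_complex.simps(2))
    have "poisson_kernel z t = Re (cis t / (cis t - z)) + Re (z / (cis t - z))"
      by (simp add: poisson_kernel_def add_divide_distrib)
    moreover have "of_real (Re a + Re b) = a + cnj b" if "Im a = Im b" for a b
      using that by (simp add: complex_eq_iff)
    ultimately show ?thesis unfolding e using im by simp
  qed
  have "((\<lambda>t. - \<i> * (Q (cis t) / (cis t - z) * \<i> * cis t + f (cis t) / cis t * \<i> * cis t))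
      has_integral (- \<i> * (2 * of_real pi * \<i> * Q z + 0))) {0..2 * pi}"
    by (intro has_integral_mult_right has_integral_add 1 2)
  also have "(\<lambda>t. - \<i> * (Q (cis t) / (cis t - z) * \<i> * cis t + f (cis t) / cis t * \<i> * cis t))
      = (\<lambda>t. of_real (poisson_kernel z t) * Q (cis t))"
  proof (rule ext)
    fix t
    have "f (cis t) / cis t * \<i> * cis t = \<i> * f (cis t)" by simp
    then show "- \<i> * (Q (cis t) / (cis t - z) * \<i> * cis t + f (cis t) / cis t * \<i> * cis t)
        = of_real (poisson_kernel z t) * Q (cis t)"
      by (simp only: pk) (simp add: f_def algebra_simps)
  qed
  also have "- \<i> * (2 * of_real pi * \<i> * Q z + 0) = 2 * pi * Q z" by simp
  finally have "((\<lambda>t. of_real (poisson_kernel z t) * Q (cis t)) has_integral (2 * pi * Q z)) {0..2 * pi}" .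
  moreover have "continuous_on {0..2 * pi} (\<lambda>t. of_real (poisson_kernel z t) * Q (cis t))"
    by (intro continuous_intros continuous_on_poisson_kernel z
        continuous_on_compose2[OF holomorphic_on_imp_continuous_on[OF Q]]) auto
  ultimately show ?thesis by (simp add: circle_has_integral integral_unique)
qed

lemma poisson_integral_Re:
  fixes Q :: "complex \<Rightarrow> complex"
  assumes Q: "Q holomorphic_on UNIV" and z: "norm z < 1"
  shows "(\<integral>\<theta>. poisson_kernel z \<theta> * Re (Q (cis \<theta>)) \<partial>circle_space) = 2 * pi * Re (Q z)"
proof -
  have c: "continuous_on {0..2 * pi} (\<lambda>t. of_real (poisson_kernel z t) * Q (cis t))"
    by (intro continuous_intros continuous_on_poisson_kernel z
        continuous_on_compose2[OF holomorphic_on_imp_continuous_on[OF Q]]) auto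
  have "(\<integral>\<theta>. poisson_kernel z \<theta> * Re (Q (cis \<theta>)) \<partial>circle_space)
      = (\<integral>\<theta>. Re (of_real (poisson_kernel z \<theta>) * Q (cis \<theta>)) \<partial>circle_space)"
    by simp
  also have "\<dots> = Re (\<integral>\<theta>. of_real (poisson_kernel z \<theta>) * Q (cis \<theta>) \<partial>circle_space)"
    by (rule integral_Re[OF circle_integrable_continuous[OF c]])
  finally show ?thesis unfolding poisson_integral_entire[OF Q z] by simp
qed

lemma poisson_kernel_integral: "norm z < 1 \<Longrightarrow> (\<integral>\<theta>. poisson_kernel z \<theta> \<partial>circle_space) = 2 * pi"
  using poisson_integral_Re[of "\<lambda>_. 1" z] by simp

text \<open>Since \<open>x * cnj x = 1\<close> on the circle, a real polynomial restricts to a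
  Laurent polynomial there. The factor \<open>cnj x ^ N\<close> stands for the negative powers, so
  that \<open>p\<close> can be an ordinary polynomial.\<close>

lemma real_polynomial_laurent:
  fixes f :: "complex \<Rightarrow> real"
  assumes "real_polynomial_function f"
  shows "\<exists>p N. \<forall>x\<in>sphere 0 1. of_real (f x) = poly p x * cnj x ^ N"
  using assms
proof induction
  case (linear f)
  have cc: "x * cnj x = 1" if "x \<in> sphere 0 1" for x
    using that by (simp add: complex_norm_square[symmetric])
  have "of_real (f x) = poly [:of_real (f 1) / 2 - of_real (f \<i>) / (2 * \<i>) , 0, of_real (f 1) / 2 + of_real (f \<i>) / (2 * \<i>):] x * cnj x ^ 1"
    if x: "x \<in> sphere 0 1" for x
  proof -
    have x_eq: "Re x *\<^sub>R 1 + Im x *\<^sub>R \<i> = x" by (simp add: complex_eq_iff)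
    have "f (Re x *\<^sub>R 1 + Im x *\<^sub>R \<i>) = Re x * f 1 + Im x * f \<i>"
      using linear by (simp add: bounded_linear.linear linear_add linear_scale)
    then have "f x = Re x * f 1 + Im x * f \<i>" unfolding x_eq .
    then have *: "of_real (f x) = of_real (f 1) * of_real (Re x) + of_real (f \<i>) * (of_real (Im x) :: complex)"
      by simp
    have re: "of_real (Re x) = (x + cnj x) / 2" and im: "of_real (Im x) = (x - cnj x) / (2 * \<i>)"
      by (simp_all add: complex_eq_iff Re_divide Im_divide)
    have pe: "poly [:a - b, 0, a + b:] x * cnj x ^ 1 = a * (x * (x * cnj x) + cnj x) + b * (x * (x * cnj x) - cnj x)" for a b
      by (simp add: algebra_simps)
    show ?thesis unfolding pe * re im cc[OF x] by (simp add: algebra_simps add_divide_distrib diff_divide_distrib)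
  qed
  then show ?case by blast
next
  case (const c)
  have "of_real c = poly [:of_real c:] x * cnj x ^ 0" for x :: complex by simp
  then show ?case by blast
next
  case (add f g)
  then obtain p N q M where
    pq: "\<And>x. x \<in> sphere 0 1 \<Longrightarrow> of_real (f x) = poly p x * cnj x ^ N"
      "\<And>x. x \<in> sphere 0 1 \<Longrightarrow> of_real (g x) = poly q x * cnj x ^ M" by blast
  have "of_real (f x + g x) = poly (p * monom 1 M + q * monom 1 N) x * cnj x ^ (N + M)" if x: "x \<in> sphere 0 1" for x
  proof -
    have "x * cnj x = 1" using x by (simp add: complex_norm_square[symmetric])
    then have c: "x ^ k * cnj x ^ k = 1" for k by (simp add: power_mult_distrib[symmetric])
    have "poly (p * monom 1 M + q * monom 1 N) x * cnj x ^ (N + M)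
        = poly p x * cnj x ^ N * (x ^ M * cnj x ^ M) + poly q x * cnj x ^ M * (x ^ N * cnj x ^ N)"
      by (simp add: poly_monom power_add algebra_simps)
    then show ?thesis using pq x by (simp add: c)
  qed
  then show ?case by blast
next
  case (mult f g)
  then obtain p N q M where
    pq: "\<And>x. x \<in> sphere 0 1 \<Longrightarrow> of_real (f x) = poly p x * cnj x ^ N"
      "\<And>x. x \<in> sphere 0 1 \<Longrightarrow> of_real (g x) = poly q x * cnj x ^ M" by blast
  have "of_real (f x * g x) = poly (p * q) x * cnj x ^ (N + M)" if x: "x \<in> sphere 0 1" for x
    using pq x by (simp add: power_add)
  then show ?case by blast
qed

text \<open>A negative frequency \<open>a * cnj x ^ m\<close> has the same real part as its
  conjugate \<open>cnj a * x ^ m\<close>, so it can be reflected into a nonnegative one when only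
  the real part counts.\<close>

lemma real_polynomial_circle_harmonic:
  fixes f :: "complex \<Rightarrow> real"
  assumes "real_polynomial_function f"
  obtains P where "P holomorphic_on UNIV" "\<And>x. x \<in> sphere 0 1 \<Longrightarrow> f x = Re (P x)"
proof -
  obtain p N where p: "\<And>x. x \<in> sphere 0 1 \<Longrightarrow> of_real (f x) = poly p x * cnj x ^ N"
    using real_polynomial_laurent[OF assms] by blast
  define P where "P = (\<lambda>x. \<Sum>k\<le>degree p. if N \<le> k then coeff p k * x ^ (k - N) else cnj (coeff p k) * x ^ (N - k))"
  have "P holomorphic_on UNIV" unfolding P_def
  proof (rule holomorphic_on_sum)
    fix k
    show "(\<lambda>x. if N \<le> k then coeff p k * x ^ (k - N) else cnj (coeff p k) * x ^ (N - k)) holomorphic_on UNIV"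
      by (cases "N \<le> k") (auto intro!: holomorphic_intros)
  qed
  moreover have "f x = Re (P x)" if x: "x \<in> sphere 0 1" for x
  proof -
    have "x * cnj x = 1" using x by (simp add: complex_norm_square[symmetric])
    then have c: "x ^ k * cnj x ^ k = 1" for k by (simp add: power_mult_distrib[symmetric])
    have "f x = Re (poly p x * cnj x ^ N)" using p[OF x] by (metis Re_complex_of_real)
    also have "\<dots> = (\<Sum>k\<le>degree p. Re (coeff p k * x ^ k * cnj x ^ N))"
      by (simp add: poly_altdef sum_distrib_right)
    also have "\<dots> = Re (P x)"
      unfolding P_def Re_sum
    proof (rule sum.cong[OF refl])
      fix k
      show "Re (coeff p k * x ^ k * cnj x ^ N) =
          Re (if N \<le> k then coeff p k * x ^ (k - N) else cnj (coeff p k) * x ^ (N - k))"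
      proof (cases "N \<le> k")
        case True
        then have "coeff p k * x ^ k * cnj x ^ N = coeff p k * x ^ (k - N) * (x ^ N * cnj x ^ N)"
          by (simp add: power_add[symmetric] mult.assoc[symmetric])
        then have "coeff p k * x ^ k * cnj x ^ N = coeff p k * x ^ (k - N)" unfolding c mult_1_right .
        then show ?thesis using True by (simp only: if_True)
      next
        case False
        then have "coeff p k * x ^ k * cnj x ^ N = coeff p k * (x ^ k * cnj x ^ k) * cnj x ^ (N - k)"
          by (simp add: mult.assoc power_add[symmetric])
        then have "coeff p k * x ^ k * cnj x ^ N = cnj (cnj (coeff p k) * x ^ (N - k))" using c by simp
        then show ?thesis using False by (metis complex_cnj(1) cnj.sel(1))
      qed
    qed
    finally show ?thesis .
  qed
  ultimately show thesis using that by blast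
qed

text \<open>The majorant is uniformly close to the real part of a polynomial \<open>P\<close> on the circle, and the maximum
  principle applies to \<open>g exp(- P)\<close>; no factorisation of \<open>g\<close> is needed.\<close>

theorem poisson_jensen:
  assumes g: "g \<in> disc_algebra" and \<psi>: "continuous_on (sphere 0 1) \<psi>"
    and le: "\<And>x. x \<in> sphere 0 1 \<Longrightarrow> norm (g x) \<le> exp (\<psi> x)"
    and z: "norm z < 1" and gz: "g z \<noteq> 0"
  shows "2 * pi * ln (norm (g z)) \<le> (\<integral>\<theta>. poisson_kernel z \<theta> * \<psi> (cis \<theta>) \<partial>circle_space)"
proof (rule field_le_epsilon)
  fix e :: real assume "e > 0"
  \<comment> \<open>The approximation error enters twice, each time multiplied by
    \<open>2 * pi\<close>: once from the maximum principle and once when \<open>Re P\<close> is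
    replaced by \<open>\<psi>\<close> under the integral.\<close>
  define \<tau> where "\<tau> = e / (4 * pi)"
  have \<tau>: "\<tau> > 0" using \<open>e > 0\<close> by (simp add: \<tau>_def)
  obtain q where q: "real_polynomial_function q" "\<And>x. x \<in> sphere 0 1 \<Longrightarrow> \<bar>\<psi> x - q x\<bar> < \<tau>"
    using Stone_Weierstrass_real_polynomial_function[OF compact_sphere \<psi> \<tau>] by blast
  obtain P where P: "P holomorphic_on UNIV" "\<And>x. x \<in> sphere 0 1 \<Longrightarrow> q x = Re (P x)"
    using real_polynomial_circle_harmonic[OF q(1)] by blast
  have PS: "P holomorphic_on S" for S using P(1) holomorphic_on_subset by blast
  have "norm (g z * exp (- P z)) \<le> exp \<tau>"
  proof (rule maximum_modulus_frontier[where S = "cball 0 1" and f = "\<lambda>x. g x * exp (- P x)"])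
    show "(\<lambda>x. g x * exp (- P x)) holomorphic_on interior (cball 0 1)"
      using g by (auto simp: disc_algebra_def intro!: holomorphic_intros PS)
    show "continuous_on (closure (cball 0 1)) (\<lambda>x. g x * exp (- P x))"
      using g by (auto simp: disc_algebra_def intro!: continuous_intros holomorphic_on_imp_continuous_on[OF PS])
    fix x :: complex assume "x \<in> frontier (cball 0 1)"
    then have x: "x \<in> sphere 0 1" by simp
    have "norm (g x * exp (- P x)) \<le> exp (\<psi> x) * exp (- q x)"
      using le[OF x] P(2)[OF x] by (simp add: norm_mult norm_exp_eq_Re)
    also have "\<dots> \<le> exp \<tau>" using q(2)[OF x] by (simp add: exp_add[symmetric])
    finally show "norm (g x * exp (- P x)) \<le> exp \<tau>" .
  qed (use z in auto)
  then have "norm (g z) * exp (- Re (P z)) \<le> exp \<tau>" by (simp only: norm_mult norm_exp_eq_Re uminus_complex.sel)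
  then have "norm (g z) \<le> exp (\<tau> + Re (P z))"
    by (simp add: exp_minus exp_add field_simps)
  then have "exp (ln (norm (g z))) \<le> exp (\<tau> + Re (P z))" using gz by simp
  then have "ln (norm (g z)) \<le> \<tau> + Re (P z)" by (simp only: exp_le_cancel_iff)
  then have "2 * pi * ln (norm (g z)) \<le> 2 * pi * (\<tau> + Re (P z))" by (intro mult_left_mono) auto
  also have "\<dots> = 2 * pi * \<tau> + (\<integral>\<theta>. poisson_kernel z \<theta> * Re (P (cis \<theta>)) \<partial>circle_space)"
    unfolding poisson_integral_Re[OF P(1) z] by (simp add: algebra_simps)
  also have "(\<integral>\<theta>. poisson_kernel z \<theta> * Re (P (cis \<theta>)) \<partial>circle_space)
      \<le> (\<integral>\<theta>. poisson_kernel z \<theta> * \<psi> (cis \<theta>) + poisson_kernel z \<theta> * \<tau> \<partial>circle_space)"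
  proof (rule integral_mono)
    show "integrable circle_space (\<lambda>\<theta>. poisson_kernel z \<theta> * Re (P (cis \<theta>)))"
      by (intro circle_integrable_continuous continuous_intros continuous_on_poisson_kernel z
          continuous_on_compose2[OF holomorphic_on_imp_continuous_on[OF P(1)]]) auto
    show "integrable circle_space (\<lambda>\<theta>. poisson_kernel z \<theta> * \<psi> (cis \<theta>) + poisson_kernel z \<theta> * \<tau>)"
      by (intro circle_integrable_continuous continuous_intros continuous_on_poisson_kernel z
          continuous_on_compose2[OF \<psi>]) auto
    fix \<theta>
    have "Re (P (cis \<theta>)) \<le> \<psi> (cis \<theta>) + \<tau>" using P(2)[of "cis \<theta>"] q(2)[of "cis \<theta>"] by simp
    then have "poisson_kernel z \<theta> * Re (P (cis \<theta>)) \<le> poisson_kernel z \<theta> * (\<psi> (cis \<theta>) + \<tau>)"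
      using poisson_kernel_nonneg[OF z] by (rule mult_left_mono)
    then show "poisson_kernel z \<theta> * Re (P (cis \<theta>)) \<le> poisson_kernel z \<theta> * \<psi> (cis \<theta>) + poisson_kernel z \<theta> * \<tau>"
      by (simp add: algebra_simps)
  qed
  also have "\<dots> = (\<integral>\<theta>. poisson_kernel z \<theta> * \<psi> (cis \<theta>) \<partial>circle_space) + 2 * pi * \<tau>"
    by (subst Bochner_Integration.integral_add)
       (auto intro!: circle_integrable_continuous continuous_intros continuous_on_poisson_kernel z
          continuous_on_compose2[OF \<psi>] simp: poisson_kernel_integral[OF z])
  finally show "2 * pi * ln (norm (g z)) \<le> (\<integral>\<theta>. poisson_kernel z \<theta> * \<psi> (cis \<theta>) \<partial>circle_space) + e"
    by (simp add: \<tau>_def)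
qed

section \<open>Outer functions\<close>

context
  fixes k :: "complex \<Rightarrow> complex"
  assumes k: "k \<in> disc_algebra" and nz: "\<And>z. norm z \<le> 1 \<Longrightarrow> z \<noteq> 1 \<Longrightarrow> k z \<noteq> 0"
begin

lemma continuous_on_circle_comp: "continuous_on (cball 0 1) f \<Longrightarrow> continuous_on S (\<lambda>\<theta>. f (cis \<theta>))"
  by (rule continuous_on_compose2[of "cball 0 1" f]) (auto intro!: continuous_intros)

lemma log_max_continuous:
  assumes "c > 0"
  shows "continuous_on (cball 0 1) (\<lambda>x. ln (max (norm (k x)) c))"
  using k assms by (auto simp: disc_algebra_def intro!: continuous_intros) 

lemma nz_ball: "norm z < 1 \<Longrightarrow> k z \<noteq> 0"
  using nz[of z] by (cases "z = 1") auto

lemma circle_nz: "0 < \<theta> \<Longrightarrow> \<theta> < 2 * pi \<Longrightarrow> k (cis \<theta>) \<noteq> 0"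
  using nz[of "cis \<theta>"] cis_neq_one by simp

lemma log_truncation_tendsto:
  assumes "k x \<noteq> 0"
  shows "(\<lambda>n. ln (max (norm (k x)) (1 / Suc n))) \<longlonglongrightarrow> ln (norm (k x))"
proof -
  have "(\<lambda>n. 1 / real (Suc n)) \<longlonglongrightarrow> 0" using LIMSEQ_inverse_real_of_nat by (simp add: inverse_eq_divide)
  then have "(\<lambda>n. ln (max (norm (k x)) (1 / Suc n))) \<longlonglongrightarrow> ln (max (norm (k x)) 0)"
    using assms by (intro tendsto_intros) auto
  then show ?thesis using assms by simp
qed

text \<open>The Poisson-Jensen inequality asks for a continuous majorant, but the logarithm of
  \<open>norm (k x)\<close> may tend to minus infinity at 1; hence the truncation of the modulus
  from below.\<close>

lemma log_truncation_le:
  assumes "z \<in> ball 0 1"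
  shows "2 * pi * ln (norm (k z)) \<le> (\<integral>\<theta>. poisson_kernel z \<theta> * ln (max (norm (k (cis \<theta>))) (1 / Suc n)) \<partial>circle_space)"
proof (rule poisson_jensen[OF k, where \<psi> = "\<lambda>x. ln (max (norm (k x)) (1 / Suc n))"])
  show "continuous_on (sphere 0 1) (\<lambda>x. ln (max (norm (k x)) (1 / Suc n)))"
    by (rule continuous_on_subset[OF log_max_continuous]) auto
  show "norm (k x) \<le> exp (ln (max (norm (k x)) (1 / Suc n)))" if "x \<in> sphere 0 1" for x
    by (subst exp_ln) (auto simp: less_max_iff_disj)
qed (use assms nz_ball[of z] in auto)

text \<open>Monotone convergence of the truncations: the Poisson-Jensen inequality at the origin
  bounds their integrals below by \<open>2 * pi * ln (norm (k 0))\<close>, a real number that does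
  not depend on the truncation level, and \<open>k 0 \<noteq> 0\<close>.\<close>

lemma log_integrable: "integrable circle_space (\<lambda>\<theta>. ln (norm (k (cis \<theta>))))"
proof -
  define u where "u = (\<lambda>n \<theta>. - ln (max (norm (k (cis \<theta>))) (1 / Suc n)))"
  have u_int: "integrable circle_space (u n)" for n
    unfolding u_def by (intro circle_integrable_continuous continuous_intros
        continuous_on_circle_comp[OF log_max_continuous]) auto
  have u_mono: "u m \<theta> \<le> u n \<theta>" if "m \<le> n" for m n \<theta>
  proof -
    have "1 / real (Suc n) \<le> 1 / real (Suc m)" using that by (intro divide_left_mono) auto
    then have "max (norm (k (cis \<theta>))) (1 / Suc n) \<le> max (norm (k (cis \<theta>))) (1 / Suc m)" by auto
    then show ?thesis unfolding u_def by (simp add: less_max_iff_disj)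
  qed
  have bdd: "(\<integral>\<theta>. u n \<theta> \<partial>circle_space) \<le> - (2 * pi * ln (norm (k 0)))" for n
    using log_truncation_le[of 0 n] by (simp add: u_def poisson_kernel_eq)
  have "incseq (\<lambda>n. \<integral>\<theta>. u n \<theta> \<partial>circle_space)"
    by (rule incseq_SucI) (intro integral_mono u_int u_mono, auto)
  then obtain L where L: "(\<lambda>n. \<integral>\<theta>. u n \<theta> \<partial>circle_space) \<longlonglongrightarrow> L"
    using incseq_convergent[of "\<lambda>n. \<integral>\<theta>. u n \<theta> \<partial>circle_space"] bdd by blast
  have lim: "AE \<theta> in circle_space. (\<lambda>n. u n \<theta>) \<longlonglongrightarrow> - ln (norm (k (cis \<theta>)))"
    unfolding u_def by (rule AE_circle) (intro tendsto_minus log_truncation_tendsto circle_nz)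
  have "continuous_on {0..2 * pi} (\<lambda>\<theta>. k (cis \<theta>))"
    using k by (intro continuous_on_circle_comp) (auto simp: disc_algebra_def)
  from circle_measurable_continuous[OF this]
  have "(\<lambda>\<theta>. - ln (norm (k (cis \<theta>)))) \<in> borel_measurable circle_space" by measurable
  then have "integrable circle_space (\<lambda>\<theta>. - ln (norm (k (cis \<theta>))))"
    by (intro integrable_monotone_convergence[of _ u, OF u_int _ lim L]) (auto simp: mono_def u_mono)
  then show ?thesis by simp
qed

lemma schwarz_integrable:
  assumes "norm z < 1"
  shows "integrable circle_space (\<lambda>\<theta>. (cis \<theta> + z) / (cis \<theta> - z) * of_real (ln (norm (k (cis \<theta>))) / (2 * pi)))"
proof (rule Bochner_Integration.integrable_bound)
  show "integrable circle_space (\<lambda>\<theta>. 2 / (1 - norm z) * (ln (norm (k (cis \<theta>))) / (2 * pi)))"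
    by (intro integrable_mult_right integrable_divide log_integrable)
  have "(\<lambda>\<theta>. (cis \<theta> + z) / (cis \<theta> - z)) \<in> borel_measurable circle_space"
    by (intro circle_measurable_continuous continuous_on_schwarz_kernel assms)
  moreover have "(\<lambda>\<theta>. ln (norm (k (cis \<theta>)))) \<in> borel_measurable circle_space"
    using log_integrable by (rule borel_measurable_integrable)
  ultimately show "(\<lambda>\<theta>. (cis \<theta> + z) / (cis \<theta> - z) * of_real (ln (norm (k (cis \<theta>))) / (2 * pi))) \<in> borel_measurable circle_space"
    by measurable
  show "AE \<theta> in circle_space. norm ((cis \<theta> + z) / (cis \<theta> - z) * of_real (ln (norm (k (cis \<theta>))) / (2 * pi)))
      \<le> norm (2 / (1 - norm z) * (ln (norm (k (cis \<theta>))) / (2 * pi)))"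
  proof (rule AE_I2)
    fix \<theta>
    have "norm ((cis \<theta> + z) / (cis \<theta> - z)) * norm (ln (norm (k (cis \<theta>))) / (2 * pi))
        \<le> norm (2 / (1 - norm z)) * norm (ln (norm (k (cis \<theta>))) / (2 * pi))"
      using schwarz_kernel_bound[OF assms, of \<theta>] assms by (intro mult_right_mono) auto
    then show "norm ((cis \<theta> + z) / (cis \<theta> - z) * of_real (ln (norm (k (cis \<theta>))) / (2 * pi)))
      \<le> norm (2 / (1 - norm z) * (ln (norm (k (cis \<theta>))) / (2 * pi)))"
      by (simp only: norm_mult norm_of_real real_norm_def)
  qed
qed

lemma poisson_log_integrable:
  assumes "norm z < 1"
  shows "integrable circle_space (\<lambda>\<theta>. poisson_kernel z \<theta> * ln (norm (k (cis \<theta>))))"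
    and "2 * pi * Re (\<integral>\<theta>. (cis \<theta> + z) / (cis \<theta> - z) * of_real (ln (norm (k (cis \<theta>))) / (2 * pi)) \<partial>circle_space)
      = (\<integral>\<theta>. poisson_kernel z \<theta> * ln (norm (k (cis \<theta>))) \<partial>circle_space)"
proof -
  have e: "Re ((cis \<theta> + z) / (cis \<theta> - z) * of_real (ln (norm (k (cis \<theta>))) / (2 * pi)))
      = poisson_kernel z \<theta> * ln (norm (k (cis \<theta>))) / (2 * pi)" for \<theta>
  proof -
    have "Re (a * of_real b) = Re a * b" for a b by simp
    then show ?thesis unfolding poisson_kernel_def by (simp only: times_divide_eq_right)
  qed
  have i: "integrable circle_space (\<lambda>\<theta>. poisson_kernel z \<theta> * ln (norm (k (cis \<theta>))) / (2 * pi))"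
    using integrable_Re[OF schwarz_integrable[OF assms]] unfolding e .
  then show "integrable circle_space (\<lambda>\<theta>. poisson_kernel z \<theta> * ln (norm (k (cis \<theta>))))"
    using integrable_mult_right[of "2 * pi", OF i] by simp
  show "2 * pi * Re (\<integral>\<theta>. (cis \<theta> + z) / (cis \<theta> - z) * of_real (ln (norm (k (cis \<theta>))) / (2 * pi)) \<partial>circle_space)
      = (\<integral>\<theta>. poisson_kernel z \<theta> * ln (norm (k (cis \<theta>))) \<partial>circle_space)"
    unfolding integral_Re[OF schwarz_integrable[OF assms], symmetric] e by simp
qed

text \<open>Passage to the limit in \<open>log_truncation_le\<close>. The truncations lie between
  the logarithm itself and the truncation at level 1, so the sum of the absolute values of these
  two, times the kernel, dominates.\<close>

lemma poisson_log_ge: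
  assumes "norm z < 1"
  shows "2 * pi * ln (norm (k z)) \<le> (\<integral>\<theta>. poisson_kernel z \<theta> * ln (norm (k (cis \<theta>))) \<partial>circle_space)"
proof (rule LIMSEQ_le_const)
  define u where "u = (\<lambda>n \<theta>. ln (max (norm (k (cis \<theta>))) (1 / Suc n)))"
  show "\<exists>N. \<forall>n\<ge>N. 2 * pi * ln (norm (k z)) \<le> (\<integral>\<theta>. poisson_kernel z \<theta> * u n \<theta> \<partial>circle_space)"
    using log_truncation_le[of z] assms by (auto simp: u_def)
  show "(\<lambda>n. \<integral>\<theta>. poisson_kernel z \<theta> * u n \<theta> \<partial>circle_space) \<longlonglongrightarrow>
      (\<integral>\<theta>. poisson_kernel z \<theta> * ln (norm (k (cis \<theta>))) \<partial>circle_space)"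
  proof (rule integral_dominated_convergence)
    show "(\<lambda>\<theta>. poisson_kernel z \<theta> * ln (norm (k (cis \<theta>)))) \<in> borel_measurable circle_space"
      by (rule borel_measurable_integrable[OF poisson_log_integrable(1)[OF assms]])
    show "(\<lambda>\<theta>. poisson_kernel z \<theta> * u n \<theta>) \<in> borel_measurable circle_space" for n
      unfolding u_def by (intro circle_measurable_continuous continuous_intros
        continuous_on_circle_comp[OF log_max_continuous] continuous_on_poisson_kernel assms) auto
    have "integrable circle_space (\<lambda>\<theta>. \<bar>poisson_kernel z \<theta> * u 0 \<theta>\<bar>)"
      unfolding u_def by (intro integrable_abs circle_integrable_continuous continuous_intros
        continuous_on_circle_comp[OF log_max_continuous] continuous_on_poisson_kernel assms) auto
    then show "integrable circle_space (\<lambda>\<theta>. \<bar>poisson_kernel z \<theta> * ln (norm (k (cis \<theta>)))\<bar> + \<bar>poisson_kernel z \<theta> * u 0 \<theta>\<bar>)"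
      by (rule Bochner_Integration.integrable_add[OF integrable_abs[OF poisson_log_integrable(1)[OF assms]]])
    show "AE \<theta> in circle_space. (\<lambda>n. poisson_kernel z \<theta> * u n \<theta>) \<longlonglongrightarrow> poisson_kernel z \<theta> * ln (norm (k (cis \<theta>)))"
      unfolding u_def by (rule AE_circle) (intro tendsto_intros log_truncation_tendsto circle_nz)
    show "AE \<theta> in circle_space. norm (poisson_kernel z \<theta> * u n \<theta>)
        \<le> \<bar>poisson_kernel z \<theta> * ln (norm (k (cis \<theta>)))\<bar> + \<bar>poisson_kernel z \<theta> * u 0 \<theta>\<bar>" for n
    proof (rule AE_circle)
      fix \<theta> assume \<theta>: "0 < \<theta>" "\<theta> < 2 * pi"
      have kp: "norm (k (cis \<theta>)) > 0" using circle_nz[OF \<theta>] by simp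
      have "1 / real (Suc n) \<le> 1" by simp
      then have "max (norm (k (cis \<theta>))) (1 / Suc n) \<le> max (norm (k (cis \<theta>))) (1 / Suc 0)"
        by (intro max.mono) auto
      then have "ln (norm (k (cis \<theta>))) \<le> u n \<theta>" "u n \<theta> \<le> u 0 \<theta>"
        using kp unfolding u_def by (intro ln_mono; simp add: less_max_iff_disj)+
      then have "\<bar>u n \<theta>\<bar> \<le> \<bar>ln (norm (k (cis \<theta>)))\<bar> + \<bar>u 0 \<theta>\<bar>" by linarith
      then have "poisson_kernel z \<theta> * \<bar>u n \<theta>\<bar> \<le> poisson_kernel z \<theta> * (\<bar>ln (norm (k (cis \<theta>)))\<bar> + \<bar>u 0 \<theta>\<bar>)"
        using poisson_kernel_nonneg[OF assms] by (rule mult_left_mono)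
      then show "norm (poisson_kernel z \<theta> * u n \<theta>)
        \<le> \<bar>poisson_kernel z \<theta> * ln (norm (k (cis \<theta>)))\<bar> + \<bar>poisson_kernel z \<theta> * u 0 \<theta>\<bar>"
        using poisson_kernel_nonneg[OF assms, of \<theta>] by (simp add: abs_mult algebra_simps)
    qed
  qed
qed

text \<open>Differentiation under the integral sign with an explicit second-order remainder. With
  \<open>a = cis \<theta> - z\<close> the remainder of the kernel is exactly
  \<open>h ^ 2 * (2 * cis \<theta>) / ((a - h) * a ^ 2)\<close>, and \<open>r\<close> keeps both
  factors of the denominator away from 0 uniformly in \<open>\<theta>\<close>, so integrability of
  the logarithm is enough.\<close>

lemma schwarz_holomorphic:
  "(\<lambda>z. \<integral>\<theta>. (cis \<theta> + z) / (cis \<theta> - z) * of_real (ln (norm (k (cis \<theta>))) / (2 * pi)) \<partial>circle_space)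
    holomorphic_on ball 0 1"
proof -
  define l where "l \<theta> = (of_real (ln (norm (k (cis \<theta>))) / (2 * pi)) :: complex)" for \<theta>
  define H where "H z = (\<integral>\<theta>. (cis \<theta> + z) / (cis \<theta> - z) * l \<theta> \<partial>circle_space)" for z
  have l_int: "integrable circle_space (\<lambda>\<theta>. norm (l \<theta>))"
    unfolding l_def norm_of_real by (intro integrable_abs integrable_divide log_integrable) 
  have l_meas: "l \<in> borel_measurable circle_space"
    using borel_measurable_integrable[OF log_integrable] unfolding l_def by measurable
  have "\<exists>D. (H has_field_derivative D) (at z)" if "z \<in> ball 0 1" for z
  proof -
    have z: "norm z < 1" using that by simp
    define r where "r = (1 - norm z) / 2"
    have r: "r > 0" using z by (simp add: r_def)
    define d where "d \<theta> = 2 * cis \<theta> / (cis \<theta> - z) ^ 2 * l \<theta>" for \<theta>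
    define D where "D = (\<integral>\<theta>. d \<theta> \<partial>circle_space)"
    have d_int: "integrable circle_space d"
    proof (rule Bochner_Integration.integrable_bound[OF integrable_mult_right[OF l_int, of "2 / (2 * r) ^ 2"]])
      have "(\<lambda>\<theta>. 2 * cis \<theta> / (cis \<theta> - z) ^ 2) \<in> borel_measurable circle_space"
        using cis_minus_nz[OF z] by (intro circle_measurable_continuous continuous_intros) auto
      then show "d \<in> borel_measurable circle_space" unfolding d_def using l_meas by measurable
      show "AE \<theta> in circle_space. norm (d \<theta>) \<le> norm (2 / (2 * r) ^ 2 * norm (l \<theta>))"
      proof (rule AE_I2)
        fix \<theta>
        have "(2 * r) ^ 2 \<le> norm (cis \<theta> - z) ^ 2"
          using norm_cis_minus_ge[of z \<theta>] z by (intro power_mono) (auto simp: r_def)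
        moreover have "cis \<theta> - z \<noteq> 0" by (rule cis_minus_nz[OF z])
        ultimately have "2 / norm (cis \<theta> - z) ^ 2 \<le> 2 / (2 * r) ^ 2" using r by (intro divide_left_mono) auto
        then have "2 / norm (cis \<theta> - z) ^ 2 * norm (l \<theta>) \<le> 2 / (2 * r) ^ 2 * norm (l \<theta>)" by (rule mult_right_mono) auto
        then show "norm (d \<theta>) \<le> norm (2 / (2 * r) ^ 2 * norm (l \<theta>))"
          using r by (simp add: d_def norm_mult norm_divide norm_power)
      qed
    qed
    define C where "C = (\<integral>\<theta>. 2 / (r * (2 * r) ^ 2) * norm (l \<theta>) \<partial>circle_space)"
    have est: "norm (H (z + h) - H z - h * D) \<le> norm h ^ 2 * C" if h: "norm h < r" for h
    proof -
      have zh: "norm (z + h) < 1" using norm_triangle_ineq[of z h] h r by (simp add: r_def field_simps)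
      have i1: "integrable circle_space (\<lambda>\<theta>. (cis \<theta> + z) / (cis \<theta> - z) * l \<theta>)"
        "integrable circle_space (\<lambda>\<theta>. (cis \<theta> + (z + h)) / (cis \<theta> - (z + h)) * l \<theta>)"
        unfolding l_def using schwarz_integrable z zh by blast+
      have "H (z + h) - H z - h * D =
        (\<integral>\<theta>. (cis \<theta> + (z + h)) / (cis \<theta> - (z + h)) * l \<theta> - (cis \<theta> + z) / (cis \<theta> - z) * l \<theta> - h * d \<theta> \<partial>circle_space)"
        unfolding H_def D_def using i1 d_int by simp
      also have "norm \<dots> \<le> (\<integral>\<theta>. norm h ^ 2 * (2 / (r * (2 * r) ^ 2) * norm (l \<theta>)) \<partial>circle_space)"
      proof (rule order_trans[OF integral_norm_bound], rule integral_mono)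
        show "integrable circle_space (\<lambda>\<theta>. norm ((cis \<theta> + (z + h)) / (cis \<theta> - (z + h)) * l \<theta> - (cis \<theta> + z) / (cis \<theta> - z) * l \<theta> - h * d \<theta>))"
          using i1 d_int by (intro integrable_norm Bochner_Integration.integrable_diff integrable_mult_right)
        show "integrable circle_space (\<lambda>\<theta>. norm h ^ 2 * (2 / (r * (2 * r) ^ 2) * norm (l \<theta>)))"
          by (intro integrable_mult_right l_int)
        fix \<theta>
        define a where "a = cis \<theta> - z"
        have a: "norm a \<ge> 2 * r" using norm_cis_minus_ge[of z \<theta>] by (simp add: a_def r_def)
        have ah: "norm (a - h) \<ge> r" using norm_triangle_ineq2[of a h] a h by simp
        have nza: "a \<noteq> 0" "a - h \<noteq> 0" using a ah r by auto
        have "(cis \<theta> + (z + h)) / (a - h) - (cis \<theta> + z) / a - h * (2 * cis \<theta> / a ^ 2)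
            = h ^ 2 * (2 * cis \<theta>) / ((a - h) * a ^ 2)"
        proof -
          have c: "cis \<theta> = a + z" by (simp add: a_def)
          show ?thesis unfolding c using nza by (simp add: divide_simps) (simp add: power2_eq_square algebra_simps)
        qed
        then have "(cis \<theta> + (z + h)) / (cis \<theta> - (z + h)) * l \<theta> - (cis \<theta> + z) / (cis \<theta> - z) * l \<theta> - h * d \<theta>
            = h ^ 2 * (2 * cis \<theta>) / ((a - h) * a ^ 2) * l \<theta>"
          by (simp add: a_def d_def algebra_simps flip: left_diff_distrib)
        then have "norm ((cis \<theta> + (z + h)) / (cis \<theta> - (z + h)) * l \<theta> - (cis \<theta> + z) / (cis \<theta> - z) * l \<theta> - h * d \<theta>)
            = norm h ^ 2 * (2 / (norm (a - h) * norm a ^ 2) * norm (l \<theta>))"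
          by (simp add: norm_mult norm_divide norm_power)
        also have "\<dots> \<le> norm h ^ 2 * (2 / (r * (2 * r) ^ 2) * norm (l \<theta>))"
          using a ah r by (intro mult_left_mono mult_right_mono divide_left_mono mult_mono power_mono mult_pos_pos) auto
        finally show "norm ((cis \<theta> + (z + h)) / (cis \<theta> - (z + h)) * l \<theta> - (cis \<theta> + z) / (cis \<theta> - z) * l \<theta> - h * d \<theta>)
            \<le> norm h ^ 2 * (2 / (r * (2 * r) ^ 2) * norm (l \<theta>))" .
      qed
      also have "\<dots> = norm h ^ 2 * C" unfolding C_def by simp
      finally show ?thesis .
    qed
    have "((\<lambda>h. (H (z + h) - H z) / h) \<longlongrightarrow> D) (at 0)"
    proof (rule LIM_I)
      fix e :: real assume e: "e > 0"
      have C0: "C \<ge> 0" unfolding C_def using r by (intro integral_nonneg_AE AE_I2) auto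
      define s where "s = min r (e / (C + 1))"
      have s: "s > 0" using r e C0 by (simp add: s_def)
      show "\<exists>s>0. \<forall>h. h \<noteq> 0 \<and> norm (h - 0) < s \<longrightarrow> norm ((H (z + h) - H z) / h - D) < e"
      proof (intro exI[of _ s] conjI allI impI s)
        fix h :: complex assume h: "h \<noteq> 0 \<and> norm (h - 0) < s"
        have "norm ((H (z + h) - H z) / h - D) = norm (H (z + h) - H z - h * D) / norm h"
          using h by (simp add: norm_divide[symmetric] diff_divide_distrib)
        also have "\<dots> \<le> (norm h ^ 2 * C) / norm h"
          using h est[of h] by (intro divide_right_mono) (auto simp: s_def)
        also have "\<dots> = norm h * C" using h by (simp add: power2_eq_square)
        also have "\<dots> \<le> norm h * (C + 1)" by (intro mult_left_mono) auto
        also have "\<dots> < e / (C + 1) * (C + 1)" using h C0 by (intro mult_strict_right_mono) (auto simp: s_def)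
        finally show "norm ((H (z + h) - H z) / h - D) < e" using C0 by simp
      qed
    qed
    then show ?thesis by (auto simp: DERIV_def)
  qed
  then have "H holomorphic_on ball 0 1"
    unfolding holomorphic_on_def field_differentiable_def using has_field_derivative_at_within by blast
  then show ?thesis unfolding H_def l_def .
qed

text \<open>Equality at the origin alone decides: with \<open>H\<close> the exponent in the
  definition of outer functions, \<open>k * exp (- H)\<close> is bounded by 1 in the disc by
  \<open>poisson_log_ge\<close>, and equality in Jensen's inequality gives it modulus 1 at 0, so it
  is constant by the maximum principle. Conversely the defining formula gives equality at every
  point on taking moduli.\<close>

lemma outer_iff_jensen_equality:
  "outer_function k \<longleftrightarrow> (\<integral>\<theta>. ln (norm (k (cis \<theta>))) \<partial>circle_space) \<le> 2 * pi * ln (norm (k 0))"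
  "outer_function k \<Longrightarrow> norm z < 1 \<Longrightarrow>
    2 * pi * ln (norm (k z)) = (\<integral>\<theta>. poisson_kernel z \<theta> * ln (norm (k (cis \<theta>))) \<partial>circle_space)"
proof -
  define H where "H = (\<lambda>z. \<integral>\<theta>. (cis \<theta> + z) / (cis \<theta> - z) * of_real (ln (norm (k (cis \<theta>))) / (2 * pi)) \<partial>circle_space)"
  have outer: "outer_function k \<longleftrightarrow> (\<exists>c. norm c = 1 \<and> (\<forall>z\<in>ball 0 1. k z = c * exp (H z)))"
    unfolding outer_function_def circle_integral_eq H_def using k nz[of 0] by auto
  have ReH: "2 * pi * Re (H z) = (\<integral>\<theta>. poisson_kernel z \<theta> * ln (norm (k (cis \<theta>))) \<partial>circle_space)"
    if "norm z < 1" for z unfolding H_def by (rule poisson_log_integrable(2)[OF that])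
  have ReH0: "2 * pi * Re (H 0) = (\<integral>\<theta>. ln (norm (k (cis \<theta>))) \<partial>circle_space)"
    using ReH[of 0] by (simp add: poisson_kernel_eq)
  show eq: "2 * pi * ln (norm (k z)) = (\<integral>\<theta>. poisson_kernel z \<theta> * ln (norm (k (cis \<theta>))) \<partial>circle_space)"
    if o: "outer_function k" and z: "norm z < 1" for z
  proof -
    from o obtain c where "norm c = 1" "\<forall>z\<in>ball 0 1. k z = c * exp (H z)" unfolding outer by blast
    with z have "norm c = 1" "k z = c * exp (H z)" by auto
    then have "ln (norm (k z)) = Re (H z)" by (simp add: norm_mult norm_exp_eq_Re)
    then show ?thesis using ReH[OF z] by simp
  qed
  show "outer_function k \<longleftrightarrow> (\<integral>\<theta>. ln (norm (k (cis \<theta>))) \<partial>circle_space) \<le> 2 * pi * ln (norm (k 0))"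
  proof
    assume "outer_function k"
    from eq[OF this, of 0] show "(\<integral>\<theta>. ln (norm (k (cis \<theta>))) \<partial>circle_space) \<le> 2 * pi * ln (norm (k 0))"
      by (simp add: poisson_kernel_eq)
  next
    assume le: "(\<integral>\<theta>. ln (norm (k (cis \<theta>))) \<partial>circle_space) \<le> 2 * pi * ln (norm (k 0))"
    define q where "q = (\<lambda>z. k z * exp (- H z))"
    have hol: "q holomorphic_on ball 0 1"
      unfolding q_def H_def using k by (intro holomorphic_intros schwarz_holomorphic) (auto simp: disc_algebra_def)
    have q_le: "norm (q z) \<le> 1" if z: "z \<in> ball 0 1" for z
    proof -
      have "2 * pi * ln (norm (k z)) \<le> 2 * pi * Re (H z)" using poisson_log_ge[of z] ReH[of z] z by simp
      then have "ln (norm (k z)) \<le> Re (H z)" by simp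
      moreover have "norm (k z) > 0" using nz_ball[of z] z by simp
      ultimately have "norm (k z) \<le> exp (Re (H z))" by (metis exp_le_cancel_iff exp_ln)
      then show ?thesis by (simp only: q_def norm_mult norm_exp_eq_Re uminus_complex.sel) (simp add: exp_minus field_simps)
    qed
    have q0: "norm (q 0) = 1"
    proof (rule antisym[OF q_le])
      have "2 * pi * Re (H 0) \<le> 2 * pi * ln (norm (k 0))" using le ReH0 by simp
      then have "exp (Re (H 0)) \<le> exp (ln (norm (k 0)))" by simp
      also have "\<dots> = norm (k 0)" using nz[of 0] by simp
      finally show "1 \<le> norm (q 0)" by (simp only: q_def norm_mult norm_exp_eq_Re uminus_complex.sel) (simp add: exp_minus field_simps)
    qed simp
    have "q constant_on ball 0 1"
      by (rule maximum_modulus_principle[OF hol, of "ball 0 1" 0]) (use q_le q0 in auto)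
    then obtain c where c: "\<And>z. z \<in> ball 0 1 \<Longrightarrow> q z = c" unfolding constant_on_def by blast
    have "k z = c * exp (H z)" if "z \<in> ball 0 1" for z
      using c[OF that] by (simp add: q_def exp_minus field_simps)
    moreover have "norm c = 1" using q0 c[of 0] by simp
    ultimately show "outer_function k" using outer by blast
  qed
qed

text \<open>Replacing \<open>h\<close> by \<open>h / (1 + s - z)\<close> avoids having to evaluate the mean of \<open>ln \<bar>z - 1\<bar>\<close>.\<close>

lemma outer_if_dense_multiples:
  assumes approx: "\<And>\<eta>. \<eta> > 0 \<Longrightarrow> \<exists>h\<in>disc_algebra. \<forall>z\<in>cball 0 1. norm (k z * h z - (z - 1)) \<le> \<eta>"
  shows "outer_function k"
  unfolding outer_iff_jensen_equality(1)
proof -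
  define L where "L = (\<lambda>\<theta>. ln (norm (k (cis \<theta>))))"
  define I where "I = (\<integral>\<theta>. L \<theta> \<partial>circle_space)"
  have L_int: "integrable circle_space L" unfolding L_def by (rule log_integrable)
  have "compact (k ` cball 0 1)" using k by (intro compact_continuous_image) (auto simp: disc_algebra_def)
  from compact_imp_bounded[OF this] obtain M0 where M0: "\<And>z. z \<in> cball 0 1 \<Longrightarrow> norm (k z) \<le> M0"
    unfolding bounded_iff by blast
  define M where "M = M0 + 1"
  have "norm (k 0) \<le> M0" by (rule M0) simp
  then have M: "M > 0" using norm_ge_zero[of "k 0"] unfolding M_def by linarith
  have kM: "norm (k z) \<le> M" if "norm z \<le> 1" for z
    using M0[of z] that by (simp add: M_def)
  have main: "I \<le> 2 * pi * (ln (norm (k 0)) + 2 * ln (1 + s) - ln (1 - s ^ 2))" if s: "0 < s" "s < 1" for s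
  proof -
    \<comment> \<open>The tolerance is \<open>s ^ 2\<close> because
      \<open>s ^ 2 \<le> s * norm (1 + s - z)\<close>; the quotient \<open>g\<close> defined below
      then satisfies \<open>norm (k z) * norm (g z) \<le> 1 + s\<close> on the closed disc.\<close>
    obtain h where h: "h \<in> disc_algebra" "\<And>z. z \<in> cball 0 1 \<Longrightarrow> norm (k z * h z - (z - 1)) \<le> s ^ 2"
      using approx[of "s ^ 2"] s by auto
    have den: "norm (1 + of_real s - z) \<ge> s" "norm (1 + of_real s - z) \<ge> norm (1 - z)" if "norm z \<le> 1" for z :: complex
    proof -
      have Rz: "Re z \<le> 1" using complex_Re_le_cmod[of z] that by simp
      then show "norm (1 + of_real s - z) \<ge> s"
        using complex_Re_le_cmod[of "1 + of_real s - z"] by simp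
      have "(1 - Re z) ^ 2 \<le> (1 + s - Re z) ^ 2" using Rz s by (intro power_mono) auto
      then have "norm (1 - z) ^ 2 \<le> norm (1 + of_real s - z) ^ 2" unfolding cmod_power2 by simp
      then show "norm (1 + of_real s - z) \<ge> norm (1 - z)" by (rule power2_le_imp_le) simp
    qed
    define g where "g = (\<lambda>z. h z / (1 + of_real s - z))"
    have dnz: "1 + of_real s - z \<noteq> 0" if "norm z \<le> 1" for z :: complex using den(1)[OF that] s by auto
    have g: "g \<in> disc_algebra"
      using h(1) dnz unfolding disc_algebra_def g_def by (auto intro!: continuous_intros holomorphic_intros)
    have g_le: "norm (k z) * norm (g z) \<le> 1 + s" if z: "norm z \<le> 1" for z
    proof -
      have "norm (k z * h z) \<le> norm (z - 1) + s ^ 2"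
        using h(2)[of z] z norm_triangle_ineq2[of "k z * h z" "z - 1"] by simp
      also have "\<dots> \<le> norm (1 + of_real s - z) + s * norm (1 + of_real s - z)"
        using den[OF z] s by (intro add_mono) (auto simp: norm_minus_commute power2_eq_square)
      also have "\<dots> = (1 + s) * norm (1 + of_real s - z)" by (simp add: algebra_simps)
      finally show ?thesis using dnz[OF z] by (simp add: g_def norm_mult norm_divide divide_simps)
    qed
    \<comment> \<open>The level at which \<open>g\<close> is truncated must not spoil the bound
      \<open>(1 + s) / norm (k x)\<close> on the circle; it does not, since
      \<open>norm (k x) \<le> M\<close>.\<close>
    define c where "c = (1 + s) / M"
    have c: "c > 0" using s M by (simp add: c_def)
    define \<psi> where "\<psi> = (\<lambda>x. ln (max (norm (g x)) c))"
    have \<psi>c: "continuous_on (cball 0 1) \<psi>"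
      using g c unfolding \<psi>_def by (auto simp: disc_algebra_def less_max_iff_disj intro!: continuous_intros)
    \<comment> \<open>At the origin the approximation reads
      \<open>norm (k 0 * h 0 + 1) \<le> s ^ 2\<close>, so \<open>g 0\<close> is nearly as large as
      \<open>1 / norm (k 0)\<close>; Jensen's inequality for \<open>g\<close> then bounds the mean
      logarithm of \<open>k\<close> from above.\<close>
    have g0: "norm (k 0) * norm (g 0) * (1 + s) \<ge> 1 - s ^ 2"
    proof -
      have "norm (k 0 * h 0 + 1) \<le> s ^ 2" using h(2)[of 0] by simp
      then have "1 - s ^ 2 \<le> norm (k 0 * h 0)" using norm_triangle_ineq2[of 1 "- (k 0 * h 0)"] by (simp add: add.commute)
      moreover have "norm (1 + of_real s :: complex) = 1 + s" using s by (metis abs_of_pos add_pos_pos norm_of_real of_real_1 of_real_add zero_less_one)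
      ultimately show ?thesis using s by (simp add: g_def norm_mult norm_divide)
    qed
    have s2: "1 - s ^ 2 > 0" using s by (simp add: power_less_one_iff)
    have k0: "norm (k 0) > 0" using nz[of 0] by simp
    have g0nz: "norm (g 0) > 0" using g0 s2 by (cases "g 0 = 0") auto
    have "2 * pi * ln (norm (g 0)) \<le> (\<integral>\<theta>. poisson_kernel 0 \<theta> * \<psi> (cis \<theta>) \<partial>circle_space)"
    proof (rule poisson_jensen[OF g])
      show "continuous_on (sphere 0 1) \<psi>" by (rule continuous_on_subset[OF \<psi>c]) auto
      show "norm (g x) \<le> exp (\<psi> x)" for x
        unfolding \<psi>_def using c by (subst exp_ln) (auto simp: less_max_iff_disj)
    qed (use g0nz in auto)
    also have "\<dots> = (\<integral>\<theta>. \<psi> (cis \<theta>) \<partial>circle_space)" by (simp add: poisson_kernel_eq)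
    also have "\<dots> \<le> (\<integral>\<theta>. ln (1 + s) - L \<theta> \<partial>circle_space)"
    proof (rule integral_mono_AE)
      show "integrable circle_space (\<lambda>\<theta>. \<psi> (cis \<theta>))"
        by (intro circle_integrable_continuous continuous_on_circle_comp \<psi>c)
      show "integrable circle_space (\<lambda>\<theta>. ln (1 + s) - L \<theta>)"
        by (intro Bochner_Integration.integrable_diff L_int circle_integrable_continuous continuous_intros)
      show "AE \<theta> in circle_space. \<psi> (cis \<theta>) \<le> ln (1 + s) - L \<theta>"
      proof (rule AE_circle)
        fix \<theta> assume \<theta>: "0 < \<theta>" "\<theta> < 2 * pi"
        have kp: "norm (k (cis \<theta>)) > 0" using circle_nz[OF \<theta>] by simp
        have "norm (g (cis \<theta>)) \<le> (1 + s) / norm (k (cis \<theta>))"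
          using g_le[of "cis \<theta>"] kp by (simp add: field_simps)
        moreover have "c \<le> (1 + s) / norm (k (cis \<theta>))"
          unfolding c_def using M kM[of "cis \<theta>"] kp s by (intro divide_left_mono mult_pos_pos) auto
        ultimately have "ln (max (norm (g (cis \<theta>))) c) \<le> ln ((1 + s) / norm (k (cis \<theta>)))"
          using c by (intro ln_mono) (auto simp: less_max_iff_disj)
        also have "\<dots> = ln (1 + s) - L \<theta>" using kp s by (simp add: ln_div L_def)
        finally show "\<psi> (cis \<theta>) \<le> ln (1 + s) - L \<theta>" by (simp add: \<psi>_def)
      qed
    qed
    also have "\<dots> = 2 * pi * ln (1 + s) - I"
    proof -
      have "(\<integral>\<theta>. ln (1 + s) - L \<theta> \<partial>circle_space) = (\<integral>\<theta>. ln (1 + s) \<partial>circle_space) - I"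
        unfolding I_def by (intro Bochner_Integration.integral_diff L_int circle_integrable_continuous continuous_intros)
      also have "(\<integral>\<theta>. ln (1 + s) \<partial>circle_space) = 2 * pi * ln (1 + s)"
        by (subst circle_has_integral) auto
      finally show ?thesis .
    qed
    finally have 1: "2 * pi * ln (norm (g 0)) \<le> 2 * pi * ln (1 + s) - I" .
    have "ln (1 - s ^ 2) \<le> ln (norm (k 0) * norm (g 0) * (1 + s))" using g0 s2 by (intro ln_mono)
    also have "\<dots> = ln (norm (k 0)) + ln (norm (g 0)) + ln (1 + s)" using k0 g0nz s by (simp add: ln_mult)
    finally have "2 * pi * (ln (1 - s ^ 2) - ln (norm (k 0)) - ln (1 + s)) \<le> 2 * pi * ln (norm (g 0))"
      by (intro mult_left_mono) auto
    then show ?thesis using 1 by (simp add: algebra_simps)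
  qed
  \<comment> \<open>As \<open>s\<close> tends to 0 the correction terms \<open>ln (1 + s)\<close>
    and \<open>ln (1 - s ^ 2)\<close> vanish, and the reverse Jensen inequality for \<open>k\<close>
    remains.\<close>
  have "((\<lambda>s. 2 * pi * (ln (norm (k 0)) + 2 * ln (1 + s) - ln (1 - s ^ 2)))
      \<longlongrightarrow> 2 * pi * (ln (norm (k 0)) + 2 * ln (1 + 0) - ln (1 - 0 ^ 2))) (at_right 0)"
    by (intro tendsto_intros) auto
  moreover have "eventually (\<lambda>s. I \<le> 2 * pi * (ln (norm (k 0)) + 2 * ln (1 + s) - ln (1 - s ^ 2))) (at_right 0)"
    using eventually_at_right_real[OF zero_less_one] by eventually_elim (use main in auto)
  ultimately have "I \<le> 2 * pi * (ln (norm (k 0)) + 2 * ln (1 + 0) - ln (1 - 0 ^ 2))"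
    by (intro tendsto_lowerbound) auto
  then show "(\<integral>\<theta>. ln (norm (k (cis \<theta>))) \<partial>circle_space) \<le> 2 * pi * ln (norm (k 0))"
    by (simp add: I_def L_def)
qed

end


text \<open>The truncation errors \<open>\<rho> n w\<close> decrease to \<open>0\<close>. They are continuous in \<open>w\<close> because outerness turns the
  mean of \<open>ln \<bar>F(\<cdot>, w)\<bar>\<close> into \<open>ln \<bar>F(0, w)\<bar>\<close>, so the convergence is uniform.\<close>

theorem outer_family_lower_bound:
  fixes F :: "complex \<times> complex \<Rightarrow> complex"
  assumes cont: "continuous_on closed_bidisc F"
    and nz: "\<And>z w. norm z \<le> 1 \<Longrightarrow> norm w \<le> 1 \<Longrightarrow> z \<noteq> 1 \<Longrightarrow> F (z, w) \<noteq> 0"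
    and outer: "\<And>w. norm w \<le> 1 \<Longrightarrow> outer_function (\<lambda>z. F (z, w))"
    and \<epsilon>: "\<epsilon> > 0"
  obtains c where "c > 0"
    "\<And>z w. norm z < 1 \<Longrightarrow> norm w \<le> 1 \<Longrightarrow> norm (F (z, w)) \<ge> c * exp (- \<epsilon> / (1 - norm z))"
proof -
  define u where "u n w \<theta> = ln (max (norm (F (cis \<theta>, w))) (1 / Suc n))" for n w \<theta>
  define \<rho> where "\<rho> n w = integral {0..2 * pi} (u n w) - 2 * pi * ln (norm (F (0, w)))" for n w
  have disc: "(\<lambda>z. F (z, w)) \<in> disc_algebra" if "norm w \<le> 1" for w
    using outer[OF that] by (simp add: outer_function_def)
  have u_cont2: "continuous_on (cball 0 1 \<times> cbox 0 (2 * pi)) (\<lambda>(w, \<theta>). u n w \<theta>)" for n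
  proof -
    have "continuous_on (cball 0 1 \<times> cbox 0 (2 * pi)) (\<lambda>p. F (cis (snd p), fst p))"
      by (rule continuous_on_compose2[OF cont]) (auto intro!: continuous_intros)
    moreover have "max x (1 / real (Suc n)) \<noteq> 0" for x using less_max_iff_disj[of 0 x "1 / real (Suc n)"] by auto
    ultimately show ?thesis unfolding u_def case_prod_unfold by (intro continuous_intros) auto
  qed
  have u_cont: "continuous_on {0..2 * pi} (u n w)" if "norm w \<le> 1" for n w
    by (rule continuous_on_compose2[OF u_cont2[of n], of _ "\<lambda>\<theta>. (w, \<theta>)", simplified])
       (use that in \<open>auto intro!: continuous_intros\<close>)
  have \<rho>_cont: "continuous_on (cball 0 1) (\<rho> n)" for n
  proof -
    have "continuous_on (cball 0 1) (\<lambda>w. integral (cbox 0 (2 * pi)) (u n w))"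
      by (rule integral_continuous_on_param[OF u_cont2])
    moreover have "continuous_on (cball 0 1) (\<lambda>w. ln (norm (F (0, w))))"
      using nz[of 0] by (intro continuous_intros continuous_on_compose2[OF cont]) auto
    ultimately show ?thesis unfolding \<rho>_def
      by (intro continuous_on_diff continuous_on_mult continuous_on_const) simp_all
  qed
  have \<rho>_eq: "\<rho> n w = (\<integral>\<theta>. u n w \<theta> - ln (norm (F (cis \<theta>, w))) \<partial>circle_space)"
    and diff_int: "integrable circle_space (\<lambda>\<theta>. u n w \<theta> - ln (norm (F (cis \<theta>, w))))" if w: "norm w \<le> 1" for n w
  proof -
    have i: "integrable circle_space (u n w)" "integrable circle_space (\<lambda>\<theta>. ln (norm (F (cis \<theta>, w))))"
      using circle_integrable_continuous[OF u_cont[OF w]] log_integrable[OF disc[OF w]] nz w by auto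
    then show "integrable circle_space (\<lambda>\<theta>. u n w \<theta> - ln (norm (F (cis \<theta>, w))))" by auto
    have "2 * pi * ln (norm (F (0, w))) = (\<integral>\<theta>. ln (norm (F (cis \<theta>, w))) \<partial>circle_space)"
      using outer_iff_jensen_equality(2)[OF disc[OF w] _ outer[OF w], of 0] nz w by (simp add: poisson_kernel_eq)
    then show "\<rho> n w = (\<integral>\<theta>. u n w \<theta> - ln (norm (F (cis \<theta>, w))) \<partial>circle_space)"
      unfolding \<rho>_def using i circle_has_integral[OF u_cont[OF w]] by simp
  qed
  have u_dec: "u n w \<theta> \<le> u m w \<theta>" if "m \<le> n" for m n w \<theta>
  proof -
    have "1 / real (Suc n) \<le> 1 / real (Suc m)" using that by (intro divide_left_mono) auto
    then have "max (norm (F (cis \<theta>, w))) (1 / Suc n) \<le> max (norm (F (cis \<theta>, w))) (1 / Suc m)" by auto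
    then show ?thesis unfolding u_def by (simp add: less_max_iff_disj)
  qed
  have \<rho>_dec: "\<rho> n w \<le> \<rho> m w" if "m \<le> n" "norm w \<le> 1" for m n w
    unfolding \<rho>_eq[OF that(2)] by (intro integral_mono diff_int that) (use u_dec[OF that(1)] in auto)
  have Fnz: "F (cis \<theta>, w) \<noteq> 0" if "0 < \<theta>" "\<theta> < 2 * pi" "norm w \<le> 1" for \<theta> w
    using nz[of "cis \<theta>" w] that cis_neq_one by simp
  have u_ge: "ln (norm (F (cis \<theta>, w))) \<le> u n w \<theta>" if "0 < \<theta>" "\<theta> < 2 * pi" "norm w \<le> 1" for \<theta> w n
    unfolding u_def using Fnz[OF that] by (intro ln_mono) auto
  have \<rho>_lim: "(\<lambda>n. \<rho> n w) \<longlonglongrightarrow> 0" if w: "norm w \<le> 1" for w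
  proof -
    have "(\<lambda>n. \<integral>\<theta>. u n w \<theta> - ln (norm (F (cis \<theta>, w))) \<partial>circle_space) \<longlonglongrightarrow> (\<integral>\<theta>. 0 \<partial>circle_space)"
    proof (rule integral_dominated_convergence)
      show "integrable circle_space (\<lambda>\<theta>. u 0 w \<theta> - ln (norm (F (cis \<theta>, w))))" by (rule diff_int[OF w])
      show "(\<lambda>\<theta>. u n w \<theta> - ln (norm (F (cis \<theta>, w)))) \<in> borel_measurable circle_space" for n
        by (rule borel_measurable_integrable[OF diff_int[OF w]])
      show "AE \<theta> in circle_space. (\<lambda>n. u n w \<theta> - ln (norm (F (cis \<theta>, w)))) \<longlonglongrightarrow> 0"
      proof (rule AE_circle)
        fix \<theta> assume "0 < \<theta>" "\<theta> < 2 * pi"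
        from log_truncation_tendsto[of "\<lambda>z. F (z, w)", OF disc[OF w] _ Fnz[OF this w]] nz w
        have "(\<lambda>n. u n w \<theta>) \<longlonglongrightarrow> ln (norm (F (cis \<theta>, w)))" unfolding u_def by blast
        from tendsto_diff[OF this tendsto_const[of "ln (norm (F (cis \<theta>, w)))"]]
        show "(\<lambda>n. u n w \<theta> - ln (norm (F (cis \<theta>, w)))) \<longlonglongrightarrow> 0" by simp
      qed
      show "AE \<theta> in circle_space. norm (u n w \<theta> - ln (norm (F (cis \<theta>, w)))) \<le> u 0 w \<theta> - ln (norm (F (cis \<theta>, w)))" for n
      proof (rule AE_circle)
        fix \<theta> assume "0 < \<theta>" "\<theta> < 2 * pi"
        from u_ge[OF this w, of n] u_dec[of 0 n w \<theta>]
        show "norm (u n w \<theta> - ln (norm (F (cis \<theta>, w)))) \<le> u 0 w \<theta> - ln (norm (F (cis \<theta>, w)))" by simp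
      qed
    qed simp
    then show ?thesis unfolding \<rho>_eq[OF w] by simp
  qed
  \<comment> \<open>The kernel is at most \<open>2 / (1 - norm z)\<close>, so an integrated
    truncation error below \<open>\<epsilon> * pi\<close> costs at most
    \<open>\<epsilon> / (1 - norm z)\<close> after division by \<open>2 * pi\<close>.\<close>
  define \<delta> where "\<delta> = \<epsilon> * pi"
  have \<delta>: "\<delta> > 0" using \<epsilon> by (simp add: \<delta>_def)
  have "\<exists>n. \<forall>w\<in>cball 0 1. \<rho> n w < \<delta>"
  proof (rule ccontr)
    assume no: "\<not> ?thesis"
    \<comment> \<open>If no \<open>n\<close> served all \<open>w\<close>, these nested nonempty
      compact sets would share a point, at which the errors could not tend to 0.\<close>
    define K where "K n = {w \<in> cball 0 1. \<delta> \<le> \<rho> n w}" for n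
    have "compact (K n) \<and> K n \<noteq> {}" for n
    proof
      have "closed (K n)" unfolding K_def
        by (rule continuous_on_closed_Collect_le) (auto simp: \<rho>_cont)
      then show "compact (K n)" unfolding K_def using bounded_subset[OF bounded_cball]
        by (metis (no_types, lifting) compact_eq_bounded_closed mem_Collect_eq subsetI)
      from no obtain w where "w \<in> cball 0 1" "\<not> \<rho> n w < \<delta>" by blast
      then show "K n \<noteq> {}" unfolding K_def not_less by blast
    qed
    moreover have "K n \<subseteq> K m" if "m \<le> n" for m n
      using \<rho>_dec[OF that] unfolding K_def by fastforce
    ultimately have "\<Inter> (range K) \<noteq> {}" by (intro compact_nest) auto
    then obtain w where w: "\<And>n. w \<in> K n" by auto
    then have "norm w \<le> 1" "\<And>n. \<delta> \<le> \<rho> n w" by (auto simp: K_def)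
    then have "\<delta> \<le> 0" using \<rho>_lim by (meson LIMSEQ_le_const)
    with \<delta> show False by simp
  qed
  then obtain n where "\<forall>w\<in>cball 0 1. \<rho> n w < \<delta>" by blast
  then have n: "\<rho> n w < \<delta>" if "norm w \<le> 1" for w using that by auto
  define c where "c = 1 / real (Suc n)"
  have c: "c > 0" by (simp add: c_def)
  have "norm (F (z, w)) \<ge> c * exp (- \<epsilon> / (1 - norm z))" if z: "norm z < 1" and w: "norm w \<le> 1" for z w
  proof -
    have nzw: "\<And>z. norm z \<le> 1 \<Longrightarrow> z \<noteq> 1 \<Longrightarrow> F (z, w) \<noteq> 0" using nz w by blast
    define L where "L \<theta> = ln (norm (F (cis \<theta>, w)))" for \<theta>
    have L_eq: "2 * pi * ln (norm (F (z, w))) = (\<integral>\<theta>. poisson_kernel z \<theta> * L \<theta> \<partial>circle_space)"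
      unfolding L_def using outer_iff_jensen_equality(2)[OF disc[OF w] nzw outer[OF w] z] .
    have int: "integrable circle_space (\<lambda>\<theta>. poisson_kernel z \<theta> * ln c - 2 / (1 - norm z) * (u n w \<theta> - L \<theta>))"
      unfolding L_def by (intro Bochner_Integration.integrable_diff integrable_mult_right diff_int w
        circle_integrable_continuous continuous_intros continuous_on_poisson_kernel z)
    \<comment> \<open>The logarithm is the truncation minus the error. The truncation is at least
      \<open>ln c\<close> and is integrated against the kernel itself; only the nonnegative error is
      charged with the supremum of the kernel.\<close>
    have "2 * pi * ln c - 2 / (1 - norm z) * \<rho> n w
        = (\<integral>\<theta>. poisson_kernel z \<theta> * ln c - 2 / (1 - norm z) * (u n w \<theta> - L \<theta>) \<partial>circle_space)"
    proof -
      have gen: "(\<integral>\<theta>. poisson_kernel z \<theta> * ln c - C * v \<theta> \<partial>circle_space) = 2 * pi * ln c - C * (\<integral>\<theta>. v \<theta> \<partial>circle_space)"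
        if v: "integrable circle_space v" for v C
      proof -
        have "integrable circle_space (poisson_kernel z)"
          by (intro circle_integrable_continuous continuous_on_poisson_kernel z)
        then show ?thesis using v by (simp add: poisson_kernel_integral[OF z])
      qed
      show ?thesis unfolding \<rho>_eq[OF w] L_def by (rule gen[OF diff_int[OF w], symmetric])
    qed
    also have "\<dots> \<le> (\<integral>\<theta>. poisson_kernel z \<theta> * L \<theta> \<partial>circle_space)"
    proof (rule integral_mono_AE[OF int])
      show "integrable circle_space (\<lambda>\<theta>. poisson_kernel z \<theta> * L \<theta>)"
        unfolding L_def by (rule poisson_log_integrable(1)[OF disc[OF w] nzw z])
      show "AE \<theta> in circle_space. poisson_kernel z \<theta> * ln c - 2 / (1 - norm z) * (u n w \<theta> - L \<theta>) \<le> poisson_kernel z \<theta> * L \<theta>"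
      proof (rule AE_circle)
        fix \<theta> assume "0 < \<theta>" "\<theta> < 2 * pi"
        then have d: "u n w \<theta> - L \<theta> \<ge> 0" using u_ge w by (simp add: L_def)
        have "ln c \<le> u n w \<theta>" unfolding u_def c_def by (intro ln_mono) auto
        then have "poisson_kernel z \<theta> * ln c \<le> poisson_kernel z \<theta> * u n w \<theta>"
          using poisson_kernel_nonneg[OF z] by (rule mult_left_mono)
        moreover have "poisson_kernel z \<theta> * (u n w \<theta> - L \<theta>) \<le> 2 / (1 - norm z) * (u n w \<theta> - L \<theta>)"
          using poisson_kernel_le[OF z] d by (rule mult_right_mono)
        ultimately show "poisson_kernel z \<theta> * ln c - 2 / (1 - norm z) * (u n w \<theta> - L \<theta>) \<le> poisson_kernel z \<theta> * L \<theta>"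
          unfolding right_diff_distrib by linarith
      qed
    qed
    finally have "2 * pi * ln c - 2 / (1 - norm z) * \<rho> n w \<le> 2 * pi * ln (norm (F (z, w)))" using L_eq by simp
    moreover have "2 / (1 - norm z) * \<rho> n w \<le> 2 / (1 - norm z) * \<delta>"
      using n[OF w] z by (intro mult_left_mono) auto
    ultimately have "2 * pi * ln c - 2 / (1 - norm z) * \<delta> \<le> 2 * pi * ln (norm (F (z, w)))" by linarith
    moreover have "2 * pi * ln c - 2 / (1 - norm z) * \<delta> = 2 * pi * (ln c - \<epsilon> / (1 - norm z))"
      by (simp add: \<delta>_def algebra_simps)
    ultimately have "ln c - \<epsilon> / (1 - norm z) \<le> ln (norm (F (z, w)))" by simp
    moreover have "norm (F (z, w)) > 0" using nzw[of z] z by (cases "z = 1") auto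
    ultimately have "exp (ln c - \<epsilon> / (1 - norm z)) \<le> norm (F (z, w))" by (metis exp_le_cancel_iff exp_ln)
    then show ?thesis using c by (simp add: exp_diff exp_minus field_simps)
  qed
  then show thesis using that c by blast
qed

section \<open>Weighted Wiener algebras on the bidisc\<close>

text \<open>The weight is a parameter so that one development serves both
  \<open>power_weight \<alpha> \<beta>\<close> and \<open>power_weight \<alpha> 0\<close>;
  norm-controlled inversion plays the two norms against each other.\<close>

definition wiener_algebra :: "(nat \<times> nat \<Rightarrow> real) \<Rightarrow> (complex \<times> complex \<Rightarrow> complex) set" where
  "wiener_algebra W = {f \<in> bidisc_algebra. \<exists>a. power_series_of f a \<and> (\<lambda>p. norm (a p) * W p) summable_on UNIV}"

definition wiener_norm :: "(nat \<times> nat \<Rightarrow> real) \<Rightarrow> (complex \<times> complex \<Rightarrow> complex) \<Rightarrow> real" where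
  "wiener_norm W f = (\<Sum>\<^sub>\<infinity>p. norm (taylor_coeff f p) * W p)"

definition power_weight :: "real \<Rightarrow> real \<Rightarrow> nat \<times> nat \<Rightarrow> real" where
  "power_weight \<alpha> \<beta> = (\<lambda>(n, m). (1 + real n) powr \<alpha> * (1 + real m) powr \<beta>)"

lemma weighted_term_eq: "weighted_term \<alpha> \<beta> a = (\<lambda>p. norm (a p) * power_weight \<alpha> \<beta> p)"
  by (auto simp: weighted_term_def power_weight_def fun_eq_iff mult.assoc)

lemma weighted_algebra_eq: "weighted_algebra \<alpha> \<beta> = wiener_algebra (power_weight \<alpha> \<beta>)"
  by (simp add: weighted_algebra_def wiener_algebra_def weighted_term_eq)

lemma weighted_norm_eq: "weighted_norm \<alpha> \<beta> = wiener_norm (power_weight \<alpha> \<beta>)"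
  by (simp add: weighted_norm_def wiener_norm_def weighted_term_eq fun_eq_iff)

lemma wiener_norm_eq: "power_series_of f a \<Longrightarrow> wiener_norm W f = (\<Sum>\<^sub>\<infinity>p. norm (a p) * W p)"
  by (simp add: wiener_norm_def taylor_coeff_eq)

lemma wiener_algebraE:
  assumes "f \<in> wiener_algebra W"
  obtains a where "f \<in> bidisc_algebra" "power_series_of f a" "(\<lambda>p. norm (a p) * W p) summable_on UNIV"
    "wiener_norm W f = (\<Sum>\<^sub>\<infinity>p. norm (a p) * W p)"
  using assms wiener_norm_eq unfolding wiener_algebra_def by blast

section \<open>Closure properties of the bidisc algebra\<close>

lemma holomorphic2I:
  assumes "(f has_derivative f') F" "\<And>h k. f' (h, k) = a * h + b * k"
  shows "\<exists>a b. (f has_derivative (\<lambda>(h, k). a * h + b * k)) F"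
proof -
  have "f' = (\<lambda>(h, k). a * h + b * k)" using assms(2) by (auto simp: fun_eq_iff)
  then show ?thesis using assms(1) by blast
qed

lemma holomorphic2E:
  assumes "f \<in> bidisc_algebra" "p \<in> bidisc"
  obtains a b where "(f has_derivative (\<lambda>(h, k). a * h + b * k)) (at p within bidisc)"
  using assms unfolding bidisc_algebra_def holomorphic2_on_def by blast

lemma bidisc_algebraI:
  assumes "continuous_on closed_bidisc f"
    and "\<And>p. p \<in> bidisc \<Longrightarrow> \<exists>a b. (f has_derivative (\<lambda>(h, k). a * h + b * k)) (at p within bidisc)"
  shows "f \<in> bidisc_algebra"
  using assms unfolding bidisc_algebra_def holomorphic2_on_def by blast

lemma bidisc_algebra_continuous: "f \<in> bidisc_algebra \<Longrightarrow> continuous_on closed_bidisc f"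
  by (simp add: bidisc_algebra_def)

lemma bidisc_algebra_add:
  assumes "f \<in> bidisc_algebra" "g \<in> bidisc_algebra"
  shows "(\<lambda>p. f p + g p) \<in> bidisc_algebra"
proof (rule bidisc_algebraI)
  show "continuous_on closed_bidisc (\<lambda>p. f p + g p)"
    using assms by (intro continuous_intros bidisc_algebra_continuous)
  fix p :: "complex \<times> complex" assume p: "p \<in> bidisc"
  obtain a b where ab: "(f has_derivative (\<lambda>(h, k). a * h + b * k)) (at p within bidisc)"
    by (rule holomorphic2E[OF assms(1) p])
  obtain c d where cd: "(g has_derivative (\<lambda>(h, k). c * h + d * k)) (at p within bidisc)"
    by (rule holomorphic2E[OF assms(2) p])
  show "\<exists>a b. ((\<lambda>p. f p + g p) has_derivative (\<lambda>(h, k). a * h + b * k)) (at p within bidisc)"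
    by (rule holomorphic2I[OF has_derivative_add[OF ab cd], where a = "a + c" and b = "b + d"])
       (simp add: algebra_simps)
qed

lemma bidisc_algebra_mult:
  assumes "f \<in> bidisc_algebra" "g \<in> bidisc_algebra"
  shows "(\<lambda>p. f p * g p) \<in> bidisc_algebra"
proof (rule bidisc_algebraI)
  show "continuous_on closed_bidisc (\<lambda>p. f p * g p)"
    using assms by (intro continuous_intros bidisc_algebra_continuous)
  fix p :: "complex \<times> complex" assume p: "p \<in> bidisc"
  obtain a b where ab: "(f has_derivative (\<lambda>(h, k). a * h + b * k)) (at p within bidisc)"
    by (rule holomorphic2E[OF assms(1) p])
  obtain c d where cd: "(g has_derivative (\<lambda>(h, k). c * h + d * k)) (at p within bidisc)"
    by (rule holomorphic2E[OF assms(2) p])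
  show "\<exists>a b. ((\<lambda>p. f p * g p) has_derivative (\<lambda>(h, k). a * h + b * k)) (at p within bidisc)"
    by (rule holomorphic2I[OF has_derivative_mult[OF ab cd], where a = "a * g p + f p * c" and b = "b * g p + f p * d"])
       (simp add: algebra_simps)
qed

lemma bidisc_algebra_const: "(\<lambda>p. c) \<in> bidisc_algebra"
  by (rule bidisc_algebraI)
     (auto intro!: holomorphic2I[OF has_derivative_const, where a = 0 and b = 0])

lemma bidisc_algebra_fst: "fst \<in> bidisc_algebra"
  by (rule bidisc_algebraI)
     (auto intro!: continuous_intros holomorphic2I[OF has_derivative_fst[OF has_derivative_ident], where a = 1 and b = 0])

lemma bidisc_algebra_snd_comp:
  assumes c: "continuous_on (cball 0 1) Q" and h: "Q holomorphic_on ball 0 1"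
  shows "(\<lambda>p. Q (snd p)) \<in> bidisc_algebra"
proof (rule bidisc_algebraI)
  show "continuous_on closed_bidisc (\<lambda>p. Q (snd p))"
    by (rule continuous_on_compose2[OF c]) (auto intro!: continuous_intros)
  fix p :: "complex \<times> complex" assume p: "p \<in> bidisc"
  then have "(Q has_field_derivative deriv Q (snd p)) (at (snd p))"
    using h by (intro holomorphic_derivI[of Q "ball 0 1"]) auto
  then have "(Q has_derivative (*) (deriv Q (snd p))) (at (snd p))" by (simp add: has_field_derivative_def)
  from has_derivative_compose[OF has_derivative_snd[OF has_derivative_ident] this]
  show "\<exists>a b. ((\<lambda>p. Q (snd p)) has_derivative (\<lambda>(h, k). a * h + b * k)) (at p within bidisc)"
    by (rule holomorphic2I[where a = 0 and b = "deriv Q (snd p)"]) simp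
qed

lemma bidisc_algebra_inverse:
  assumes f: "f \<in> bidisc_algebra" and nz: "\<And>p. p \<in> closed_bidisc \<Longrightarrow> f p \<noteq> 0"
  shows "(\<lambda>p. inverse (f p)) \<in> bidisc_algebra"
proof (rule bidisc_algebraI)
  show "continuous_on closed_bidisc (\<lambda>p. inverse (f p))"
    using f nz by (intro continuous_on_inverse bidisc_algebra_continuous) auto
  fix p :: "complex \<times> complex" assume p: "p \<in> bidisc"
  then have nzp: "f p \<noteq> 0" by (intro nz) (auto simp: mem_Times_iff)
  obtain a b where ab: "(f has_derivative (\<lambda>(h, k). a * h + b * k)) (at p within bidisc)"
    by (rule holomorphic2E[OF f p])
  show "\<exists>a b. ((\<lambda>p. inverse (f p)) has_derivative (\<lambda>(h, k). a * h + b * k)) (at p within bidisc)"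
    by (rule holomorphic2I[OF Deriv.has_derivative_inverse[OF nzp ab], where a = "- (inverse (f p) * a * inverse (f p))"
        and b = "- (inverse (f p) * b * inverse (f p))"])
       (simp add: algebra_simps)
qed

lemma bidisc_algebra_cong:
  assumes f: "f \<in> bidisc_algebra" and eq: "\<And>p. p \<in> closed_bidisc \<Longrightarrow> g p = f p"
  shows "g \<in> bidisc_algebra"
proof (rule bidisc_algebraI)
  show "continuous_on closed_bidisc g"
    using bidisc_algebra_continuous[OF f] eq by (subst continuous_on_cong[OF refl]) auto
  fix p :: "complex \<times> complex" assume p: "p \<in> bidisc"
  obtain a b where ab: "(f has_derivative (\<lambda>(h, k). a * h + b * k)) (at p within bidisc)"
    by (rule holomorphic2E[OF f p])
  have "(g has_derivative (\<lambda>(h, k). a * h + b * k)) (at p within bidisc)"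
    by (rule has_derivative_transform[OF p _ ab]) (use eq in \<open>auto simp: mem_Times_iff\<close>)
  then show "\<exists>a b. (g has_derivative (\<lambda>(h, k). a * h + b * k)) (at p within bidisc)" by blast
qed

lemma power_series_of_cong:
  assumes "power_series_of f a" "\<And>p. p \<in> closed_bidisc \<Longrightarrow> g p = f p"
  shows "power_series_of g a"
  unfolding power_series_of_def
proof clarify
  fix z w :: complex assume zw: "z \<in> ball 0 1" "w \<in> ball 0 1"
  then have "g (z, w) = f (z, w)" by (intro assms) auto
  with zw show "((\<lambda>(n, m). a (n, m) * z ^ n * w ^ m) has_sum g (z, w)) UNIV"
    using assms(1) unfolding power_series_of_def by auto
qed

text \<open>The reciprocal built in \<open>quantitative_inverse\<close> is known to agree with the
  wanted function on the closed bidisc only.\<close>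

lemma wiener_algebra_cong:
  assumes f: "f \<in> wiener_algebra W" and eq: "\<And>p. p \<in> closed_bidisc \<Longrightarrow> g p = f p"
  shows "g \<in> wiener_algebra W" "wiener_norm W g = wiener_norm W f"
proof -
  obtain a where a: "f \<in> bidisc_algebra" "power_series_of f a" "(\<lambda>p. norm (a p) * W p) summable_on UNIV"
    using f by (rule wiener_algebraE)
  have ga: "power_series_of g a" using power_series_of_cong[OF a(2)] eq by blast
  then show "g \<in> wiener_algebra W" using bidisc_algebra_cong[OF a(1) eq] a(3) unfolding wiener_algebra_def by blast
  show "wiener_norm W g = wiener_norm W f" using wiener_norm_eq ga a(2) by metis
qed

lemma wiener_norm_zero:
  assumes "\<And>p. p \<in> closed_bidisc \<Longrightarrow> g p = 0"
  shows "wiener_norm W g = 0"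
proof -
  have "power_series_of g (\<lambda>_. 0)"
    unfolding power_series_of_def
  proof clarify
    fix z w :: complex assume "z \<in> ball 0 1" "w \<in> ball 0 1"
    then have "g (z, w) = 0" by (intro assms) auto
    then show "((\<lambda>(n, m). 0 * z ^ n * w ^ m) has_sum g (z, w)) UNIV" by (simp add: case_prod_unfold)
  qed
  then show ?thesis by (simp add: wiener_norm_eq)
qed

section \<open>Products of double power series\<close>

lemma has_sum_times:
  fixes A :: "'i \<Rightarrow> 'c::{banach, real_normed_field, second_countable_topology}" and B :: "'j \<Rightarrow> 'c"
  assumes "(\<lambda>q. norm (A q)) summable_on UNIV" "(\<lambda>r. norm (B r)) summable_on UNIV" "(A has_sum s) UNIV" "(B has_sum t) UNIV"
  shows "((\<lambda>(q, r). A q * B r) has_sum (s * t)) (UNIV \<times> UNIV)"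
proof (rule has_sum_SigmaI)
  show "((\<lambda>r. case (q, r) of (q, r) \<Rightarrow> A q * B r) has_sum (A q * t)) UNIV" for q
    using has_sum_cmult_right[OF assms(4)] by simp
  show "((\<lambda>q. A q * t) has_sum (s * t)) UNIV" using has_sum_cmult_left[OF assms(3)] .
  have "(\<lambda>x. norm (case x of (q, r) \<Rightarrow> A q * B r)) summable_on UNIV \<times> UNIV"
  proof (rule iffD2[OF Infinite_Sum.abs_summable_on_Sigma_iff[where f = "\<lambda>(q, r). A q * B r" and A = UNIV and B = "\<lambda>_. UNIV"]], intro conjI ballI)
    show "(\<lambda>r. norm (case (q, r) of (q, r) \<Rightarrow> A q * B r)) summable_on UNIV" for q
      using summable_on_cmult_right[OF assms(2), of "norm (A q)"] by (simp add: norm_mult)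
    have "(\<lambda>q. \<Sum>\<^sub>\<infinity>r. norm (case (q, r) of (q, r) \<Rightarrow> A q * B r)) = (\<lambda>q. norm (A q) * (\<Sum>\<^sub>\<infinity>r. norm (B r)))"
      by (simp add: norm_mult infsum_cmult_right')
    moreover have "(\<lambda>q. norm (A q) * (\<Sum>\<^sub>\<infinity>r. norm (B r))) summable_on UNIV"
      using summable_on_cmult_left[OF assms(1)] .
    ultimately show "(\<lambda>q. norm (\<Sum>\<^sub>\<infinity>r. norm (case (q, r) of (q, r) \<Rightarrow> A q * B r))) summable_on UNIV"
      using summable_on_iff_abs_summable_on_real by metis
  qed
  then show "(\<lambda>(q, r). A q * B r) summable_on UNIV \<times> UNIV" by (rule abs_summable_summable)
qed

text \<open>Subtraction of pairs of naturals truncates at 0; the box is exactly where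
  \<open>p - q\<close> is a true complement of \<open>q\<close>.\<close>

definition degree_box :: "nat \<times> nat \<Rightarrow> (nat \<times> nat) set" where
  "degree_box p = {..fst p} \<times> {..snd p}"

lemma finite_degree_box [simp]: "finite (degree_box p)"
  by (simp add: degree_box_def)

lemma degree_box_diff: "q \<in> degree_box p \<Longrightarrow> q + (p - q) = p"
  by (cases p; cases q) (auto simp: degree_box_def)

text \<open>Pairs \<open>(q, r)\<close> are regrouped by their sum:
  \<open>(p, q) \<mapsto> (q, p - q)\<close> is a bijection from the disjoint union of the boxes
  onto all pairs, and each box is finite.\<close>

lemma has_sum_convolution:
  fixes F :: "(nat \<times> nat) \<times> (nat \<times> nat) \<Rightarrow> 'c::{topological_comm_monoid_add, t3_space}"
  assumes "(F has_sum S) (UNIV \<times> UNIV)"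
  shows "((\<lambda>p. \<Sum>q\<in>degree_box p. F (q, p - q)) has_sum S) UNIV"
proof -
  define g where "g = (\<lambda>(p, q). (q, p - q :: nat \<times> nat))"
  have bij: "bij_betw g (Sigma UNIV degree_box) (UNIV \<times> UNIV)"
  proof (rule bij_betwI[where g = "\<lambda>(q, r). (q + r, q)"])
    show "(case g x of (q, r) \<Rightarrow> (q + r, q)) = x" if "x \<in> Sigma UNIV degree_box" for x
      using that degree_box_diff by (auto simp: g_def)
  qed (auto simp: g_def degree_box_def)
  have "((\<lambda>x. F (g x)) has_sum S) (Sigma UNIV degree_box)"
    using has_sum_reindex_bij_betw[OF bij] assms by blast
  then show ?thesis
  proof (rule has_sum_SigmaD)
    fix p show "((\<lambda>q. F (g (p, q))) has_sum (\<Sum>q\<in>degree_box p. F (q, p - q))) (degree_box p)"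
      by (rule has_sum_finiteI) (auto simp: g_def)
  qed
qed

definition convolution :: "(nat \<times> nat \<Rightarrow> complex) \<Rightarrow> (nat \<times> nat \<Rightarrow> complex) \<Rightarrow> nat \<times> nat \<Rightarrow> complex" where
  "convolution a b p = (\<Sum>q\<in>degree_box p. a q * b (p - q))"

lemma power_series_of_mult:
  assumes a: "power_series_of f a" and b: "power_series_of g b"
  shows "power_series_of (\<lambda>p. f p * g p) (convolution a b)"
  unfolding power_series_of_def
proof clarify
  fix z w :: complex assume zw: "z \<in> ball 0 1" "w \<in> ball 0 1"
  define M where "M = (\<lambda>(n, m). z ^ n * w ^ m :: complex)"
  have M_add: "M (q + r) = M q * M r" for q r by (cases q; cases r) (simp add: M_def power_add)
  have A: "((\<lambda>q. a q * M q) has_sum f (z, w)) UNIV" and B: "((\<lambda>q. b q * M q) has_sum g (z, w)) UNIV"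
    using a b zw unfolding power_series_of_def M_def by (auto simp: case_prod_unfold mult.assoc)
  have "((\<lambda>(q, r). (a q * M q) * (b r * M r)) has_sum (f (z, w) * g (z, w))) (UNIV \<times> UNIV)"
    using has_sum_imp_summable[OF A] has_sum_imp_summable[OF B]
    by (intro has_sum_times A B) (simp_all add: summable_on_iff_abs_summable_on_complex)
  from has_sum_convolution[OF this]
  have "((\<lambda>p. \<Sum>q\<in>degree_box p. a q * M q * (b (p - q) * M (p - q))) has_sum (f (z, w) * g (z, w))) UNIV" by simp
  also have "(\<lambda>p. \<Sum>q\<in>degree_box p. a q * M q * (b (p - q) * M (p - q))) = (\<lambda>p. convolution a b p * M p)"
  proof
    fix p
    have "a q * M q * (b (p - q) * M (p - q)) = a q * b (p - q) * M p" if "q \<in> degree_box p" for q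
      using M_add[of q "p - q"] degree_box_diff[OF that] by simp
    then show "(\<Sum>q\<in>degree_box p. a q * M q * (b (p - q) * M (p - q))) = convolution a b p * M p"
      unfolding convolution_def sum_distrib_right by (rule sum.cong[OF refl])
  qed
  finally show "((\<lambda>(n, m). convolution a b (n, m) * z ^ n * w ^ m) has_sum f (z, w) * g (z, w)) UNIV"
    by (simp add: M_def case_prod_unfold mult.assoc)
qed

text \<open>The majorant \<open>\<Phi>\<close> is left open to cover two cases at once:
  \<open>W q * W r\<close> for submultiplicativity and \<open>W q * V r + V q * W r\<close> for the
  Leibniz-type estimate.\<close>

lemma convolution_bound:
  assumes le: "\<And>q r. W (q + r) \<le> \<Phi> q r" and W0: "\<And>p. W p \<ge> 0"
    and sum: "((\<lambda>(q, r). norm (a q) * norm (b r) * \<Phi> q r) has_sum S) (UNIV \<times> UNIV)"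
  shows "(\<lambda>p. norm (convolution a b p) * W p) summable_on UNIV"
    and "(\<Sum>\<^sub>\<infinity>p. norm (convolution a b p) * W p) \<le> S"
proof -
  define G where "G = (\<lambda>p. \<Sum>q\<in>degree_box p. norm (a q) * norm (b (p - q)) * \<Phi> q (p - q))"
  have G: "(G has_sum S) UNIV" using has_sum_convolution[OF sum] by (simp add: G_def)
  have le: "norm (convolution a b p) * W p \<le> G p" for p
  proof -
    have "norm (convolution a b p) * W p \<le> (\<Sum>q\<in>degree_box p. norm (a q * b (p - q))) * W p"
      unfolding convolution_def using W0 by (intro mult_right_mono norm_sum) auto
    also have "\<dots> = (\<Sum>q\<in>degree_box p. norm (a q) * norm (b (p - q)) * W p)"
      by (simp add: sum_distrib_right norm_mult)
    also have "\<dots> \<le> G p" unfolding G_def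
    proof (rule sum_mono)
      fix q assume "q \<in> degree_box p"
      then have "W p \<le> \<Phi> q (p - q)" using le[of q "p - q"] degree_box_diff by simp
      then show "norm (a q) * norm (b (p - q)) * W p \<le> norm (a q) * norm (b (p - q)) * \<Phi> q (p - q)"
        by (intro mult_left_mono) auto
    qed
    finally show ?thesis .
  qed
  show s: "(\<lambda>p. norm (convolution a b p) * W p) summable_on UNIV"
    by (rule summable_on_comparison_test[OF has_sum_imp_summable[OF G]]) (use le W0 in auto)
  have "(\<Sum>\<^sub>\<infinity>p. norm (convolution a b p) * W p) \<le> (\<Sum>\<^sub>\<infinity>p. G p)"
    by (rule infsum_mono[OF s has_sum_imp_summable[OF G] le])
  then show "(\<Sum>\<^sub>\<infinity>p. norm (convolution a b p) * W p) \<le> S" using G by (simp add: infsumI)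
qed

lemma has_sum_times_nonneg:
  fixes A :: "'i \<Rightarrow> real" and B :: "'j \<Rightarrow> real"
  assumes "A summable_on UNIV" "B summable_on UNIV"
  shows "((\<lambda>(q, r). A q * B r) has_sum (infsum A UNIV * infsum B UNIV)) (UNIV \<times> UNIV)"
  using assms by (intro has_sum_times has_sum_infsum summable_on_iff_abs_summable_on_real[THEN iffD1])

text \<open>A Leibniz rule for norms: each summand carries the norm of \<open>W\<close> on one
  factor only. Iterated, it makes powers grow in the norm of \<open>W\<close> essentially at the
  rate dictated by the norm of \<open>V\<close>.\<close>

lemma wiener_algebra_mult_two_weights:
  assumes f: "f \<in> wiener_algebra W" "f \<in> wiener_algebra V" and g: "g \<in> wiener_algebra W" "g \<in> wiener_algebra V"
    and le: "\<And>q r. W (q + r) \<le> W q * V r + V q * W r" and W0: "\<And>p. W p \<ge> 0"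
  shows "wiener_norm W (\<lambda>p. f p * g p) \<le> wiener_norm W f * wiener_norm V g + wiener_norm V f * wiener_norm W g"
proof -
  obtain a where a: "power_series_of f a" "(\<lambda>p. norm (a p) * W p) summable_on UNIV"
    "wiener_norm W f = (\<Sum>\<^sub>\<infinity>p. norm (a p) * W p)" using f(1) by (rule wiener_algebraE)
  obtain b where b: "power_series_of g b" "(\<lambda>p. norm (b p) * W p) summable_on UNIV"
    "wiener_norm W g = (\<Sum>\<^sub>\<infinity>p. norm (b p) * W p)" using g(1) by (rule wiener_algebraE)
  have av: "(\<lambda>p. norm (a p) * V p) summable_on UNIV" "wiener_norm V f = (\<Sum>\<^sub>\<infinity>p. norm (a p) * V p)"
    using f(2) a(1) power_series_of_unique by (metis wiener_algebraE)+
  have bv: "(\<lambda>p. norm (b p) * V p) summable_on UNIV" "wiener_norm V g = (\<Sum>\<^sub>\<infinity>p. norm (b p) * V p)"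
    using g(2) b(1) power_series_of_unique by (metis wiener_algebraE)+
  have "((\<lambda>(q, r). norm (a q) * norm (b r) * (W q * V r + V q * W r)) has_sum
      (wiener_norm W f * wiener_norm V g + wiener_norm V f * wiener_norm W g)) (UNIV \<times> UNIV)"
    using has_sum_add[OF has_sum_times_nonneg[OF a(2) bv(1)] has_sum_times_nonneg[OF av(1) b(2)]]
    unfolding a(3) b(3) av(2) bv(2) by (simp add: case_prod_unfold algebra_simps)
  from convolution_bound(2)[OF le W0 this]
  show ?thesis using wiener_norm_eq[OF power_series_of_mult[OF a(1) b(1)]] by simp
qed

lemma power_series_of_add:
  "power_series_of f a \<Longrightarrow> power_series_of g b \<Longrightarrow> power_series_of (\<lambda>p. f p + g p) (\<lambda>p. a p + b p)"
  unfolding power_series_of_def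
proof (clarify, goal_cases)
  case (1 z w)
  then have "((\<lambda>(n, m). a (n, m) * z ^ n * w ^ m) has_sum f (z, w)) UNIV"
    "((\<lambda>(n, m). b (n, m) * z ^ n * w ^ m) has_sum g (z, w)) UNIV" by auto
  from has_sum_add[OF this] show ?case by (simp add: case_prod_unfold algebra_simps)
qed

lemma power_series_of_cmult:
  "power_series_of f a \<Longrightarrow> power_series_of (\<lambda>p. c * f p) (\<lambda>p. c * a p)"
  unfolding power_series_of_def
proof (clarify, goal_cases)
  case (1 z w)
  then have "((\<lambda>(n, m). a (n, m) * z ^ n * w ^ m) has_sum f (z, w)) UNIV" by auto
  from has_sum_cmult_right[OF this] show ?case by (simp add: case_prod_unfold algebra_simps)
qed

lemma wiener_algebra_cmult:
  assumes "f \<in> wiener_algebra W"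
  shows "(\<lambda>p. c * f p) \<in> wiener_algebra W" "wiener_norm W (\<lambda>p. c * f p) = norm c * wiener_norm W f"
proof -
  obtain a where a: "f \<in> bidisc_algebra" "power_series_of f a" "(\<lambda>p. norm (a p) * W p) summable_on UNIV"
    "wiener_norm W f = (\<Sum>\<^sub>\<infinity>p. norm (a p) * W p)" using assms by (rule wiener_algebraE)
  have s: "(\<lambda>p. norm (c * a p) * W p) summable_on UNIV"
    using summable_on_cmult_right[OF a(3), of "norm c"] by (simp add: norm_mult mult.assoc)
  show "(\<lambda>p. c * f p) \<in> wiener_algebra W"
    using bidisc_algebra_mult[OF bidisc_algebra_const a(1)] power_series_of_cmult[OF a(2)] s
    unfolding wiener_algebra_def by blast
  show "wiener_norm W (\<lambda>p. c * f p) = norm c * wiener_norm W f"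
    unfolding wiener_norm_eq[OF power_series_of_cmult[OF a(2)]] a(4)
    by (simp add: norm_mult mult.assoc infsum_cmult_right')
qed

section \<open>Banach algebra estimates for a submultiplicative weight\<close>

locale weight =
  fixes W :: "nat \<times> nat \<Rightarrow> real"
  assumes ge1: "W p \<ge> 1" and submult: "W (p + q) \<le> W p * W q" and W0: "W 0 = 1"
begin

lemma nonneg: "W p \<ge> 0" using ge1[of p] by simp

lemma norm_nonneg: "wiener_norm W f \<ge> 0"
  unfolding wiener_norm_def by (intro infsum_nonneg mult_nonneg_nonneg nonneg norm_ge_zero)

lemma add:
  assumes "f \<in> wiener_algebra W" "g \<in> wiener_algebra W"
  shows "(\<lambda>p. f p + g p) \<in> wiener_algebra W"
    "wiener_norm W (\<lambda>p. f p + g p) \<le> wiener_norm W f + wiener_norm W g"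
proof -
  obtain a where a: "f \<in> bidisc_algebra" "power_series_of f a" "(\<lambda>p. norm (a p) * W p) summable_on UNIV"
    "wiener_norm W f = (\<Sum>\<^sub>\<infinity>p. norm (a p) * W p)" using assms(1) by (rule wiener_algebraE)
  obtain b where b: "g \<in> bidisc_algebra" "power_series_of g b" "(\<lambda>p. norm (b p) * W p) summable_on UNIV"
    "wiener_norm W g = (\<Sum>\<^sub>\<infinity>p. norm (b p) * W p)" using assms(2) by (rule wiener_algebraE)
  have S: "((\<lambda>p. norm (a p) * W p + norm (b p) * W p) has_sum (wiener_norm W f + wiener_norm W g)) UNIV"
    unfolding a(4) b(4) by (intro has_sum_add has_sum_infsum a b)
  have le: "norm (a p + b p) * W p \<le> norm (a p) * W p + norm (b p) * W p" for p
    using mult_right_mono[OF norm_triangle_ineq nonneg, of "a p" "b p"] by (simp add: algebra_simps)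
  have s: "(\<lambda>p. norm (a p + b p) * W p) summable_on UNIV"
    by (rule summable_on_comparison_test[OF has_sum_imp_summable[OF S]]) (use le nonneg in auto)
  show "(\<lambda>p. f p + g p) \<in> wiener_algebra W"
    using bidisc_algebra_add[OF a(1) b(1)] power_series_of_add[OF a(2) b(2)] s
    unfolding wiener_algebra_def by blast
  have "(\<Sum>\<^sub>\<infinity>p. norm (a p + b p) * W p) \<le> (\<Sum>\<^sub>\<infinity>p. norm (a p) * W p + norm (b p) * W p)"
    by (rule infsum_mono[OF s has_sum_imp_summable[OF S] le])
  then show "wiener_norm W (\<lambda>p. f p + g p) \<le> wiener_norm W f + wiener_norm W g"
    using wiener_norm_eq[OF power_series_of_add[OF a(2) b(2)]] infsumI[OF S] by simp
qed

lemma mult: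
  assumes "f \<in> wiener_algebra W" "g \<in> wiener_algebra W"
  shows "(\<lambda>p. f p * g p) \<in> wiener_algebra W"
    "wiener_norm W (\<lambda>p. f p * g p) \<le> wiener_norm W f * wiener_norm W g"
proof -
  obtain a where a: "f \<in> bidisc_algebra" "power_series_of f a" "(\<lambda>p. norm (a p) * W p) summable_on UNIV"
    "wiener_norm W f = (\<Sum>\<^sub>\<infinity>p. norm (a p) * W p)" using assms(1) by (rule wiener_algebraE)
  obtain b where b: "g \<in> bidisc_algebra" "power_series_of g b" "(\<lambda>p. norm (b p) * W p) summable_on UNIV"
    "wiener_norm W g = (\<Sum>\<^sub>\<infinity>p. norm (b p) * W p)" using assms(2) by (rule wiener_algebraE)
  have "((\<lambda>(q, r). norm (a q) * norm (b r) * (W q * W r)) has_sum (wiener_norm W f * wiener_norm W g)) (UNIV \<times> UNIV)"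
    using has_sum_times_nonneg[OF a(3) b(3)] unfolding a(4) b(4) by (simp add: case_prod_unfold algebra_simps)
  note cb = convolution_bound[OF submult nonneg this]
  show "(\<lambda>p. f p * g p) \<in> wiener_algebra W"
    using bidisc_algebra_mult[OF a(1) b(1)] power_series_of_mult[OF a(2) b(2)] cb(1)
    unfolding wiener_algebra_def by blast
  show "wiener_norm W (\<lambda>p. f p * g p) \<le> wiener_norm W f * wiener_norm W g"
    using cb(2) wiener_norm_eq[OF power_series_of_mult[OF a(2) b(2)]] by simp
qed

lemma diff:
  assumes "f \<in> wiener_algebra W" "g \<in> wiener_algebra W"
  shows "(\<lambda>p. f p - g p) \<in> wiener_algebra W"
    "wiener_norm W (\<lambda>p. f p - g p) \<le> wiener_norm W f + wiener_norm W g"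
  using add[OF assms(1) wiener_algebra_cmult(1)[OF assms(2), of "-1"]] wiener_algebra_cmult(2)[OF assms(2), of "-1"]
  by simp_all

lemma norm_mult_le:
  assumes "f \<in> wiener_algebra W" "g \<in> wiener_algebra W" "wiener_norm W f \<le> A" "wiener_norm W g \<le> B"
  shows "wiener_norm W (\<lambda>p. f p * g p) \<le> A * B"
  using mult(2)[OF assms(1,2)] mult_mono[OF assms(3,4)] norm_nonneg order_trans by (meson assms(3))

lemma monomial:
  "(\<lambda>p. c * fst p ^ n * snd p ^ m) \<in> wiener_algebra W"
  "wiener_norm W (\<lambda>p. c * fst p ^ n * snd p ^ m) = norm c * W (n, m)"
proof -
  define a where "a p = (if p = (n, m) then c else 0)" for p
  have ps: "power_series_of (\<lambda>p. c * fst p ^ n * snd p ^ m) a"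
    unfolding power_series_of_def
  proof clarify
    fix z w :: complex
    show "((\<lambda>(i, j). a (i, j) * z ^ i * w ^ j) has_sum c * fst (z, w) ^ n * snd (z, w) ^ m) UNIV"
      by (rule has_sum_finite_neutralI[of "{(n, m)}"]) (auto simp: a_def split: if_splits)
  qed
  have s: "((\<lambda>p. norm (a p) * W p) has_sum (norm c * W (n, m))) UNIV"
    by (rule has_sum_finite_neutralI[of "{(n, m)}"]) (auto simp: a_def)
  have "(\<lambda>p. c * fst p ^ k) \<in> bidisc_algebra" for k
    by (induction k) (use bidisc_algebra_const bidisc_algebra_mult[OF _ bidisc_algebra_fst] in \<open>auto simp: mult.assoc[symmetric] mult.commute[of "fst _"]\<close>)
  moreover have "(\<lambda>p. snd p ^ m) \<in> bidisc_algebra"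
    by (rule bidisc_algebra_snd_comp) (auto intro!: continuous_intros holomorphic_intros)
  ultimately have "(\<lambda>p. c * fst p ^ n * snd p ^ m) \<in> bidisc_algebra" by (rule bidisc_algebra_mult)
  then show "(\<lambda>p. c * fst p ^ n * snd p ^ m) \<in> wiener_algebra W"
    using ps has_sum_imp_summable[OF s] unfolding wiener_algebra_def by blast
  show "wiener_norm W (\<lambda>p. c * fst p ^ n * snd p ^ m) = norm c * W (n, m)"
    unfolding wiener_norm_eq[OF ps] using s by (rule infsumI)
qed

lemma const: "(\<lambda>_. c) \<in> wiener_algebra W" "wiener_norm W (\<lambda>_. c) = norm c"
  using monomial[of c 0 0] W0 by (simp_all add: zero_prod_def)

lemma sum:
  assumes "\<And>i. i \<in> I \<Longrightarrow> f i \<in> wiener_algebra W"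
  shows "(\<lambda>p. \<Sum>i\<in>I. f i p) \<in> wiener_algebra W"
    "wiener_norm W (\<lambda>p. \<Sum>i\<in>I. f i p) \<le> (\<Sum>i\<in>I. wiener_norm W (f i))"
proof -
  have "(\<lambda>p. \<Sum>i\<in>I. f i p) \<in> wiener_algebra W \<and> wiener_norm W (\<lambda>p. \<Sum>i\<in>I. f i p) \<le> (\<Sum>i\<in>I. wiener_norm W (f i))"
    using assms
  proof (induction I rule: infinite_finite_induct)
    case (insert i I)
    then show ?case using add[of "f i" "\<lambda>p. \<Sum>i\<in>I. f i p"] by force
  qed (use const[of 0] in auto)
  then show "(\<lambda>p. \<Sum>i\<in>I. f i p) \<in> wiener_algebra W"
    "wiener_norm W (\<lambda>p. \<Sum>i\<in>I. f i p) \<le> (\<Sum>i\<in>I. wiener_norm W (f i))" by auto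
qed

lemma polynomial:
  "(\<lambda>p. \<Sum>i\<in>I. c i * fst p ^ n i * snd p ^ m i) \<in> wiener_algebra W"
  "wiener_norm W (\<lambda>p. \<Sum>i\<in>I. c i * fst p ^ n i * snd p ^ m i) \<le> (\<Sum>i\<in>I. norm (c i) * W (n i, m i))"
  using sum[of I "\<lambda>i p. c i * fst p ^ n i * snd p ^ m i"] monomial by auto

lemma power:
  assumes "f \<in> wiener_algebra W"
  shows "(\<lambda>p. f p ^ k) \<in> wiener_algebra W" "wiener_norm W (\<lambda>p. f p ^ k) \<le> wiener_norm W f ^ k"
proof -
  have "(\<lambda>p. f p ^ k) \<in> wiener_algebra W \<and> wiener_norm W (\<lambda>p. f p ^ k) \<le> wiener_norm W f ^ k"
  proof (induction k)
    case 0 then show ?case using const[of 1] by simp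
  next
    case (Suc k)
    have "wiener_norm W (\<lambda>p. f p * f p ^ k) \<le> wiener_norm W f * wiener_norm W f ^ k"
      by (rule norm_mult_le) (use assms Suc in auto)
    then show ?case using mult(1)[OF assms, of "\<lambda>p. f p ^ k"] Suc by simp
  qed
  then show "(\<lambda>p. f p ^ k) \<in> wiener_algebra W" "wiener_norm W (\<lambda>p. f p ^ k) \<le> wiener_norm W f ^ k" by auto
qed

text \<open>The weight is at least 1, so the series is dominated termwise on the open bidisc;
  continuity extends the bound to the boundary.\<close>

lemma closed_bidisc_le:
  assumes f: "f \<in> wiener_algebra W" and p: "p \<in> closed_bidisc"
  shows "norm (f p) \<le> wiener_norm W f"
proof -
  obtain a where a: "f \<in> bidisc_algebra" "power_series_of f a" "(\<lambda>p. norm (a p) * W p) summable_on UNIV"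
    "wiener_norm W f = (\<Sum>\<^sub>\<infinity>p. norm (a p) * W p)" using f by (rule wiener_algebraE)
  have cl: "closure bidisc = closed_bidisc" by (simp add: closure_Times)
  have "norm (f (z, w)) \<le> wiener_norm W f" if zw: "norm z < 1" "norm w < 1" for z w
  proof -
    have s: "((\<lambda>(n, m). a (n, m) * z ^ n * w ^ m) has_sum f (z, w)) UNIV"
      using a(2) zw unfolding power_series_of_def by auto
    have le: "norm (case p of (n, m) \<Rightarrow> a (n, m) * z ^ n * w ^ m) \<le> norm (a p) * W p" for p
    proof (cases p)
      case (Pair n m)
      have "norm (z ^ n) * norm (w ^ m) \<le> 1 * 1" using zw by (intro mult_mono) (auto simp: norm_power power_le_one)
      then have "norm (z ^ n * w ^ m) \<le> W p" using ge1[of p] by (simp add: norm_mult)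
      then have "norm (a p) * norm (z ^ n * w ^ m) \<le> norm (a p) * W p" by (rule mult_left_mono) auto
      then show ?thesis using Pair by (simp add: norm_mult mult.assoc)
    qed
    show ?thesis unfolding a(4) by (rule norm_infsum_le[OF s has_sum_infsum[OF a(3)] le])
  qed
  then show ?thesis
    using continuous_on_closure_norm_le[of bidisc f "wiener_norm W f" p] bidisc_algebra_continuous[OF a(1)] p cl by auto
qed

end

section \<open>Neumann series, truncation and slices\<close>

text \<open>Places a series in \<open>w\<close> alone into the row \<open>n = 0\<close> of a double
  series; \<open>has_sum_col0\<close> is its mirror image for series in \<open>z\<close>.\<close>

lemma has_sum_row0:
  fixes h :: "nat \<Rightarrow> 'c::{topological_comm_monoid_add, t2_space}"
  assumes "(h has_sum S) UNIV"
  shows "((\<lambda>(n::nat, m). if n = 0 then h m else 0) has_sum S) UNIV"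
proof -
  have "((\<lambda>(n::nat, m). if n = 0 then h m else 0) has_sum S) (range (\<lambda>m. (0, m)))"
    by (subst has_sum_reindex) (use assms in \<open>auto simp: inj_on_def o_def\<close>)
  then show ?thesis by (rule has_sum_cong_neutral[THEN iffD1, rotated -1]) auto
qed

lemma geometric_has_sum:
  fixes r :: real assumes "0 \<le> r" "r < 1"
  shows "((\<lambda>k. r ^ k) has_sum (1 / (1 - r))) UNIV"
  using assms by (intro sums_nonneg_imp_has_sum geometric_sums) auto

context weight
begin

text \<open>Coefficients are summed instead of functions: over all \<open>k\<close> and
  \<open>p\<close>, the weighted coefficients \<open>norm (c k p) * W p\<close> of the powers of
  \<open>x\<close> form a summable family dominated by a geometric series, and exchanging the order
  of summation gives both the norm of the candidate \<open>d\<close> and its identification with the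
  reciprocal.\<close>

lemma neumann:
  assumes x: "x \<in> wiener_algebra W" and lt: "wiener_norm W x < 1"
  shows "(\<lambda>p. inverse (1 - x p)) \<in> wiener_algebra W"
    "wiener_norm W (\<lambda>p. inverse (1 - x p)) \<le> 1 / (1 - wiener_norm W x)"
    "p \<in> closed_bidisc \<Longrightarrow> x p \<noteq> 1"
proof -
  define r where "r = wiener_norm W x"
  have r: "0 \<le> r" "r < 1" using lt norm_nonneg by (auto simp: r_def)
  have x_le: "norm (x p) \<le> r" if "p \<in> closed_bidisc" for p
    using closed_bidisc_le[OF x that] by (simp add: r_def)
  then show ne1: "x p \<noteq> 1" if "p \<in> closed_bidisc" for p using that r by force
  have "(\<lambda>p. 1 - x p) \<in> bidisc_algebra"
    using diff(1)[OF const(1)[of 1] x] by (rule wiener_algebraE)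
  then have y_ba: "(\<lambda>p. inverse (1 - x p)) \<in> bidisc_algebra"
    by (rule bidisc_algebra_inverse) (use ne1 in force)
  define c where "c k = taylor_coeff (\<lambda>p. x p ^ k)" for k
  have c: "power_series_of (\<lambda>p. x p ^ k) (c k)" "(\<lambda>p. norm (c k p) * W p) summable_on UNIV"
    "(\<Sum>\<^sub>\<infinity>p. norm (c k p) * W p) \<le> r ^ k" for k
  proof -
    obtain a where a: "power_series_of (\<lambda>p. x p ^ k) a" "(\<lambda>p. norm (a p) * W p) summable_on UNIV"
      using power(1)[OF x, of k] by (rule wiener_algebraE)
    have "c k = a" unfolding c_def by (rule taylor_coeff_eq[OF a(1)])
    then show "power_series_of (\<lambda>p. x p ^ k) (c k)" "(\<lambda>p. norm (c k p) * W p) summable_on UNIV" using a by auto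
    show "(\<Sum>\<^sub>\<infinity>p. norm (c k p) * W p) \<le> r ^ k"
      using power(2)[OF x, of k] by (simp add: wiener_norm_def c_def r_def)
  qed
  define T0 where "T0 k = (\<Sum>\<^sub>\<infinity>p. norm (c k p) * W p)" for k
  have T0_nn: "T0 k \<ge> 0" for k unfolding T0_def by (intro infsum_nonneg mult_nonneg_nonneg nonneg norm_ge_zero)
  have geo: "((\<lambda>k. r ^ k) has_sum (1 / (1 - r))) UNIV" by (rule geometric_has_sum[OF r])
  have T0_s: "T0 summable_on UNIV"
    by (rule summable_on_comparison_test[OF has_sum_imp_summable[OF geo]]) (use c(3) T0_nn in \<open>auto simp: T0_def\<close>)
  have S: "(\<lambda>(k, p). norm (c k p) * W p) summable_on UNIV \<times> UNIV"
  proof (rule summable_on_SigmaI)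
    show "((\<lambda>p. case (k, p) of (k, p) \<Rightarrow> norm (c k p) * W p) has_sum T0 k) UNIV" for k
      using has_sum_infsum[OF c(2)[of k]] by (simp add: T0_def)
  qed (use T0_s nonneg in auto)
  have Ssw: "(\<lambda>(p, k). norm (c k p) * W p) summable_on UNIV \<times> UNIV"
    using S summable_on_swap[where A = UNIV and B = UNIV and f = "\<lambda>(k, p). norm (c k p) * W p"] by simp
  obtain T where T: "((\<lambda>(k, p). norm (c k p) * W p) has_sum T) (UNIV \<times> UNIV)"
    using S by (auto simp: summable_on_def)
  have T_le: "T \<le> 1 / (1 - r)"
  proof -
    have "(T0 has_sum T) UNIV"
      by (rule has_sum_SigmaD[OF T]) (use has_sum_infsum[OF c(2)] in \<open>simp add: T0_def\<close>)
    then show ?thesis by (rule has_sum_mono[OF _ geo]) (use c(3) in \<open>simp add: T0_def\<close>)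
  qed
  have Tsw: "((\<lambda>(p, k). norm (c k p) * W p) has_sum T) (UNIV \<times> UNIV)"
    using T has_sum_swap[where A = UNIV and B = UNIV and f = "\<lambda>(k, p). norm (c k p) * W p"] by simp
  define d where "d p = (\<Sum>\<^sub>\<infinity>k. c k p)" for p
  have row: "(\<lambda>k. norm (c k p) * W p) summable_on UNIV" for p
    using summable_on_SigmaD1[OF Ssw, of p] by simp
  have row': "(\<lambda>k. norm (c k p)) summable_on UNIV" for p
  proof -
    have "(\<lambda>k. (norm (c k p) * W p) * inverse (W p)) summable_on UNIV" by (rule summable_on_cmult_left[OF row])
    moreover have "W p \<noteq> 0" using ge1[of p] by auto
    ultimately show ?thesis by (simp add: mult.assoc)
  qed
  have d: "((\<lambda>k. c k p) has_sum d p) UNIV" for p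
    unfolding d_def by (rule has_sum_infsum[OF abs_summable_summable[OF row']])
  have d_le: "norm (d p) * W p \<le> (\<Sum>\<^sub>\<infinity>k. norm (c k p) * W p)" for p
  proof -
    have "norm (d p) \<le> (\<Sum>\<^sub>\<infinity>k. norm (c k p))" by (rule norm_infsum_le[OF d has_sum_infsum[OF row']]) simp
    then have "norm (d p) * W p \<le> (\<Sum>\<^sub>\<infinity>k. norm (c k p)) * W p" using nonneg by (rule mult_right_mono)
    then show ?thesis by (simp add: infsum_cmult_left')
  qed
  have hT: "((\<lambda>p. \<Sum>\<^sub>\<infinity>k. norm (c k p) * W p) has_sum T) UNIV"
    by (rule has_sum_SigmaD[OF Tsw]) (use has_sum_infsum[OF row] in simp)
  have d_s: "(\<lambda>p. norm (d p) * W p) summable_on UNIV"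
    by (rule summable_on_comparison_test[OF has_sum_imp_summable[OF hT]]) (use d_le nonneg in auto)
  have ps: "power_series_of (\<lambda>p. inverse (1 - x p)) d"
    unfolding power_series_of_def
  proof clarify
    fix z w :: complex assume zw: "z \<in> ball 0 1" "w \<in> ball 0 1"
    define M where "M = (\<lambda>(n, m). z ^ n * w ^ m)"
    have M: "norm (M p) \<le> W p" for p
    proof (cases p)
      case (Pair n m)
      have "norm (z ^ n) * norm (w ^ m) \<le> 1 * 1" using zw by (intro mult_mono) (auto simp: norm_power power_le_one)
      then show ?thesis using ge1[of p] Pair by (simp add: M_def norm_mult)
    qed
    have "(\<lambda>kp. norm (case kp of (k, p) \<Rightarrow> c k p * M p)) summable_on UNIV \<times> UNIV"
      by (rule summable_on_comparison_test[OF S]) (auto simp: norm_mult intro!: mult_left_mono M)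
    then obtain T' where T': "((\<lambda>(k, p). c k p * M p) has_sum T') (UNIV \<times> UNIV)"
      using abs_summable_summable unfolding summable_on_def by blast
    have "((\<lambda>k. x (z, w) ^ k) has_sum T') UNIV"
    proof (rule has_sum_SigmaD[OF T'])
      fix k show "((\<lambda>p. case (k, p) of (k, p) \<Rightarrow> c k p * M p) has_sum x (z, w) ^ k) UNIV"
        using c(1)[of k] zw unfolding power_series_of_def M_def by (auto simp: case_prod_unfold mult.assoc)
    qed
    then have "(\<lambda>k. x (z, w) ^ k) sums T'" by (rule has_sum_imp_sums)
    moreover have "(\<lambda>k. x (z, w) ^ k) sums (1 / (1 - x (z, w)))"
      using x_le[of "(z, w)"] r zw by (intro geometric_sums) auto
    ultimately have T'_eq: "T' = inverse (1 - x (z, w))" using sums_unique2 by (metis inverse_eq_divide)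
    have "((\<lambda>(p, k). c k p * M p) has_sum T') (UNIV \<times> UNIV)"
      using T' has_sum_swap[where A = UNIV and B = UNIV and f = "\<lambda>(k, p). c k p * M p"] by simp
    then have "((\<lambda>p. d p * M p) has_sum T') UNIV"
      by (rule has_sum_SigmaD) (use has_sum_cmult_left[OF d] in simp)
    then show "((\<lambda>(n, m). d (n, m) * z ^ n * w ^ m) has_sum inverse (1 - x (z, w))) UNIV"
      by (simp add: T'_eq M_def case_prod_unfold mult.assoc)
  qed
  show "(\<lambda>p. inverse (1 - x p)) \<in> wiener_algebra W"
    using y_ba ps d_s unfolding wiener_algebra_def by blast
  have "wiener_norm W (\<lambda>p. inverse (1 - x p)) \<le> T"
    unfolding wiener_norm_eq[OF ps] using infsum_mono[OF d_s has_sum_imp_summable[OF hT] d_le] infsumI[OF hT] by simp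
  then show "wiener_norm W (\<lambda>p. inverse (1 - x p)) \<le> 1 / (1 - wiener_norm W x)"
    using T_le by (simp add: r_def)
qed

text \<open>In a weighted \<open>l1\<close> norm the removed coefficients take away exactly their
  share, so truncation errors are tails of a convergent sum of reals.\<close>

lemma truncation_norm:
  assumes f: "f \<in> wiener_algebra W" and a: "power_series_of f a" and F: "finite F"
  shows "wiener_norm W (\<lambda>p. f p - (\<Sum>q\<in>F. a q * fst p ^ fst q * snd p ^ snd q))
    = wiener_norm W f - (\<Sum>q\<in>F. norm (a q) * W q)"
proof -
  have s: "(\<lambda>p. norm (a p) * W p) summable_on UNIV" and n: "wiener_norm W f = (\<Sum>\<^sub>\<infinity>p. norm (a p) * W p)"
    using f a power_series_of_unique by (metis wiener_algebraE)+
  define b where "b p = (if p \<in> F then a p else 0)" for p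
  have "power_series_of (\<lambda>p. \<Sum>q\<in>F. a q * fst p ^ fst q * snd p ^ snd q) b"
    unfolding power_series_of_def
  proof clarify
    fix z w :: complex
    show "((\<lambda>(n, m). b (n, m) * z ^ n * w ^ m) has_sum
        (\<Sum>q\<in>F. a q * fst (z, w) ^ fst q * snd (z, w) ^ snd q)) UNIV"
      by (rule has_sum_finite_neutralI[OF F]) (auto simp: b_def case_prod_unfold intro!: sum.cong)
  qed
  from power_series_of_add[OF a power_series_of_cmult[OF this, of "-1"]]
  have "power_series_of (\<lambda>p. f p - (\<Sum>q\<in>F. a q * fst p ^ fst q * snd p ^ snd q)) (\<lambda>p. a p - b p)" by simp
  from wiener_norm_eq[OF this]
  have "wiener_norm W (\<lambda>p. f p - (\<Sum>q\<in>F. a q * fst p ^ fst q * snd p ^ snd q)) = (\<Sum>\<^sub>\<infinity>p. norm (a p - b p) * W p)" .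
  also have "\<dots> = (\<Sum>\<^sub>\<infinity>p. norm (a p) * W p + - (if p \<in> F then norm (a p) * W p else 0))"
    by (rule infsum_cong) (auto simp: b_def)
  also have "\<dots> = wiener_norm W f + - (\<Sum>q\<in>F. norm (a q) * W q)"
    unfolding n
    by (intro infsumI has_sum_add has_sum_infsum[OF s] has_sum_uminusI has_sum_finite_neutralI[OF F])
       (auto intro!: sum.cong)
  finally show ?thesis by simp
qed

lemma truncation:
  assumes f: "f \<in> wiener_algebra W" and e: "e > 0"
  obtains F a where "finite F" "power_series_of f a"
    "wiener_norm W (\<lambda>p. f p - (\<Sum>q\<in>F. a q * fst p ^ fst q * snd p ^ snd q)) < e"
    "(\<Sum>q\<in>F. norm (a q) * W q) \<le> wiener_norm W f"
proof -
  obtain a where a: "power_series_of f a" "(\<lambda>p. norm (a p) * W p) summable_on UNIV"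
    "wiener_norm W f = (\<Sum>\<^sub>\<infinity>p. norm (a p) * W p)" using f by (rule wiener_algebraE)
  obtain F where F: "finite F" "dist (\<Sum>q\<in>F. norm (a q) * W q) (wiener_norm W f) \<le> e / 2"
    using infsum_finite_approximation[OF a(2), of "e / 2"] e unfolding a(3) by auto
  show thesis
  proof (rule that[OF F(1) a(1)])
    show "wiener_norm W (\<lambda>p. f p - (\<Sum>q\<in>F. a q * fst p ^ fst q * snd p ^ snd q)) < e"
      unfolding truncation_norm[OF f a(1) F(1)] using F(2) e unfolding dist_real_def by linarith
    show "(\<Sum>q\<in>F. norm (a q) * W q) \<le> wiener_norm W f"
      unfolding a(3) by (rule finite_sum_le_infsum[OF a(2) F(1)]) (use nonneg in auto)
  qed
qed

text \<open>By definition the series represents the function on the open bidisc only. On the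
  boundary the error of a partial sum is at most the norm of the remainder, which
  \<open>truncation_norm\<close> identifies as a tail of the norm series. Boundary values occur
  below both at \<open>z = 1\<close> and for slices with \<open>norm w = 1\<close>.\<close>

lemma power_series_closed:
  assumes f: "f \<in> wiener_algebra W" and a: "power_series_of f a" and p: "p \<in> closed_bidisc"
  shows "((\<lambda>q. a q * fst p ^ fst q * snd p ^ snd q) has_sum f p) UNIV"
  unfolding has_sum_def
proof (rule metric_tendsto_imp_tendsto)
  have s: "(\<lambda>p. norm (a p) * W p) summable_on UNIV" and n: "wiener_norm W f = (\<Sum>\<^sub>\<infinity>p. norm (a p) * W p)"
    using f a power_series_of_unique by (metis wiener_algebraE)+
  show "(sum (\<lambda>p. norm (a p) * W p) \<longlongrightarrow> wiener_norm W f) (finite_subsets_at_top UNIV)"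
    unfolding n using has_sum_infsum[OF s] unfolding has_sum_def .
  show "\<forall>\<^sub>F F in finite_subsets_at_top UNIV.
     dist (\<Sum>q\<in>F. a q * fst p ^ fst q * snd p ^ snd q) (f p) \<le> dist (\<Sum>p\<in>F. norm (a p) * W p) (wiener_norm W f)"
  proof (rule eventually_finite_subsets_at_top_weakI)
    fix F :: "(nat \<times> nat) set" assume F: "finite F"
    have "norm (f p - (\<Sum>q\<in>F. a q * fst p ^ fst q * snd p ^ snd q))
        \<le> wiener_norm W (\<lambda>p. f p - (\<Sum>q\<in>F. a q * fst p ^ fst q * snd p ^ snd q))"
      by (rule closed_bidisc_le[OF diff(1)[OF f polynomial(1)] p])
    then show "dist (\<Sum>q\<in>F. a q * fst p ^ fst q * snd p ^ snd q) (f p) \<le> dist (\<Sum>p\<in>F. norm (a p) * W p) (wiener_norm W f)"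
      unfolding truncation_norm[OF f a F] by (simp add: dist_norm norm_minus_commute)
  qed
qed

text \<open>Restriction to \<open>z = 1\<close> adds up the coefficients along \<open>n\<close>; by
  \<open>mono\<close>, moving them from weight \<open>W (n, m)\<close> to \<open>W (0, m)\<close>
  does not increase the norm. The restriction is regarded as a function on the bidisc that does not
  depend on \<open>z\<close>.\<close>

lemma slice_at_one:
  assumes f: "f \<in> wiener_algebra W" and y: "y \<in> bidisc_algebra"
    and eq: "\<And>z w. norm z < 1 \<Longrightarrow> norm w < 1 \<Longrightarrow> y (z, w) = f (1, w)"
    and mono: "\<And>n m. W (0, m) \<le> W (n, m)"
  shows "wiener_norm W y \<le> wiener_norm W f"
proof -
  obtain a where a: "power_series_of f a" "(\<lambda>p. norm (a p) * W p) summable_on UNIV"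
    "wiener_norm W f = (\<Sum>\<^sub>\<infinity>p. norm (a p) * W p)" using f by (rule wiener_algebraE)
  define B where "B m = (\<Sum>\<^sub>\<infinity>n. a (n, m))" for m
  define b where "b = (\<lambda>(n::nat, m). if n = 0 then B m else 0)"
  have Tsw: "((\<lambda>(m, n). norm (a (n, m)) * W (n, m)) has_sum (wiener_norm W f)) (UNIV \<times> UNIV)"
    using has_sum_infsum[OF a(2)] has_sum_swap[where A = UNIV and B = UNIV and f = "\<lambda>p. norm (a p) * W p"] a(3) by simp
  have row: "(\<lambda>n. norm (a (n, m)) * W (n, m)) summable_on UNIV" for m
    using summable_on_SigmaD1[OF has_sum_imp_summable[OF Tsw], of m] by simp
  have row': "(\<lambda>n. norm (a (n, m))) summable_on UNIV" for m
  proof (rule summable_on_comparison_test[OF row])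
    show "norm (a (n, m)) \<le> norm (a (n, m)) * W (n, m)" for n
      using mult_left_mono[OF ge1[of "(n, m)"], of "norm (a (n, m))"] by simp
  qed auto
  have B: "((\<lambda>n. a (n, m)) has_sum B m) UNIV" for m
    unfolding B_def by (rule has_sum_infsum[OF abs_summable_summable[OF row']])
  have B_le: "norm (B m) * W (0, m) \<le> (\<Sum>\<^sub>\<infinity>n. norm (a (n, m)) * W (n, m))" for m
  proof -
    have "norm (B m) \<le> (\<Sum>\<^sub>\<infinity>n. norm (a (n, m)))" by (rule norm_infsum_le[OF B has_sum_infsum[OF row']]) simp
    then have "norm (B m) * W (0, m) \<le> (\<Sum>\<^sub>\<infinity>n. norm (a (n, m))) * W (0, m)" using nonneg by (rule mult_right_mono)
    also have "\<dots> = (\<Sum>\<^sub>\<infinity>n. norm (a (n, m)) * W (0, m))" by (simp add: infsum_cmult_left')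
    also have "\<dots> \<le> (\<Sum>\<^sub>\<infinity>n. norm (a (n, m)) * W (n, m))"
      by (rule infsum_mono[OF summable_on_cmult_left[OF row'] row]) (auto intro!: mult_left_mono mono)
    finally show ?thesis .
  qed
  have hT: "((\<lambda>m. \<Sum>\<^sub>\<infinity>n. norm (a (n, m)) * W (n, m)) has_sum (wiener_norm W f)) UNIV"
    by (rule has_sum_SigmaD[OF Tsw]) (use has_sum_infsum[OF row] in simp)
  have B_s: "(\<lambda>m. norm (B m) * W (0, m)) summable_on UNIV"
    by (rule summable_on_comparison_test[OF has_sum_imp_summable[OF hT]]) (use B_le nonneg in auto)
  have ps: "power_series_of y b"
    unfolding power_series_of_def
  proof clarify
    fix z w :: complex assume zw: "z \<in> ball 0 1" "w \<in> ball 0 1"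
    have "((\<lambda>q. a q * w ^ snd q) has_sum f (1, w)) (UNIV \<times> UNIV)"
      using power_series_closed[OF f a(1), of "(1, w)"] zw by simp
    then have "((\<lambda>(m, n). a (n, m) * w ^ m) has_sum f (1, w)) (UNIV \<times> UNIV)"
      using has_sum_swap[where A = UNIV and B = UNIV and f = "\<lambda>q. a q * w ^ snd q"] by (simp add: case_prod_unfold)
    then have "((\<lambda>m. B m * w ^ m) has_sum f (1, w)) UNIV"
      by (rule has_sum_SigmaD) (use has_sum_cmult_left[OF B] in simp)
    then have "((\<lambda>(n::nat, m). if n = 0 then B m * w ^ m else 0) has_sum f (1, w)) UNIV" by (rule has_sum_row0)
    also have "(\<lambda>(n::nat, m). if n = 0 then B m * w ^ m else 0) = (\<lambda>(n, m). b (n, m) * z ^ n * w ^ m)"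
      by (auto simp: b_def fun_eq_iff)
    also have "f (1, w) = y (z, w)" using eq zw by simp
    finally show "((\<lambda>(n, m). b (n, m) * z ^ n * w ^ m) has_sum y (z, w)) UNIV" .
  qed
  have "((\<lambda>(n::nat, m). if n = 0 then norm (B m) * W (0, m) else 0) has_sum (\<Sum>\<^sub>\<infinity>m. norm (B m) * W (0, m))) UNIV"
    by (rule has_sum_row0[OF has_sum_infsum[OF B_s]])
  also have "(\<lambda>(n::nat, m). if n = 0 then norm (B m) * W (0, m) else 0) = (\<lambda>p. norm (b p) * W p)"
    by (auto simp: b_def fun_eq_iff)
  finally have "wiener_norm W y = (\<Sum>\<^sub>\<infinity>m. norm (B m) * W (0, m))"
    unfolding wiener_norm_eq[OF ps] by (rule infsumI)
  also have "\<dots> \<le> wiener_norm W f"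
    using infsum_mono[OF B_s has_sum_imp_summable[OF hT] B_le] infsumI[OF hT] by simp
  finally show ?thesis .
qed

text \<open>Cauchy's estimates bound every Taylor coefficient by the supremum \<open>B\<close> on
  the circle, and dilation contributes \<open>\<rho> ^ m\<close>; the rest is the sum of
  \<open>(m + 1) * \<rho> ^ m\<close>. Only a supremum enters, so for every power of a reciprocal
  the loss is the same factor \<open>1 / (1 - \<rho>)^2\<close>.\<close>

lemma dilated_snd:
  assumes c: "continuous_on (cball 0 1) Q" and h: "Q holomorphic_on ball 0 1"
    and B: "\<And>w. norm w = 1 \<Longrightarrow> norm (Q w) \<le> B" and \<rho>: "0 < \<rho>" "\<rho> < 1"
    and W: "\<And>m. W (0, m) \<le> 1 + real m"
  shows "(\<lambda>p. Q (of_real \<rho> * snd p)) \<in> wiener_algebra W"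
    "wiener_norm W (\<lambda>p. Q (of_real \<rho> * snd p)) \<le> B / (1 - \<rho>)\<^sup>2"
proof -
  define q where "q m = (deriv ^^ m) Q 0 / fact m" for m
  have q: "norm (q m) \<le> B" for m
  proof -
    have "norm ((deriv ^^ m) Q 0) \<le> fact m * B / 1 ^ m"
      by (rule Cauchy_inequality[OF h c]) (use B in auto)
    then show ?thesis by (simp add: q_def norm_divide field_simps)
  qed
  have B0: "B \<ge> 0" using order_trans[OF norm_ge_zero q] .
  have ball: "of_real \<rho> * w \<in> ball 0 1" if "norm w \<le> 1" for w :: complex
  proof -
    have "\<rho> * norm w \<le> \<rho> * 1" using that \<rho> by (intro mult_left_mono) auto
    also have "\<dots> < 1" using \<rho> by simp
    finally show ?thesis using \<rho> by (simp add: norm_mult)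
  qed
  define b where "b = (\<lambda>(n::nat, m). if n = 0 then q m * of_real \<rho> ^ m else 0)"
  have ser: "((\<lambda>m. real (Suc m) * \<rho> ^ m) has_sum (1 / (1 - \<rho>)\<^sup>2)) UNIV"
    using \<rho> by (intro sums_nonneg_imp_has_sum geometric_deriv_sums) auto
  have ba: "(\<lambda>p. Q (of_real \<rho> * snd p)) \<in> bidisc_algebra"
  proof (rule bidisc_algebra_snd_comp[where Q = "\<lambda>w. Q (of_real \<rho> * w)"])
    show "continuous_on (cball 0 1) (\<lambda>w. Q (of_real \<rho> * w))"
      using ball by (intro continuous_on_compose2[OF c] continuous_intros) force
    show "(\<lambda>w. Q (of_real \<rho> * w)) holomorphic_on ball 0 1"
      using ball by (intro holomorphic_on_compose_gen[OF _ h, unfolded o_def] holomorphic_intros) auto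
  qed
  have ps: "power_series_of (\<lambda>p. Q (of_real \<rho> * snd p)) b"
    unfolding power_series_of_def
  proof clarify
    fix z w :: complex assume zw: "z \<in> ball 0 1" "w \<in> ball 0 1"
    define \<zeta> where "\<zeta> = of_real \<rho> * w"
    have \<zeta>: "norm \<zeta> < 1" using ball[of w] zw by (simp add: \<zeta>_def)
    have "(\<lambda>m. q m * (\<zeta> - 0) ^ m) sums Q \<zeta>"
      unfolding q_def by (rule holomorphic_power_series[OF h]) (use \<zeta> in auto)
    then have s: "(\<lambda>m. q m * \<zeta> ^ m) sums Q \<zeta>" by simp
    have "summable (\<lambda>m. norm (q m * \<zeta> ^ m))"
    proof (rule summable_comparison_test'[of "\<lambda>m. B * norm \<zeta> ^ m" 0])
      show "summable (\<lambda>m. B * norm \<zeta> ^ m)" using \<zeta> by (intro summable_mult summable_geometric) auto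
      show "norm (norm (q m * \<zeta> ^ m)) \<le> B * norm \<zeta> ^ m" for m
        using q[of m] by (simp add: norm_mult norm_power mult_right_mono)
    qed
    then have "((\<lambda>m. q m * \<zeta> ^ m) has_sum Q \<zeta>) UNIV" using s by (rule norm_summable_imp_has_sum)
    then have "((\<lambda>(n::nat, m). if n = 0 then q m * \<zeta> ^ m else 0) has_sum Q \<zeta>) UNIV" by (rule has_sum_row0)
    also have "(\<lambda>(n::nat, m). if n = 0 then q m * \<zeta> ^ m else 0) = (\<lambda>(n, m). b (n, m) * z ^ n * w ^ m)"
      by (auto simp: b_def \<zeta>_def power_mult_distrib fun_eq_iff)
    finally show "((\<lambda>(n, m). b (n, m) * z ^ n * w ^ m) has_sum Q (of_real \<rho> * snd (z, w))) UNIV"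
      by (simp add: \<zeta>_def)
  qed
  have S: "((\<lambda>(n::nat, m). if n = 0 then B * (real (Suc m) * \<rho> ^ m) else 0) has_sum (B * (1 / (1 - \<rho>)\<^sup>2))) UNIV"
    by (rule has_sum_row0[OF has_sum_cmult_right[OF ser]])
  have le: "norm (b p) * W p \<le> (case p of (n, m) \<Rightarrow> if n = 0 then B * (real (Suc m) * \<rho> ^ m) else 0)" for p
  proof (cases p)
    case (Pair n m)
    have "norm (q m) * \<rho> ^ m * W (0, m) \<le> B * \<rho> ^ m * (1 + real m)"
      using q[of m] W[of m] \<rho> B0 nonneg by (intro mult_mono) auto
    then show ?thesis using Pair \<rho> by (auto simp: b_def norm_mult norm_power algebra_simps)
  qed
  have s: "(\<lambda>p. norm (b p) * W p) summable_on UNIV"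
    by (rule summable_on_comparison_test[OF has_sum_imp_summable[OF S]]) (use le nonneg in auto)
  show "(\<lambda>p. Q (of_real \<rho> * snd p)) \<in> wiener_algebra W"
    using ba ps s unfolding wiener_algebra_def by blast
  show "wiener_norm W (\<lambda>p. Q (of_real \<rho> * snd p)) \<le> B / (1 - \<rho>)\<^sup>2"
    unfolding wiener_norm_eq[OF ps]
    using infsum_mono[OF s has_sum_imp_summable[OF S] le] infsumI[OF S] by simp
qed

end

section \<open>Norm-controlled inversion\<close>

lemma power_weight_weight:
  assumes "\<alpha> \<ge> 0" "\<beta> \<ge> 0"
  shows "weight (power_weight \<alpha> \<beta>)"
proof
  show "power_weight \<alpha> \<beta> 0 = 1" by (simp add: power_weight_def zero_prod_def)
  fix p q :: "nat \<times> nat"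
  obtain n m i j where pq: "p = (n, m)" "q = (i, j)" by (cases p; cases q)
  have "1 * 1 \<le> (1 + real n) powr \<alpha> * (1 + real m) powr \<beta>"
    using assms by (intro mult_mono ge_one_powr_ge_zero) auto
  then show "power_weight \<alpha> \<beta> p \<ge> 1" by (simp add: power_weight_def pq)
  have le: "(1 + real (a + b)) powr c \<le> (1 + real a) powr c * (1 + real b) powr c" if "c \<ge> 0" for a b :: nat and c :: real
  proof -
    have "(1 + real (a + b)) powr c \<le> ((1 + real a) * (1 + real b)) powr c"
      using that by (intro powr_mono2) (auto simp: algebra_simps)
    then show ?thesis by (simp add: powr_mult)
  qed
  have "(1 + real (n + i)) powr \<alpha> * (1 + real (m + j)) powr \<beta>
      \<le> ((1 + real n) powr \<alpha> * (1 + real i) powr \<alpha>) * ((1 + real m) powr \<beta> * (1 + real j) powr \<beta>)"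
    using le assms by (intro mult_mono) auto
  then show "power_weight \<alpha> \<beta> (p + q) \<le> power_weight \<alpha> \<beta> p * power_weight \<alpha> \<beta> q"
    by (simp add: power_weight_def pq algebra_simps)
qed

lemma powr_add_le:
  fixes x y b :: real
  assumes "x > 0" "y > 0" "0 < b" "b \<le> 1"
  shows "(x + y) powr b \<le> x powr b + y powr b"
proof -
  have le: "t / (x + y) \<le> (t / (x + y)) powr b" if "0 < t" "t \<le> x + y" for t
  proof -
    have "(t / (x + y)) powr 1 \<le> (t / (x + y)) powr b"
      using that assms by (intro powr_mono') auto
    then show ?thesis using that by simp
  qed
  have "1 = x / (x + y) + y / (x + y)" using assms by (simp add: add_divide_distrib[symmetric])
  also have "\<dots> \<le> (x / (x + y)) powr b + (y / (x + y)) powr b"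
    using le assms by (intro add_mono) auto
  also have "\<dots> = (x powr b + y powr b) / (x + y) powr b"
    using assms by (simp add: powr_divide add_divide_distrib)
  finally show ?thesis using assms by (simp add: field_simps)
qed

text \<open>Subadditivity of \<open>t powr \<beta>\<close> for \<open>\<beta> \<le> 1\<close> in the
  second index, submultiplicativity in the first, where both weights coincide.\<close>

lemma power_weight_two_weights:
  assumes "\<alpha> \<ge> 0" "0 < \<beta>" "\<beta> \<le> 1"
  shows "power_weight \<alpha> \<beta> (p + q) \<le> power_weight \<alpha> \<beta> p * power_weight \<alpha> 0 q + power_weight \<alpha> 0 p * power_weight \<alpha> \<beta> q"
proof -
  obtain n m i j where pq: "p = (n, m)" "q = (i, j)" by (cases p; cases q)
  have "(1 + real (n + i)) powr \<alpha> \<le> ((1 + real n) * (1 + real i)) powr \<alpha>"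
    using assms by (intro powr_mono2) (auto simp: algebra_simps)
  then have 1: "(1 + real (n + i)) powr \<alpha> \<le> (1 + real n) powr \<alpha> * (1 + real i) powr \<alpha>" by (simp add: powr_mult)
  have "(1 + real (m + j)) powr \<beta> \<le> ((1 + real m) + (1 + real j)) powr \<beta>"
    using assms by (intro powr_mono2) auto
  also have "\<dots> \<le> (1 + real m) powr \<beta> + (1 + real j) powr \<beta>"
    using assms by (intro powr_add_le) auto
  finally have 2: "(1 + real (m + j)) powr \<beta> \<le> (1 + real m) powr \<beta> + (1 + real j) powr \<beta>" .
  have "(1 + real (n + i)) powr \<alpha> * (1 + real (m + j)) powr \<beta>
      \<le> ((1 + real n) powr \<alpha> * (1 + real i) powr \<alpha>) * ((1 + real m) powr \<beta> + (1 + real j) powr \<beta>)"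
    using 1 2 by (intro mult_mono) auto
  then show ?thesis by (simp add: power_weight_def pq algebra_simps)
qed

text \<open>With \<open>t = \<eta> * (1 + m)\<close>, the left side is at most 1 and, by Bernoulli,
  at most \<open>t\<close>; hence at most \<open>t powr b\<close>. This converts the dilation error
  of a coefficient into a gain \<open>\<eta> powr b\<close> at the price of the weight.\<close>

lemma power_le_powr:
  assumes "0 < \<eta>" "\<eta> < 1" "0 < b" "b \<le> 1"
  shows "1 - (1 - \<eta>) ^ m \<le> \<eta> powr b * (1 + real m) powr b"
proof -
  have n1: "1 - (1 - \<eta>) ^ m \<le> 1" using assms by simp
  have n2: "1 - (1 - \<eta>) ^ m \<le> \<eta> * (1 + real m)"
    using Bernoulli_inequality[of "- \<eta>" m] assms by (simp add: algebra_simps)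
  define t where "t = \<eta> * (1 + real m)"
  have t: "t > 0" using assms by (simp add: t_def)
  have "1 - (1 - \<eta>) ^ m \<le> t powr b"
  proof (cases "t \<le> 1")
    case True
    have "t powr 1 \<le> t powr b" using True t assms by (intro powr_mono') auto
    then show ?thesis using n2 t by (simp add: t_def)
  next
    case False
    then have "1 \<le> t powr b" using assms by (intro ge_one_powr_ge_zero) auto
    then show ?thesis using n1 by simp
  qed
  then show ?thesis using assms by (simp add: t_def powr_mult)
qed

text \<open>Induction with the Leibniz-type inequality; the factor \<open>k + 1\<close> is the one
  in the derivative of a power, and only one factor is measured in the norm of
  \<open>W\<close>.\<close>

lemma wiener_norm_power_two_weights:
  assumes W: "weight W" and V: "weight V" and xW: "x \<in> wiener_algebra W" and xV: "x \<in> wiener_algebra V"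
    and le: "\<And>q r. W (q + r) \<le> W q * V r + V q * W r"
  shows "wiener_norm W (\<lambda>p. x p ^ Suc k) \<le> real (Suc k) * wiener_norm W x * wiener_norm V x ^ k"
proof (induction k)
  case 0 then show ?case by simp
next
  case (Suc k)
  interpret W: weight W by (rule W)
  interpret V: weight V by (rule V)
  have "wiener_norm W (\<lambda>p. x p * x p ^ Suc k)
      \<le> wiener_norm W x * wiener_norm V (\<lambda>p. x p ^ Suc k) + wiener_norm V x * wiener_norm W (\<lambda>p. x p ^ Suc k)"
    by (rule wiener_algebra_mult_two_weights[OF xW xV W.power(1)[OF xW] V.power(1)[OF xV] le W.nonneg])
  also have "\<dots> \<le> wiener_norm W x * wiener_norm V x ^ Suc k
      + wiener_norm V x * (real (Suc k) * wiener_norm W x * wiener_norm V x ^ k)"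
    using Suc V.power(2)[OF xV, of "Suc k"] W.norm_nonneg V.norm_nonneg by (intro add_mono mult_left_mono) auto
  also have "\<dots> = real (Suc (Suc k)) * wiener_norm W x * wiener_norm V x ^ Suc k" by (simp add: algebra_simps)
  finally show ?case by simp
qed

text \<open>Let \<open>h\<close> be the polynomial, \<open>g(w) = h((1 - \<eta>) w)\<close> and \<open>r = (g - h) / g\<close>. In the norm without weight in \<open>w\<close>,
  \<open>g - h\<close> is of size \<open>\<eta>\<^sup>\<beta>\<close>, whereas by Cauchy estimates the weighted norm of \<open>1 / g\<^sup>k\<close> loses only
  \<open>\<eta>\<^sup>-\<^sup>2\<close> for every \<open>k\<close>. Hence some fixed power of \<open>r\<close> is small, and a Neumann series inverts \<open>1 - r = h / g\<close>.\<close>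

theorem quantitative_inverse:
  assumes \<alpha>: "\<alpha> \<ge> 0" and \<beta>: "0 < \<beta>" "\<beta> \<le> 1" and M: "M > 0"
  obtains A K where "A > 0"
    "\<And>(I :: (nat \<times> nat) set) c \<delta>. finite I \<Longrightarrow> (\<Sum>i\<in>I. norm (c i) * (1 + real (snd i)) powr \<beta>) \<le> M \<Longrightarrow> \<delta> > 0 \<Longrightarrow>
      (\<And>w. norm w \<le> 1 \<Longrightarrow> norm (\<Sum>i\<in>I. c i * w ^ snd i) \<ge> \<delta>) \<Longrightarrow>
      (\<lambda>p. inverse (\<Sum>i\<in>I. c i * snd p ^ snd i)) \<in> wiener_algebra (power_weight \<alpha> \<beta>) \<and>
      wiener_norm (power_weight \<alpha> \<beta>) (\<lambda>p. inverse (\<Sum>i\<in>I. c i * snd p ^ snd i)) \<le> A / \<delta> ^ K"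
proof -
  \<comment> \<open>Makes \<open>\<eta> powr (\<beta> * j) \<le> \<eta> ^ 3\<close>: two powers of
    \<open>\<eta>\<close> pay for the Cauchy estimate and one is left over. The one further factor,
    measured in the norm of \<open>W\<close>, explains \<open>k = j + 1\<close>.\<close>
  define j where "j = nat \<lceil>3 / \<beta>\<rceil>"
  have "3 / \<beta> \<le> real j" unfolding j_def by (rule real_nat_ceiling_ge)
  then have j: "\<beta> * real j \<ge> 3" using \<beta> by (simp add: field_simps)
  define k where "k = Suc j"
  \<comment> \<open>Bookkeeping for the final bound:
    \<open>1 + R \<le> D / \<delta> ^ (2 * k + 1)\<close>, where \<open>R\<close> bounds the norm of
    \<open>r\<close>, and \<open>K\<close> adds the exponents of \<open>1 / \<delta>\<close> from
    \<open>1 / g\<close>, from \<open>1 / \<eta> ^ 2\<close> and from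
    \<open>(1 + R) ^ k\<close>.\<close>
  define D where "D = M ^ (2 * k + 1) + 4 * real k ^ 2 * M ^ (2 * k + 1)"
  define A where "A = 8 * real k ^ 3 * M ^ (2 * k) * D ^ k"
  define K where "K = 1 + 2 * k + (2 * k + 1) * k"
  have k: "real k > 0" by (simp add: k_def)
  have D: "D > 0" using M k by (simp add: D_def add_pos_pos)
  have A: "A > 0" using M k D by (simp add: A_def)
  have main: "(\<lambda>p. inverse (\<Sum>i\<in>I. c i * snd p ^ snd i)) \<in> wiener_algebra (power_weight \<alpha> \<beta>) \<and>
      wiener_norm (power_weight \<alpha> \<beta>) (\<lambda>p. inverse (\<Sum>i\<in>I. c i * snd p ^ snd i)) \<le> A / \<delta> ^ K"
    if I: "finite I" and cM: "(\<Sum>i\<in>I. norm (c i) * (1 + real (snd i)) powr \<beta>) \<le> M" and \<delta>: "\<delta> > 0"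
      and low: "\<And>w. norm w \<le> 1 \<Longrightarrow> norm (\<Sum>i\<in>I. c i * w ^ snd i) \<ge> \<delta>"
    for I :: "(nat \<times> nat) set" and c \<delta>
  proof -
    define W where "W = power_weight \<alpha> \<beta>"
    define V where "V = power_weight \<alpha> 0"
    interpret W: weight W unfolding W_def using \<alpha> \<beta> by (intro power_weight_weight) auto
    interpret V: weight V unfolding V_def using \<alpha> by (intro power_weight_weight) auto
    have WV: "W (q + r) \<le> W q * V r + V q * W r" for q r
      unfolding W_def V_def by (rule power_weight_two_weights[OF \<alpha> \<beta>])
    have W0: "W (0, m) = (1 + real m) powr \<beta>" and V0: "V (0, m) = 1" for m
      by (simp_all add: W_def V_def power_weight_def)
    have W0_le: "W (0, m) \<le> 1 + real m" for m
    proof -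
      have "(1 + real m) powr \<beta> \<le> (1 + real m) powr 1" using \<beta> by (intro powr_mono) auto
      then show ?thesis by (simp add: W0)
    qed
    define h where "h w = (\<Sum>i\<in>I. c i * w ^ snd i)" for w
    have h_low: "norm (h w) \<ge> \<delta>" if "norm w \<le> 1" for w using low[OF that] by (simp add: h_def)
    have h_nz: "h w \<noteq> 0" if "norm w \<le> 1" for w using h_low[OF that] \<delta> by auto
    have h_hol: "h holomorphic_on S" for S unfolding h_def by (intro holomorphic_intros)
    have c1: "(\<Sum>i\<in>I. norm (c i)) \<le> M"
    proof -
      have "(\<Sum>i\<in>I. norm (c i)) \<le> (\<Sum>i\<in>I. norm (c i) * (1 + real (snd i)) powr \<beta>)"
      proof (rule sum_mono)
        fix i :: "nat \<times> nat"
        have "1 \<le> (1 + real (snd i)) powr \<beta>" using \<beta> by (intro ge_one_powr_ge_zero) auto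
        then show "norm (c i) \<le> norm (c i) * (1 + real (snd i)) powr \<beta>" by (metis mult.right_neutral mult_left_mono norm_ge_zero)
      qed
      then show ?thesis using cM by simp
    qed
    have \<delta>M: "\<delta> \<le> M"
    proof -
      have "norm (h 1) \<le> (\<Sum>i\<in>I. norm (c i))" unfolding h_def using norm_sum[of c I] by simp
      then show ?thesis using h_low[of 1] c1 by simp
    qed
    \<comment> \<open>Solves \<open>k * (M / \<delta>) ^ k * \<eta> = 1 / 2\<close>, whose left side
      is the bound obtained below for the norm of \<open>r ^ k\<close>.\<close>
    define \<eta> where "\<eta> = (\<delta> / M) ^ k / (2 * real k)"
    have dk: "0 < (\<delta> / M) ^ k" "(\<delta> / M) ^ k \<le> 1" using \<delta> M \<delta>M by (auto intro: power_le_one)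
    have "(\<delta> / M) ^ k / (2 * real k) \<le> 1 / 2" using dk k by (intro frac_le) (auto simp: k_def)
    then have \<eta>: "0 < \<eta>" "\<eta> < 1" using dk k by (auto simp: \<eta>_def)
    define \<rho> where "\<rho> = 1 - \<eta>"
    have \<rho>: "0 < \<rho>" "\<rho> < 1" using \<eta> by (auto simp: \<rho>_def)
    define g where "g = (\<lambda>p :: complex \<times> complex. h (of_real \<rho> * snd p))"
    have snd_le: "norm (of_real \<rho> * snd p :: complex) \<le> 1" if "p \<in> closed_bidisc" for p :: "complex \<times> complex"
    proof -
      have "\<rho> * norm (snd p) \<le> 1 * 1" using that \<rho> by (intro mult_mono) (auto simp: mem_Times_iff)
      then show ?thesis using \<rho> by (simp add: norm_mult)
    qed
    define x where "x = (\<lambda>p :: complex \<times> complex. g p - h (snd p))"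
    have x_eq: "x = (\<lambda>p. \<Sum>i\<in>I. (c i * (of_real \<rho> ^ snd i - 1)) * fst p ^ 0 * snd p ^ snd i)"
      by (rule ext) (simp add: x_def g_def h_def sum_subtractf[symmetric] power_mult_distrib algebra_simps)
    have coef: "norm (c i * (of_real \<rho> ^ snd i - 1)) = norm (c i) * (1 - \<rho> ^ snd i)" for i
    proof -
      have "norm (of_real \<rho> ^ snd i - 1 :: complex) = norm (of_real (\<rho> ^ snd i - 1) :: complex)" by simp
      also have "\<dots> = 1 - \<rho> ^ snd i" unfolding norm_of_real using \<rho> by (simp add: power_le_one)
      finally show ?thesis by (simp add: norm_mult)
    qed
    have xW: "x \<in> wiener_algebra W" unfolding x_eq by (rule W.polynomial)
    have xV: "x \<in> wiener_algebra V" unfolding x_eq by (rule V.polynomial)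
    have x_W: "wiener_norm W x \<le> M"
    proof -
      have "wiener_norm W x \<le> (\<Sum>i\<in>I. norm (c i * (of_real \<rho> ^ snd i - 1)) * W (0, snd i))"
        unfolding x_eq by (rule W.polynomial(2))
      also have "\<dots> \<le> (\<Sum>i\<in>I. norm (c i) * (1 + real (snd i)) powr \<beta>)"
        unfolding coef W0 using \<rho> by (intro sum_mono mult_right_mono mult_left_le) (auto simp: power_le_one)
      finally show ?thesis using cM by simp
    qed
    have x_V: "wiener_norm V x \<le> \<eta> powr \<beta> * M"
    proof -
      have "wiener_norm V x \<le> (\<Sum>i\<in>I. norm (c i * (of_real \<rho> ^ snd i - 1)) * V (0, snd i))"
        unfolding x_eq by (rule V.polynomial(2))
      also have "\<dots> \<le> (\<Sum>i\<in>I. norm (c i) * (\<eta> powr \<beta> * (1 + real (snd i)) powr \<beta>))"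
        unfolding coef V0 mult_1_right unfolding \<rho>_def using power_le_powr[OF \<eta> \<beta>] by (intro sum_mono mult_left_mono) auto
      also have "\<dots> = \<eta> powr \<beta> * (\<Sum>i\<in>I. norm (c i) * (1 + real (snd i)) powr \<beta>)"
        by (simp add: sum_distrib_left algebra_simps)
      also have "\<dots> \<le> \<eta> powr \<beta> * M" using cM by (intro mult_left_mono) auto
      finally show ?thesis .
    qed
    have inv_g: "(\<lambda>p. inverse (g p) ^ l) \<in> wiener_algebra W"
      "wiener_norm W (\<lambda>p. inverse (g p) ^ l) \<le> inverse \<delta> ^ l / \<eta>\<^sup>2" for l
    proof -
      define Q where "Q w = inverse (h w) ^ l" for w
      have Qc: "Q holomorphic_on cball 0 1" unfolding Q_def
        by (intro holomorphic_intros h_hol) (use h_nz in auto)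
      have "(\<lambda>p. Q (of_real \<rho> * snd p)) \<in> wiener_algebra W \<and>
          wiener_norm W (\<lambda>p. Q (of_real \<rho> * snd p)) \<le> (inverse \<delta> ^ l) / (1 - \<rho>)\<^sup>2"
      proof (intro conjI W.dilated_snd)
        show "continuous_on (cball 0 1) Q" "continuous_on (cball 0 1) Q"
          using Qc by (auto intro: holomorphic_on_imp_continuous_on)
        show "Q holomorphic_on ball 0 1" "Q holomorphic_on ball 0 1"
          using Qc by (auto intro: holomorphic_on_subset)
        show "norm (Q w) \<le> inverse \<delta> ^ l" "norm (Q w) \<le> inverse \<delta> ^ l" if "norm w = 1" for w
          unfolding Q_def norm_power norm_inverse
          using h_low[of w] that \<delta> by (intro power_mono le_imp_inverse_le; simp)+
      qed (use \<rho> W0_le in auto)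
      then show "(\<lambda>p. inverse (g p) ^ l) \<in> wiener_algebra W"
        "wiener_norm W (\<lambda>p. inverse (g p) ^ l) \<le> inverse \<delta> ^ l / \<eta>\<^sup>2"
        by (simp_all add: Q_def g_def \<rho>_def)
    qed
    define r where "r p = x p * inverse (g p)" for p
    have rW: "r \<in> wiener_algebra W" and r_W: "wiener_norm W r \<le> M * (inverse \<delta> / \<eta>\<^sup>2)"
      unfolding r_def using W.mult(1)[OF xW inv_g(1)[of 1]] W.norm_mult_le[OF xW inv_g(1)[of 1] x_W inv_g(2)[of 1]]
      by simp_all
    have rk: "wiener_norm W (\<lambda>p. r p ^ k) \<le> 1 / 2"
    proof -
      have "wiener_norm W (\<lambda>p. x p ^ Suc j) \<le> real (Suc j) * wiener_norm W x * wiener_norm V x ^ j"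
        by (rule wiener_norm_power_two_weights[OF _ _ xW xV WV]) (unfold_locales)
      also have "\<dots> \<le> real (Suc j) * M * (\<eta> powr \<beta> * M) ^ j"
        using x_W x_V W.norm_nonneg V.norm_nonneg M by (intro mult_mono power_mono) auto
      also have "(\<eta> powr \<beta> * M) ^ j = \<eta> powr (\<beta> * real j) * M ^ j"
      proof -
        have "\<eta> powr \<beta> > 0" using \<eta> by simp
        then show ?thesis by (simp add: power_mult_distrib powr_realpow[symmetric] powr_powr)
      qed
      also have "real (Suc j) * M * (\<eta> powr (\<beta> * real j) * M ^ j) \<le> real (Suc j) * M * (\<eta> ^ 3 * M ^ j)"
      proof -
        have "\<eta> powr (\<beta> * real j) \<le> \<eta> powr 3" using j \<eta> by (intro powr_mono') auto
        also have "\<dots> = \<eta> ^ 3" using \<eta> by simp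
        finally show ?thesis using M by (intro mult_left_mono mult_right_mono) auto
      qed
      finally have xk: "wiener_norm W (\<lambda>p. x p ^ k) \<le> real k * M ^ k * \<eta> ^ 3" by (simp add: k_def algebra_simps)
      have "wiener_norm W (\<lambda>p. r p ^ k) = wiener_norm W (\<lambda>p. x p ^ k * inverse (g p) ^ k)"
        by (simp add: r_def power_mult_distrib)
      also have "\<dots> \<le> (real k * M ^ k * \<eta> ^ 3) * (inverse \<delta> ^ k / \<eta>\<^sup>2)"
        by (rule W.norm_mult_le[OF W.power(1)[OF xW] inv_g(1) xk inv_g(2)])
      also have "\<dots> = real k * M ^ k * (\<eta> ^ 3 * (inverse \<delta> ^ k / \<eta>\<^sup>2))" by (simp only: mult.assoc)
      also have "\<eta> ^ 3 * (inverse \<delta> ^ k / \<eta>\<^sup>2) = inverse \<delta> ^ k * \<eta>"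
        using \<eta> by (simp add: power2_eq_square power3_eq_cube)
      also have "real k * M ^ k * (inverse \<delta> ^ k * \<eta>) = (M ^ k * inverse \<delta> ^ k * (\<delta> / M) ^ k) / 2"
        using k by (simp add: \<eta>_def)
      also have "M ^ k * inverse \<delta> ^ k * (\<delta> / M) ^ k = (M * inverse \<delta> * (\<delta> / M)) ^ k"
        by (simp only: power_mult_distrib)
      also have "M * inverse \<delta> * (\<delta> / M) = 1" using M \<delta> by simp
      finally have "wiener_norm W (\<lambda>p. r p ^ k) \<le> 1 ^ k / 2" .
      then show ?thesis by simp
    qed
    have rkW: "(\<lambda>p. r p ^ k) \<in> wiener_algebra W" by (rule W.power(1)[OF rW])
    have lt1: "wiener_norm W (\<lambda>p. r p ^ k) < 1" using rk by simp
    note nm = W.neumann[OF rkW lt1]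
    define v where "v p = inverse (1 - r p ^ k)" for p
    have vW: "v \<in> wiener_algebra W" and v2: "wiener_norm W v \<le> 2"
    proof -
      show "v \<in> wiener_algebra W" using nm(1) by (simp add: v_def[abs_def])
      have "1 / (1 - wiener_norm W (\<lambda>p. r p ^ k)) \<le> 1 / (1 / 2)" using rk by (intro divide_left_mono) auto
      then show "wiener_norm W v \<le> 2" using nm(2) by (simp add: v_def[abs_def])
    qed
    define R where "R = M * (inverse \<delta> / \<eta>\<^sup>2)"
    have R0: "R \<ge> 0" using M \<delta> by (simp add: R_def)
    have sW: "(\<lambda>p. \<Sum>l<k. r p ^ l) \<in> wiener_algebra W" by (rule W.sum(1)) (rule W.power(1)[OF rW])
    have s_le: "wiener_norm W (\<lambda>p. \<Sum>l<k. r p ^ l) \<le> real k * (1 + R) ^ k"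
    proof -
      have "wiener_norm W (\<lambda>p. \<Sum>l<k. r p ^ l) \<le> (\<Sum>l<k. wiener_norm W (\<lambda>p. r p ^ l))"
        by (rule W.sum(2)) (rule W.power(1)[OF rW])
      also have "\<dots> \<le> (\<Sum>l<k. (1 + R) ^ k)"
      proof (rule sum_mono)
        fix l assume "l \<in> {..<k}"
        have "wiener_norm W (\<lambda>p. r p ^ l) \<le> wiener_norm W r ^ l" by (rule W.power(2)[OF rW])
        also have "\<dots> \<le> (1 + R) ^ l" using r_W W.norm_nonneg by (intro power_mono) (auto simp: R_def)
        also have "\<dots> \<le> (1 + R) ^ k" using R0 \<open>l \<in> {..<k}\<close> by (intro power_increasing) auto
        finally show "wiener_norm W (\<lambda>p. r p ^ l) \<le> (1 + R) ^ k" .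
      qed
      finally show ?thesis by simp
    qed
    \<comment> \<open>Since \<open>h / g = 1 - r\<close>, the reciprocal of \<open>h\<close> is
      \<open>1 / g\<close> times \<open>1 / (1 - r)\<close>, and the latter is the finite geometric
      sum divided by \<open>1 - r ^ k\<close>; smallness is known for \<open>r ^ k\<close>, not for
      \<open>r\<close>.\<close>
    define y where "y p = inverse (g p) * ((\<Sum>l<k. r p ^ l) * v p)" for p
    have yW: "y \<in> wiener_algebra W"
      using W.mult(1)[OF inv_g(1)[of 1] W.mult(1)[OF sW vW]] by (simp add: y_def[abs_def])
    have "wiener_norm W (\<lambda>p. (\<Sum>l<k. r p ^ l) * v p) \<le> (real k * (1 + R) ^ k) * 2"
      by (rule W.norm_mult_le[OF sW vW s_le v2])
    from W.norm_mult_le[OF inv_g(1)[of 1] W.mult(1)[OF sW vW] inv_g(2)[of 1] this]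
    have y_le: "wiener_norm W y \<le> (inverse \<delta> / \<eta>\<^sup>2) * ((real k * (1 + R) ^ k) * 2)"
      by (simp add: y_def[abs_def])
    have \<eta>2: "inverse (\<eta>\<^sup>2) = 4 * real k ^ 2 * (M ^ (2 * k) / \<delta> ^ (2 * k))"
    proof -
      have "\<eta>\<^sup>2 = (\<delta> ^ (2 * k) / M ^ (2 * k)) / (4 * real k ^ 2)"
        by (simp add: \<eta>_def power_divide power_mult_distrib power_mult[symmetric] mult.commute)
      then show ?thesis by simp
    qed
    have R_eq: "R = 4 * real k ^ 2 * M ^ (2 * k + 1) / \<delta> ^ (2 * k + 1)"
    proof -
      have "M * (inverse d * (4 * q * (a / b))) = 4 * q * (M * a) / (d * b)" for q a b d :: real
        by (simp add: divide_inverse mult_ac)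
      from this[of \<delta> "real k ^ 2"] show ?thesis unfolding R_def divide_inverse[of _ "\<eta>\<^sup>2"] \<eta>2 by simp
    qed
    have "1 + R \<le> D / \<delta> ^ (2 * k + 1)"
    proof -
      have "\<delta> ^ (2 * k + 1) \<le> M ^ (2 * k + 1)" using \<delta> \<delta>M by (intro power_mono) auto
      then have "1 \<le> M ^ (2 * k + 1) / \<delta> ^ (2 * k + 1)" using \<delta> by (simp add: field_simps)
      then show ?thesis unfolding R_eq D_def add_divide_distrib by simp
    qed
    then have "(1 + R) ^ k \<le> (D / \<delta> ^ (2 * k + 1)) ^ k" using R0 by (intro power_mono) auto
    also have "\<dots> = D ^ k / \<delta> ^ ((2 * k + 1) * k)" by (simp only: power_divide power_mult[symmetric])
    finally have Rk: "(1 + R) ^ k \<le> D ^ k / \<delta> ^ ((2 * k + 1) * k)" .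
    have "wiener_norm W y \<le> (inverse \<delta> / \<eta>\<^sup>2) * ((real k * (D ^ k / \<delta> ^ ((2 * k + 1) * k))) * 2)"
      by (rule order_trans[OF y_le]) (intro mult_left_mono mult_right_mono Rk; use \<delta> in simp)
    also have "\<dots> = A / \<delta> ^ K"
    proof -
      have "inverse d * (4 * q ^ 2 * (a / b)) * (q * (c / e) * 2) = 8 * q ^ 3 * a * c / (d * b * e)" for q a b c d e :: real
        by (simp add: divide_inverse mult_ac power2_eq_square power3_eq_cube)
      from this[of \<delta> "real k"] show ?thesis
        unfolding divide_inverse[of _ "\<eta>\<^sup>2"] \<eta>2 A_def K_def power_add power_one_right by simp
    qed
    finally have y_final: "wiener_norm W y \<le> A / \<delta> ^ K" .
    have eq: "inverse (\<Sum>i\<in>I. c i * snd p ^ snd i) = y p" if p: "p \<in> closed_bidisc" for p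
    proof -
      have g_nz: "g p \<noteq> 0" unfolding g_def by (rule h_nz[OF snd_le[OF p]])
      have "norm (snd p) \<le> 1" using p by (auto simp: mem_Times_iff)
      then have hp: "h (snd p) \<noteq> 0" by (rule h_nz)
      have rp: "r p ^ k \<noteq> 1" by (rule nm(3)[OF p])
      have "h (snd p) * inverse (g p) = 1 - r p" using g_nz by (simp add: r_def x_def field_simps)
      moreover have "(1 - r p) * (\<Sum>l<k. r p ^ l) = 1 - r p ^ k" using one_diff_power_eq[of "r p" k] by simp
      ultimately have "(h (snd p) * inverse (g p)) * (\<Sum>l<k. r p ^ l) * inverse (1 - r p ^ k) = 1"
        using rp by simp
      then have "h (snd p) * (inverse (g p) * ((\<Sum>l<k. r p ^ l) * inverse (1 - r p ^ k))) = 1"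
        by (simp only: mult.assoc)
      then show ?thesis using hp by (simp add: y_def v_def h_def[symmetric] inverse_unique)
    qed
    show ?thesis
      using wiener_algebra_cong[OF yW eq] y_final unfolding W_def by simp
  qed
  show thesis by (rule that[OF A main])
qed

section \<open>The Hahn-Banach theorem\<close>

definition sublinear :: "('a::real_vector \<Rightarrow> real) \<Rightarrow> bool" where
  "sublinear q \<longleftrightarrow> (\<forall>x y. q (x + y) \<le> q x + q y) \<and> (\<forall>t x. t \<ge> 0 \<longrightarrow> q (t *\<^sub>R x) = t * q x)"

lemma sublinearD:
  assumes "sublinear q"
  shows "q (x + y) \<le> q x + q y" "t \<ge> 0 \<Longrightarrow> q (t *\<^sub>R x) = t * q x" "q 0 = 0" "- q (- x) \<le> q x"
proof -
  show "q (x + y) \<le> q x + q y" and *: "t \<ge> 0 \<Longrightarrow> q (t *\<^sub>R x) = t * q x" for t x y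
    using assms unfolding sublinear_def by blast+
  show "q 0 = 0" using *[of 0 0] by simp
  moreover have "q (x + (- x)) \<le> q x + q (- x)" using assms unfolding sublinear_def by blast
  ultimately show "- q (- x) \<le> q x" by simp
qed

text \<open>A minimal sublinear function is fixed by every step, and being fixed forces additivity.\<close>

definition sublinear_step :: "('a::real_vector \<Rightarrow> real) \<Rightarrow> 'a \<Rightarrow> 'a \<Rightarrow> real" where
  "sublinear_step q x y = (INF t\<in>{0..}. q (y + t *\<^sub>R x) - t * q x)"

text \<open>The infimum is finite because each term is at least \<open>- q (- y)\<close>;
  subadditivity adds the parameters \<open>s\<close> and \<open>t\<close>, and homogeneity rescales
  them. Later \<open>t = 0\<close> shows that the step lies below \<open>q\<close>, and
  \<open>t = 1\<close> at \<open>- x\<close> bounds its value there by \<open>- q x\<close>.\<close>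

lemma sublinear_step:
  assumes q: "sublinear q"
  shows "sublinear (sublinear_step q x)" and "t \<ge> 0 \<Longrightarrow> sublinear_step q x y \<le> q (y + t *\<^sub>R x) - t * q x"
proof -
  have bdd: "bdd_below ((\<lambda>t. q (y + t *\<^sub>R x) - t * q x) ` {0..})" for y
  proof (rule bdd_belowI2)
    fix t :: real assume "t \<in> {0..}"
    then have "t * q x = q ((y + t *\<^sub>R x) + (- y))" using sublinearD(2)[OF q] by simp
    also have "\<dots> \<le> q (y + t *\<^sub>R x) + q (- y)" by (rule sublinearD[OF q])
    finally show "- q (- y) \<le> q (y + t *\<^sub>R x) - t * q x" by simp
  qed
  show le: "sublinear_step q x y \<le> q (y + t *\<^sub>R x) - t * q x" if "t \<ge> 0" for t y
    unfolding sublinear_step_def by (rule cINF_lower[OF bdd]) (use that in auto)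
  have add: "sublinear_step q x (y + z) \<le> sublinear_step q x y + sublinear_step q x z" for y z
  proof -
    have 1: "sublinear_step q x (y + z) \<le> (q (y + s *\<^sub>R x) - s * q x) + (q (z + t *\<^sub>R x) - t * q x)"
      if "s \<ge> 0" "t \<ge> 0" for s t
    proof -
      have "q ((y + z) + (s + t) *\<^sub>R x) \<le> q (y + s *\<^sub>R x) + q (z + t *\<^sub>R x)"
        using sublinearD(1)[OF q, of "y + s *\<^sub>R x" "z + t *\<^sub>R x"] by (simp add: algebra_simps)
      with le[of "s + t" "y + z"] that show ?thesis by (simp add: algebra_simps)
    qed
    have 2: "sublinear_step q x (y + z) - (q (y + s *\<^sub>R x) - s * q x) \<le> sublinear_step q x z"
      if "s \<ge> 0" for s
      unfolding sublinear_step_def[of q x z]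
      by (rule cINF_greatest) (use 1[OF that] in \<open>auto simp: algebra_simps\<close>)
    have "sublinear_step q x (y + z) - sublinear_step q x z \<le> sublinear_step q x y"
      unfolding sublinear_step_def[of q x y]
      by (rule cINF_greatest) (use 2 in \<open>auto simp: algebra_simps\<close>)
    then show ?thesis by simp
  qed
  have hom_le: "sublinear_step q x (t *\<^sub>R y) \<le> t * sublinear_step q x y" if t: "t > 0" for t y
  proof -
    have "sublinear_step q x (t *\<^sub>R y) / t \<le> sublinear_step q x y"
      unfolding sublinear_step_def[of q x y]
    proof (rule cINF_greatest)
      fix s :: real assume s: "s \<in> {0..}"
      have "sublinear_step q x (t *\<^sub>R y) \<le> q (t *\<^sub>R y + (t * s) *\<^sub>R x) - (t * s) * q x"
        by (rule le) (use s t in auto)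
      also have "t *\<^sub>R y + (t * s) *\<^sub>R x = t *\<^sub>R (y + s *\<^sub>R x)" by (simp add: algebra_simps)
      also have "q (t *\<^sub>R (y + s *\<^sub>R x)) = t * q (y + s *\<^sub>R x)" using sublinearD(2)[OF q] t by simp
      finally show "sublinear_step q x (t *\<^sub>R y) / t \<le> q (y + s *\<^sub>R x) - s * q x"
        using t by (simp add: field_simps)
    qed auto
    then show ?thesis using t by (simp add: field_simps)
  qed
  have hom: "sublinear_step q x (t *\<^sub>R y) = t * sublinear_step q x y" if "t > 0" for t y
  proof (rule antisym[OF hom_le[OF that]])
    have "sublinear_step q x ((1/t) *\<^sub>R (t *\<^sub>R y)) \<le> (1/t) * sublinear_step q x (t *\<^sub>R y)"
      by (rule hom_le) (use that in auto)
    then show "t * sublinear_step q x y \<le> sublinear_step q x (t *\<^sub>R y)"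
      using that by (simp add: field_simps)
  qed
  have zero: "sublinear_step q x 0 = 0"
  proof -
    have "sublinear_step q x 0 = (INF t\<in>{0::real..}. (0::real))"
      unfolding sublinear_step_def
      by (rule arg_cong[where f = Inf], rule image_cong) (use sublinearD(2)[OF q] in auto)
    then show ?thesis by simp
  qed
  show "sublinear (sublinear_step q x)"
    unfolding sublinear_def using add hom zero by (metis less_eq_real_def mult_zero_left scale_zero_left)
qed

text \<open>Zorn's lemma for the reversed order. The pointwise infimum of a chain is finite, being
  at least \<open>- d (- x)\<close>, and stays subadditive because the smaller of two members of the
  chain can be used for both arguments.\<close>

lemma minimal_sublinear_exists:
  assumes d: "sublinear d"
  obtains m where "sublinear m" "m \<le> d" "\<And>q. sublinear q \<Longrightarrow> q \<le> m \<Longrightarrow> q = m"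
proof -
  define A where "A = {q. sublinear q \<and> q \<le> d}"
  have "\<exists>m\<in>A. \<forall>a\<in>A. (\<lambda>x y. y \<le> x) m a \<longrightarrow> a = m"
  proof (rule predicate_Zorn)
    show "partial_order_on A (relation_of (\<lambda>x y. y \<le> x) A)"
      by (rule partial_order_on_relation_ofI) auto
  next
    fix C assume "C \<in> Chains (relation_of (\<lambda>x y. y \<le> x) A)"
    then have C: "C \<subseteq> A" and chain: "\<And>a b. a \<in> C \<Longrightarrow> b \<in> C \<Longrightarrow> a \<le> b \<or> b \<le> a"
      by (auto simp: Chains_def relation_of_def)
    show "\<exists>u\<in>A. \<forall>a\<in>C. u \<le> a"
    proof (cases "C = {}")
      case True
      then show ?thesis using d by (auto simp: A_def)
    next
      case False
      define u where "u = (\<lambda>x. INF q\<in>C. q x)"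
      have bdd: "bdd_below ((\<lambda>q. q x) ` C)" for x
      proof (rule bdd_belowI2)
        fix q assume "q \<in> C"
        then have "sublinear q" "q (- x) \<le> d (- x)" using C by (auto simp: A_def le_fun_def)
        with sublinearD(4)[of q x] show "- d (- x) \<le> q x" by simp
      qed
      have le: "u x \<le> q x" if "q \<in> C" for q x
        unfolding u_def by (rule cINF_lower[OF bdd that])
      have sub: "sublinear q" if "q \<in> C" for q using C that by (auto simp: A_def)
      have add: "u (x + y) \<le> u x + u y" for x y
      proof -
        have 1: "u (x + y) \<le> a x + b y" if ab: "a \<in> C" "b \<in> C" for a b
        proof (cases "a \<le> b")
          case True
          have "u (x + y) \<le> a x + a y" using le[OF ab(1)] sublinearD(1)[OF sub[OF ab(1)]] order_trans by blast
          also have "a y \<le> b y" using True by (simp add: le_fun_def)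
          finally show ?thesis by simp
        next
          case False
          then have "b \<le> a" using chain ab by blast
          have "u (x + y) \<le> b x + b y" using le[OF ab(2)] sublinearD(1)[OF sub[OF ab(2)]] order_trans by blast
          also have "b x \<le> a x" using \<open>b \<le> a\<close> by (simp add: le_fun_def)
          finally show ?thesis by simp
        qed
        have 2: "u (x + y) - a x \<le> u y" if "a \<in> C" for a
          unfolding u_def[THEN fun_cong, of y]
          by (rule cINF_greatest[OF False]) (use 1[OF that] in \<open>auto simp: algebra_simps\<close>)
        have "u (x + y) - u y \<le> u x"
          unfolding u_def[THEN fun_cong, of x]
          by (rule cINF_greatest[OF False]) (use 2 in \<open>auto simp: algebra_simps\<close>)
        then show ?thesis by simp
      qed
      have hom_le: "t * u x \<le> u (t *\<^sub>R x)" if "t \<ge> 0" for t x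
        unfolding u_def[THEN fun_cong, of "t *\<^sub>R x"]
      proof (rule cINF_greatest[OF False])
        fix q assume q: "q \<in> C"
        show "t * u x \<le> q (t *\<^sub>R x)"
          using sublinearD(2)[OF sub[OF q] that] le[OF q] that by (simp add: mult_left_mono)
      qed
      have hom: "u (t *\<^sub>R x) = t * u x" if "t \<ge> 0" for t x
      proof (cases "t = 0")
        case True
        obtain q where "q \<in> C" using False by auto
        have "u 0 = (INF q\<in>C. (0::real))"
          unfolding u_def
          by (rule arg_cong[where f = Inf], rule image_cong) (use sublinearD(3)[OF sub] in auto)
        then show ?thesis using True False by simp
      next
        case False
        have "(1 / t) * u (t *\<^sub>R x) \<le> u ((1 / t) *\<^sub>R (t *\<^sub>R x))" by (rule hom_le) (use that in auto)
        then have "u (t *\<^sub>R x) \<le> t * u x" using False that by (simp add: field_simps)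
        then show ?thesis using hom_le[OF that] by (simp add: antisym)
      qed
      have "u \<le> d"
      proof -
        obtain q where "q \<in> C" using False by auto
        then have "q \<le> d" "u \<le> q" using C le by (auto simp: A_def le_fun_def)
        then show ?thesis by simp
      qed
      then have "u \<in> A" using add hom by (auto simp: A_def sublinear_def)
      then show ?thesis using le by (auto simp: le_fun_def)
    qed
  qed
  then obtain m where m: "m \<in> A" "\<And>a. a \<in> A \<Longrightarrow> a \<le> m \<Longrightarrow> a = m" by blast
  show thesis
  proof (rule that[of m])
    fix q assume "sublinear q" "q \<le> m"
    then show "q = m" using m by (auto simp: A_def)
  qed (use m in \<open>auto simp: A_def\<close>)
qed

text \<open>Minimising below \<open>sublinear_step d x0\<close> instead of \<open>d\<close> fixes
  the value at \<open>x0\<close>: it forces \<open>\<psi> (- x0) \<le> - d x0\<close>, so linearity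
  gives \<open>\<psi> x0 \<ge> d x0\<close>.\<close>

theorem hahn_banach_sublinear:
  fixes d :: "'a::real_vector \<Rightarrow> real"
  assumes d: "sublinear d"
  obtains \<psi> where "linear \<psi>" "\<psi> \<le> d" "\<psi> x0 = d x0"
proof -
  have s0: "sublinear (sublinear_step d x0)" by (rule sublinear_step(1)[OF d])
  obtain m where m: "sublinear m" "m \<le> sublinear_step d x0"
    and min: "\<And>q. sublinear q \<Longrightarrow> q \<le> m \<Longrightarrow> q = m"
    by (rule minimal_sublinear_exists[OF s0]) blast
  have step_eq: "sublinear_step m x = m" for x
    by (rule min[OF sublinear_step(1)[OF m(1)]])
       (use sublinear_step(2)[OF m(1), of 0 x] in \<open>auto simp: le_fun_def\<close>)
  have add: "m (x + y) = m x + m y" for x y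
  proof (rule antisym[OF sublinearD(1)[OF m(1)]])
    show "m x + m y \<le> m (x + y)"
      using sublinear_step(2)[OF m(1), of 1 x y] by (simp add: step_eq add.commute)
  qed
  have neg: "m (- x) = - m x" for x using add[of x "- x"] sublinearD(3)[OF m(1)] by simp
  have lin: "linear m"
  proof (rule linearI[OF add])
    fix t x show "m (t *\<^sub>R x) = t *\<^sub>R m x"
      using sublinearD(2)[OF m(1), of t x] sublinearD(2)[OF m(1), of "- t" x] neg[of "t *\<^sub>R x"]
      by (cases "t \<ge> 0") auto
  qed
  have le: "m \<le> d"
  proof (rule order_trans[OF m(2)])
    show "sublinear_step d x0 \<le> d" using sublinear_step(2)[OF d, of 0 x0] by (auto simp: le_fun_def)
  qed
  have "m (- x0) \<le> sublinear_step d x0 (- x0)" using m(2) by (simp add: le_fun_def)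
  also have "\<dots> \<le> - d x0" using sublinear_step(2)[OF d, of 1 x0 "- x0"] sublinearD(3)[OF d] by simp
  finally have "d x0 \<le> m x0" using neg by simp
  moreover have "m x0 \<le> d x0" using le by (simp add: le_fun_def)
  ultimately show thesis using that[OF lin le] by simp
qed

text \<open>With pointwise addition already available, pointwise scaling turns functions into a real
  vector space, to which \<open>hahn_banach_sublinear\<close> applies directly.\<close>

instantiation "fun" :: (type, real_vector) real_vector
begin
definition "scaleR r f = (\<lambda>x. r *\<^sub>R f x)"
instance by standard (auto simp: scaleR_fun_def fun_eq_iff algebra_simps)
end

text \<open>The seminorm is controlled on \<open>V\<close> only; composing it with a linear
  projection \<open>P\<close> onto \<open>V\<close> makes it sublinear on the whole type.\<close>

theorem hahn_banach_seminorm: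
  fixes V :: "('a \<Rightarrow> complex) set" and d :: "('a \<Rightarrow> complex) \<Rightarrow> real"
  assumes add: "\<And>x y. x \<in> V \<Longrightarrow> y \<in> V \<Longrightarrow> (\<lambda>p. x p + y p) \<in> V"
    and scale: "\<And>c x. x \<in> V \<Longrightarrow> (\<lambda>p. c * x p) \<in> V"
    and dadd: "\<And>x y. x \<in> V \<Longrightarrow> y \<in> V \<Longrightarrow> d (\<lambda>p. x p + y p) \<le> d x + d y"
    and dscale: "\<And>c x. x \<in> V \<Longrightarrow> d (\<lambda>p. c * x p) = norm c * d x"
    and x0: "x0 \<in> V" "d x0 \<noteq> 0"
  obtains \<phi> :: "('a \<Rightarrow> complex) \<Rightarrow> complex" where
    "\<And>x y. x \<in> V \<Longrightarrow> y \<in> V \<Longrightarrow> \<phi> (\<lambda>p. x p + y p) = \<phi> x + \<phi> y"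
    "\<And>c x. x \<in> V \<Longrightarrow> \<phi> (\<lambda>p. c * x p) = c * \<phi> x"
    "\<And>x. x \<in> V \<Longrightarrow> norm (\<phi> x) \<le> d x"
    "\<phi> x0 \<noteq> 0"
proof -
  have "subspace V"
    unfolding subspace_def
  proof (intro conjI ballI allI)
    show "0 \<in> V" using scale[OF x0(1), of 0] by (simp add: zero_fun_def)
    show "x + y \<in> V" if "x \<in> V" "y \<in> V" for x y using add[OF that] by (simp add: plus_fun_def)
    show "c *\<^sub>R x \<in> V" if "x \<in> V" for c x
      using scale[OF that, of "of_real c"] by (simp add: scaleR_fun_def scaleR_conv_of_real)
  qed
  then obtain P where P: "range P \<subseteq> V" "linear P" "\<And>v. v \<in> V \<Longrightarrow> P v = v"
    using linear_exists_left_inverse_on[of id V] linear_id by auto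
  have PV: "P x \<in> V" for x using P(1) by auto
  have "sublinear (d \<circ> P)"
    unfolding sublinear_def
  proof (intro conjI allI impI)
    fix x y show "(d \<circ> P) (x + y) \<le> (d \<circ> P) x + (d \<circ> P) y"
      using dadd[OF PV PV, of x y] linear_add[OF P(2), of x y] by (simp add: plus_fun_def)
  next
    fix t x assume "(t::real) \<ge> 0"
    then show "(d \<circ> P) (t *\<^sub>R x) = t * (d \<circ> P) x"
      using dscale[OF PV, of "of_real t" x] linear_scale[OF P(2), of t x]
      by (simp add: scaleR_fun_def scaleR_conv_of_real)
  qed
  then obtain \<psi> where \<psi>: "linear \<psi>" "\<psi> \<le> d \<circ> P" "\<psi> x0 = (d \<circ> P) x0"
    by (rule hahn_banach_sublinear)
  have \<psi>add: "\<psi> (\<lambda>p. x p + y p) = \<psi> x + \<psi> y" for x y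
    using linear_add[OF \<psi>(1), of x y] by (simp add: plus_fun_def)
  have \<psi>sc: "\<psi> (\<lambda>p. of_real r * x p) = r * \<psi> x" for r x
    using linear_scale[OF \<psi>(1), of r x] by (simp add: scaleR_fun_def scaleR_conv_of_real)
  have \<psi>le: "\<psi> x \<le> d x" if "x \<in> V" for x using \<psi>(2) P(3)[OF that] by (auto simp: le_fun_def dest: spec[of _ x])
  \<comment> \<open>The standard complexification of a real functional. Its modulus is bounded by
    rotating \<open>x\<close> until the value becomes real and nonnegative, hence equal to a value
    of \<open>\<psi>\<close>.\<close>
  define \<phi> where "\<phi> x = Complex (\<psi> x) (- \<psi> (\<lambda>p. \<i> * x p))" for x
  have \<phi>add: "\<phi> (\<lambda>p. x p + y p) = \<phi> x + \<phi> y" for x y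
    unfolding \<phi>_def using \<psi>add[of "\<lambda>p. \<i> * x p" "\<lambda>p. \<i> * y p"] \<psi>add[of x y]
    by (simp add: complex_eq_iff algebra_simps)
  have \<phi>sc: "\<phi> (\<lambda>p. c * x p) = c * \<phi> x" for c x
  proof -
    have eq1: "(\<lambda>p. c * x p) = (\<lambda>p. of_real (Re c) * x p + of_real (Im c) * (\<i> * x p))"
      by (rule ext) (simp add: complex_eq_iff)
    have eq2: "(\<lambda>p. \<i> * (c * x p)) = (\<lambda>p. of_real (Re c) * (\<i> * x p) + of_real (- Im c) * x p)"
      by (rule ext) (simp add: complex_eq_iff)
    have "\<psi> (\<lambda>p. c * x p) = Re c * \<psi> x + Im c * \<psi> (\<lambda>p. \<i> * x p)"
      unfolding eq1 by (subst \<psi>add, subst (1 2) \<psi>sc) simp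
    moreover have "\<psi> (\<lambda>p. \<i> * (c * x p)) = Re c * \<psi> (\<lambda>p. \<i> * x p) - Im c * \<psi> x"
      unfolding eq2 by (subst \<psi>add, subst (1 2) \<psi>sc) simp
    ultimately show ?thesis unfolding \<phi>_def by (simp add: complex_eq_iff)
  qed
  have \<phi>le: "norm (\<phi> x) \<le> d x" if x: "x \<in> V" for x
  proof -
    obtain c where c: "norm c = 1" "c * \<phi> x = of_real (norm (\<phi> x))"
    proof (cases "\<phi> x = 0")
      case True then show thesis using that[of 1] by simp
    next
      case False
      have "norm (of_real (norm (\<phi> x)) / \<phi> x) = 1" using False by (simp add: norm_divide)
      then show thesis using that[of "of_real (norm (\<phi> x)) / \<phi> x"] False by simp
    qed
    have "norm (\<phi> x) = Re (\<phi> (\<lambda>p. c * x p))" using c(2) by (simp add: \<phi>sc)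
    also have "\<dots> = \<psi> (\<lambda>p. c * x p)" by (simp add: \<phi>_def)
    also have "\<dots> \<le> d (\<lambda>p. c * x p)" by (rule \<psi>le[OF scale[OF x]])
    also have "\<dots> = d x" using dscale[OF x] c by simp
    finally show ?thesis .
  qed
  have "\<phi> x0 \<noteq> 0" using \<psi>(3) x0 P(3) by (auto simp: \<phi>_def complex_eq_iff)
  then show thesis using that[of \<phi>] \<phi>add \<phi>sc \<phi>le by blast
qed

section \<open>Inversion modulo the ideal\<close>

lemma has_sum_col0:
  fixes h :: "nat \<Rightarrow> 'c::{topological_comm_monoid_add, t2_space}"
  assumes "(h has_sum S) UNIV"
  shows "((\<lambda>(n, m::nat). if m = 0 then h n else 0) has_sum S) UNIV"
proof -
  have "((\<lambda>(n, m::nat). if m = 0 then h n else 0) has_sum S) (range (\<lambda>n. (n, 0)))"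
    by (subst has_sum_reindex) (use assms in \<open>auto simp: inj_on_def o_def\<close>)
  then show ?thesis by (rule has_sum_cong_neutral[THEN iffD1, rotated -1]) auto
qed

text \<open>For \<open>norm w = 1\<close> the slice leaves the open bidisc, so its holomorphy does
  not come from the definition of the bidisc algebra; it is read off from the power series in
  \<open>z\<close>, which converges by \<open>power_series_closed\<close>.\<close>

lemma (in weight) slice_disc_algebra:
  assumes f: "f \<in> wiener_algebra W" and w: "norm w \<le> 1"
  shows "(\<lambda>z. f (z, w)) \<in> disc_algebra"
proof -
  obtain a where a: "f \<in> bidisc_algebra" "power_series_of f a" "(\<lambda>p. norm (a p) * W p) summable_on UNIV"
    using f by (rule wiener_algebraE)
  have "continuous_on (cball 0 1) (\<lambda>z. f (z, w))"
    by (rule continuous_on_compose2[OF bidisc_algebra_continuous[OF a(1)]])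
       (use w in \<open>auto intro!: continuous_intros\<close>)
  moreover have "(\<lambda>z. f (z, w)) holomorphic_on ball 0 1"
  proof (rule power_series_holomorphic)
    fix z :: complex assume z: "z \<in> ball 0 1"
    have S: "((\<lambda>(n, m). a (n, m) * z ^ n * w ^ m) has_sum f (z, w)) (UNIV \<times> UNIV)" if "norm z \<le> 1" for z
      using power_series_closed[OF f a(2), of "(z, w)"] that w by (simp add: case_prod_unfold)
    have row: "(\<lambda>m. a (n, m) * w ^ m) summable_on UNIV" for n
      using summable_on_SigmaD1[OF has_sum_imp_summable[OF S[of 1]], of n] by simp
    have "((\<lambda>n. (\<Sum>\<^sub>\<infinity>m. a (n, m) * w ^ m) * z ^ n) has_sum f (z, w)) UNIV"
    proof (rule has_sum_SigmaD[OF S])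
      show "norm z \<le> 1" using z by simp
      fix n
      show "((\<lambda>m. case (n, m) of (n, m) \<Rightarrow> a (n, m) * z ^ n * w ^ m) has_sum (\<Sum>\<^sub>\<infinity>m. a (n, m) * w ^ m) * z ^ n) UNIV"
        using has_sum_cmult_left[OF has_sum_infsum[OF row[of n]], of "z ^ n"] by (simp add: mult_ac)
    qed
    then show "(\<lambda>n. (\<Sum>\<^sub>\<infinity>m. a (n, m) * w ^ m) * (z - 0) ^ n) sums f (z, w)"
      using has_sum_imp_sums by simp
  qed
  ultimately show ?thesis by (simp add: disc_algebra_def)
qed

lemma (in weight) coordinate_minus_one: "(\<lambda>p. fst p - 1) \<in> wiener_algebra W"
  using diff(1)[OF monomial(1)[of 1 1 0] const(1)[of 1]] by simp

text \<open>Hahn-Banach for the quotient seminorm \<open>d\<close>, the distance to the multiples of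
  \<open>f\<close>. It vanishes on these multiples, so the functional depends only on the class of
  an element modulo \<open>f\<close>.\<close>

lemma (in weight) ideal_functional:
  assumes f: "f \<in> wiener_algebra W" and x0: "x0 \<in> wiener_algebra W" and e: "e > 0"
    and far: "\<And>h. h \<in> wiener_algebra W \<Longrightarrow> e \<le> wiener_norm W (\<lambda>p. x0 p - f p * h p)"
  obtains \<phi> :: "(complex \<times> complex \<Rightarrow> complex) \<Rightarrow> complex" where
    "\<And>x y. x \<in> wiener_algebra W \<Longrightarrow> y \<in> wiener_algebra W \<Longrightarrow> \<phi> (\<lambda>p. x p + y p) = \<phi> x + \<phi> y"
    "\<And>c x. x \<in> wiener_algebra W \<Longrightarrow> \<phi> (\<lambda>p. c * x p) = c * \<phi> x"
    "\<And>x. x \<in> wiener_algebra W \<Longrightarrow> norm (\<phi> x) \<le> wiener_norm W x"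
    "\<And>x y h. x \<in> wiener_algebra W \<Longrightarrow> y \<in> wiener_algebra W \<Longrightarrow> h \<in> wiener_algebra W \<Longrightarrow>
      (\<And>p. p \<in> closed_bidisc \<Longrightarrow> x p - y p = f p * h p) \<Longrightarrow> \<phi> x = \<phi> y"
    "\<phi> x0 \<noteq> 0"
proof -
  define V where "V = wiener_algebra W"
  define N where "N = wiener_norm W"
  define d where "d x = (INF h\<in>V. N (\<lambda>p. x p - f p * h p))" for x
  have V0: "(\<lambda>_. 0) \<in> V" using const(1) by (simp add: V_def)
  have bdd: "bdd_below ((\<lambda>h. N (\<lambda>p. x p - f p * h p)) ` V)" for x
    by (rule bdd_belowI2[of _ 0]) (simp add: N_def norm_nonneg)
  have d_le: "d x \<le> N (\<lambda>p. x p - f p * h p)" if "h \<in> V" for x h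
    unfolding d_def by (rule cINF_lower[OF bdd that])
  have d_ge: "c \<le> d x" if "\<And>h. h \<in> V \<Longrightarrow> c \<le> N (\<lambda>p. x p - f p * h p)" for c x
    unfolding d_def by (rule cINF_greatest) (use V0 that in auto)
  have d_nn: "0 \<le> d x" for x by (rule d_ge) (simp add: N_def norm_nonneg)
  have mem: "(\<lambda>p. x p - f p * h p) \<in> V" if "x \<in> V" "h \<in> V" for x h
    using that diff(1) mult(1)[OF f] by (simp add: V_def)
  have d_zero: "d x = 0" if "h \<in> V" "\<And>p. p \<in> closed_bidisc \<Longrightarrow> x p = f p * h p" for x h
  proof (rule antisym[OF _ d_nn])
    have "N (\<lambda>p. x p - f p * h p) = 0" unfolding N_def by (rule wiener_norm_zero) (use that in simp)
    then show "d x \<le> 0" using d_le[OF that(1), of x] by simp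
  qed
  have dadd: "d (\<lambda>p. x p + y p) \<le> d x + d y" if xy: "x \<in> V" "y \<in> V" for x y
  proof -
    have 1: "d (\<lambda>p. x p + y p) \<le> N (\<lambda>p. x p - f p * h p) + N (\<lambda>p. y p - f p * k p)" if hk: "h \<in> V" "k \<in> V" for h k
    proof -
      have "(\<lambda>p. h p + k p) \<in> V" using add(1) hk by (simp add: V_def)
      then have "d (\<lambda>p. x p + y p) \<le> N (\<lambda>p. (x p + y p) - f p * (h p + k p))" by (rule d_le)
      also have "(\<lambda>p. (x p + y p) - f p * (h p + k p)) = (\<lambda>p. (x p - f p * h p) + (y p - f p * k p))"
        by (simp add: algebra_simps)
      also have "N \<dots> \<le> N (\<lambda>p. x p - f p * h p) + N (\<lambda>p. y p - f p * k p)"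
        unfolding N_def by (rule add(2)) (use mem xy hk in \<open>auto simp: V_def\<close>)
      finally show ?thesis .
    qed
    have 2: "d (\<lambda>p. x p + y p) - N (\<lambda>p. x p - f p * h p) \<le> d y" if "h \<in> V" for h
      by (rule d_ge) (use 1[OF that] in \<open>simp add: algebra_simps\<close>)
    have "d (\<lambda>p. x p + y p) - d y \<le> d x"
      by (rule d_ge) (use 2 in \<open>simp add: algebra_simps\<close>)
    then show ?thesis by simp
  qed
  have dle: "d (\<lambda>p. c * x p) \<le> norm c * d x" if x: "x \<in> V" and c: "c \<noteq> 0" for c x
  proof -
    have "d (\<lambda>p. c * x p) / norm c \<le> d x"
    proof (rule d_ge)
      fix h assume h: "h \<in> V"
      have "(\<lambda>p. c * h p) \<in> V" using wiener_algebra_cmult(1) h by (simp add: V_def)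
      then have "d (\<lambda>p. c * x p) \<le> N (\<lambda>p. c * x p - f p * (c * h p))" by (rule d_le)
      also have "(\<lambda>p. c * x p - f p * (c * h p)) = (\<lambda>p. c * (x p - f p * h p))" by (simp add: algebra_simps)
      also have "N \<dots> = norm c * N (\<lambda>p. x p - f p * h p)"
        unfolding N_def by (rule wiener_algebra_cmult(2)) (use mem x h in \<open>auto simp: V_def\<close>)
      finally show "d (\<lambda>p. c * x p) / norm c \<le> N (\<lambda>p. x p - f p * h p)" using c by (simp add: field_simps)
    qed
    then show ?thesis using c by (simp add: field_simps)
  qed
  have dscale: "d (\<lambda>p. c * x p) = norm c * d x" if x: "x \<in> V" for c x
  proof (cases "c = 0")
    case True
    then show ?thesis using d_zero[OF V0, of "\<lambda>p. c * x p"] by simp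
  next
    case False
    have "(\<lambda>p. c * x p) \<in> V" using wiener_algebra_cmult(1) x by (simp add: V_def)
    from dle[OF this, of "inverse c"] False have "d x \<le> inverse (norm c) * d (\<lambda>p. c * x p)"
      by (simp add: mult.assoc[symmetric] norm_inverse)
    then have "norm c * d x \<le> d (\<lambda>p. c * x p)" using False by (simp add: field_simps)
    then show ?thesis using dle[OF x False] by simp
  qed
  have "e \<le> d x0" by (rule d_ge) (use far in \<open>simp add: N_def V_def\<close>)
  then have "d x0 \<noteq> 0" using e by simp
  note ne = this
  have x0V: "x0 \<in> V" using x0 by (simp add: V_def)
  have Vadd: "(\<lambda>p. x p + y p) \<in> V" if "x \<in> V" "y \<in> V" for x y using add(1) that by (simp add: V_def)
  have Vscale: "(\<lambda>p. c * x p) \<in> V" if "x \<in> V" for c x using wiener_algebra_cmult(1) that by (simp add: V_def)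
  show thesis
  proof (rule hahn_banach_seminorm[of V d x0, OF Vadd Vscale dadd dscale x0V ne])
    fix \<phi> :: "(complex \<times> complex \<Rightarrow> complex) \<Rightarrow> complex"
    assume \<phi>: "\<And>x y. x \<in> V \<Longrightarrow> y \<in> V \<Longrightarrow> \<phi> (\<lambda>p. x p + y p) = \<phi> x + \<phi> y"
      "\<And>c x. x \<in> V \<Longrightarrow> \<phi> (\<lambda>p. c * x p) = c * \<phi> x"
      "\<And>x. x \<in> V \<Longrightarrow> norm (\<phi> x) \<le> d x" "\<phi> x0 \<noteq> 0"
    show thesis
    proof (rule that[of \<phi>])
      show "norm (\<phi> x) \<le> wiener_norm W x" if "x \<in> wiener_algebra W" for x
        using \<phi>(3)[of x] d_le[OF V0, of x] that by (simp add: V_def N_def)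
      show "\<phi> x = \<phi> y" if x: "x \<in> wiener_algebra W" and y: "y \<in> wiener_algebra W"
        and h: "h \<in> wiener_algebra W" and eq: "\<And>p. p \<in> closed_bidisc \<Longrightarrow> x p - y p = f p * h p" for x y h
      proof -
        define m where "m = (\<lambda>p. (-1) * y p)"
        have m: "m \<in> V" unfolding m_def V_def by (rule wiener_algebra_cmult(1)[OF y])
        have "d (\<lambda>p. x p + m p) = 0"
          by (rule d_zero[of h]) (use h eq in \<open>auto simp: V_def m_def\<close>)
        moreover have "(\<lambda>p. x p + m p) \<in> V" using add(1) x m by (simp add: V_def)
        ultimately have "\<phi> (\<lambda>p. x p + m p) = 0" using \<phi>(3)[of "\<lambda>p. x p + m p"] by simp
        then have "\<phi> x + \<phi> m = 0" using \<phi>(1)[of x m] x m by (simp add: V_def)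
        moreover have "\<phi> m = - \<phi> y" unfolding m_def using \<phi>(2)[of y "-1"] y by (simp add: V_def)
        ultimately show ?thesis by simp
      qed
    qed (simp_all add: \<phi> V_def[symmetric])
  qed
qed

text \<open>The coefficients are the powers of \<open>\<kappa>\<close>. The crude bound uses
  \<open>(1 + n) powr \<alpha> \<le> 1 + n\<close> and serves the whole half-plane
  \<open>Re u < 1/2\<close>; the sharper one is needed on the negative axis, where the exponent
  \<open>1 + \<alpha>\<close> turns into growth of order \<open>\<alpha>\<close> after division by
  \<open>norm (1 - u)\<close>.\<close>

lemma geometric_fst:
  assumes \<alpha>: "0 \<le> \<alpha>" "\<alpha> \<le> 1" and \<beta>: "0 \<le> \<beta>" and \<kappa>: "norm \<kappa> < 1"
  shows "(\<lambda>p. inverse (1 - \<kappa> * fst p)) \<in> wiener_algebra (power_weight \<alpha> \<beta>)"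
    "wiener_norm (power_weight \<alpha> \<beta>) (\<lambda>p. inverse (1 - \<kappa> * fst p)) \<le> 1 / (1 - norm \<kappa>)\<^sup>2"
    "wiener_norm (power_weight \<alpha> \<beta>) (\<lambda>p. inverse (1 - \<kappa> * fst p)) \<le> 2 * (1 / (1 - norm \<kappa>)) powr (1 + \<alpha>)"
proof -
  define W where "W = power_weight \<alpha> \<beta>"
  interpret weight W unfolding W_def using \<alpha> \<beta> by (intro power_weight_weight) auto
  have W0: "W (n, 0) = (1 + real n) powr \<alpha>" for n by (simp add: W_def power_weight_def)
  define b where "b = (\<lambda>(n, m::nat). if m = 0 then \<kappa> ^ n else 0)"
  have nz: "1 - \<kappa> * fst p \<noteq> 0" if "p \<in> closed_bidisc" for p :: "complex \<times> complex"
  proof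
    assume "1 - \<kappa> * fst p = 0"
    then have "norm (\<kappa> * fst p) = 1" by (metis eq_iff_diff_eq_0 norm_one)
    moreover have "norm \<kappa> * norm (fst p) \<le> norm \<kappa> * 1" using that by (intro mult_left_mono) (auto simp: mem_Times_iff)
    ultimately show False using \<kappa> by (simp add: norm_mult)
  qed
  have "(\<lambda>p. 1 - \<kappa> * fst p) \<in> wiener_algebra W"
    using diff(1)[OF const(1)[of 1] monomial(1)[of \<kappa> 1 0]] by simp
  then have "(\<lambda>p. 1 - \<kappa> * fst p) \<in> bidisc_algebra" by (rule wiener_algebraE)
  then have ba: "(\<lambda>p. inverse (1 - \<kappa> * fst p)) \<in> bidisc_algebra"
    by (rule bidisc_algebra_inverse) (rule nz)
  have ps: "power_series_of (\<lambda>p. inverse (1 - \<kappa> * fst p)) b"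
    unfolding power_series_of_def
  proof clarify
    fix z w :: complex assume zw: "z \<in> ball 0 1" "w \<in> ball 0 1"
    have "norm \<kappa> * norm z \<le> norm \<kappa> * 1" using zw by (intro mult_left_mono) auto
    then have lt: "norm (\<kappa> * z) < 1" using \<kappa> by (simp add: norm_mult)
    then have "summable (\<lambda>n. norm ((\<kappa> * z) ^ n))" by (simp add: norm_power summable_geometric)
    then have "((\<lambda>n. (\<kappa> * z) ^ n) has_sum (1 / (1 - \<kappa> * z))) UNIV"
      by (rule norm_summable_imp_has_sum) (rule geometric_sums[OF lt])
    then have "((\<lambda>(n, m::nat). if m = 0 then (\<kappa> * z) ^ n else 0) has_sum (1 / (1 - \<kappa> * z))) UNIV" by (rule has_sum_col0)
    also have "(\<lambda>(n, m::nat). if m = 0 then (\<kappa> * z) ^ n else 0) = (\<lambda>(n, m). b (n, m) * z ^ n * w ^ m)"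
      by (auto simp: b_def power_mult_distrib fun_eq_iff)
    finally show "((\<lambda>(n, m). b (n, m) * z ^ n * w ^ m) has_sum inverse (1 - \<kappa> * fst (z, w))) UNIV"
      by (simp add: inverse_eq_divide)
  qed
  define k where "k = norm \<kappa>"
  have k: "0 \<le> k" "k < 1" using \<kappa> by (auto simp: k_def)
  have geo: "((\<lambda>n. k ^ n) has_sum (1 / (1 - k))) UNIV" by (rule geometric_has_sum[OF k])
  have der: "((\<lambda>n. real (Suc n) * k ^ n) has_sum (1 / (1 - k)\<^sup>2)) UNIV"
    using k by (intro sums_nonneg_imp_has_sum geometric_deriv_sums) auto
  have le1: "(1 + real n) powr \<alpha> * k ^ n \<le> real (Suc n) * k ^ n" for n
  proof -
    have "(1 + real n) powr \<alpha> \<le> (1 + real n) powr 1" using \<alpha> by (intro powr_mono) auto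
    then show ?thesis using k by (intro mult_right_mono) auto
  qed
  have s: "(\<lambda>n. (1 + real n) powr \<alpha> * k ^ n) summable_on UNIV"
    by (rule summable_on_comparison_test[OF has_sum_imp_summable[OF der]]) (use le1 k in auto)
  have "((\<lambda>(n, m::nat). if m = 0 then (1 + real n) powr \<alpha> * k ^ n else 0) has_sum
      (\<Sum>\<^sub>\<infinity>n. (1 + real n) powr \<alpha> * k ^ n)) UNIV"
    by (rule has_sum_col0[OF has_sum_infsum[OF s]])
  also have "(\<lambda>(n, m::nat). if m = 0 then (1 + real n) powr \<alpha> * k ^ n else 0) = (\<lambda>p. norm (b p) * W p)"
    by (auto simp: b_def fun_eq_iff W0 k_def norm_power)
  finally have hs: "((\<lambda>p. norm (b p) * W p) has_sum (\<Sum>\<^sub>\<infinity>n. (1 + real n) powr \<alpha> * k ^ n)) UNIV" .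
  show "(\<lambda>p. inverse (1 - \<kappa> * fst p)) \<in> wiener_algebra (power_weight \<alpha> \<beta>)"
    using ba ps has_sum_imp_summable[OF hs] unfolding wiener_algebra_def W_def by blast
  have n: "wiener_norm W (\<lambda>p. inverse (1 - \<kappa> * fst p)) = (\<Sum>\<^sub>\<infinity>n. (1 + real n) powr \<alpha> * k ^ n)"
    unfolding wiener_norm_eq[OF ps] by (rule infsumI[OF hs])
  have "(\<Sum>\<^sub>\<infinity>n. (1 + real n) powr \<alpha> * k ^ n) \<le> 1 / (1 - k)\<^sup>2"
    using infsum_mono[OF s has_sum_imp_summable[OF der] le1] infsumI[OF der] by simp
  then show "wiener_norm (power_weight \<alpha> \<beta>) (\<lambda>p. inverse (1 - \<kappa> * fst p)) \<le> 1 / (1 - norm \<kappa>)\<^sup>2"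
    using n by (simp add: W_def k_def)
  \<comment> \<open>The scale at which the weights \<open>k ^ n\<close> decay. Splitting at
    \<open>1 + n = s\<close> bounds \<open>(1 + n) powr \<alpha>\<close> by a constant plus a linear
    function of \<open>n\<close>, for which the series is summed in closed form.\<close>
  define s where "s = 1 / (1 - k)"
  have s0: "s > 0" using k by (simp add: s_def)
  have le2: "(1 + real n) powr \<alpha> \<le> s powr \<alpha> + s powr (\<alpha> - 1) * (1 + real n)" for n
  proof (cases "1 + real n \<le> s")
    case True
    then have "(1 + real n) powr \<alpha> \<le> s powr \<alpha>" using \<alpha> by (intro powr_mono2) auto
    then show ?thesis by (simp add: add_increasing2)
  next
    case False
    have "(1 + real n) powr (\<alpha> - 1) \<le> s powr (\<alpha> - 1)"
      using False s0 \<alpha> by (intro powr_mono2') auto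
    then have "(1 + real n) powr (\<alpha> - 1) * (1 + real n) \<le> s powr (\<alpha> - 1) * (1 + real n)" by (intro mult_right_mono) auto
    moreover have "(1 + real n) powr (\<alpha> - 1) * (1 + real n) = (1 + real n) powr \<alpha>" by (simp add: powr_diff)
    ultimately show ?thesis by (simp add: add_increasing)
  qed
  have tot: "((\<lambda>n. s powr \<alpha> * k ^ n + s powr (\<alpha> - 1) * (real (Suc n) * k ^ n)) has_sum
      (s powr \<alpha> * (1 / (1 - k)) + s powr (\<alpha> - 1) * (1 / (1 - k)\<^sup>2))) UNIV"
    by (intro has_sum_add has_sum_cmult_right geo der)
  have le3: "(1 + real n) powr \<alpha> * k ^ n \<le> s powr \<alpha> * k ^ n + s powr (\<alpha> - 1) * (real (Suc n) * k ^ n)" for n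
  proof -
    have "(1 + real n) powr \<alpha> * k ^ n \<le> (s powr \<alpha> + s powr (\<alpha> - 1) * (1 + real n)) * k ^ n"
      using le2 k by (intro mult_right_mono) auto
    then show ?thesis by (simp add: algebra_simps)
  qed
  have "(\<Sum>\<^sub>\<infinity>n. (1 + real n) powr \<alpha> * k ^ n) \<le> s powr \<alpha> * (1 / (1 - k)) + s powr (\<alpha> - 1) * (1 / (1 - k)\<^sup>2)"
    using infsum_mono[OF s has_sum_imp_summable[OF tot] le3] infsumI[OF tot] by simp
  also have "\<dots> = 2 * s powr (1 + \<alpha>)"
  proof -
    have "1 / (1 - k)\<^sup>2 = s * s" by (simp add: s_def power2_eq_square)
    moreover have "s powr (\<alpha> - 1) * (s * s) = s powr (1 + \<alpha>)"
      using s0 by (simp add: powr_diff powr_add)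
    moreover have "s powr \<alpha> * s = s powr (1 + \<alpha>)" using s0 by (simp add: powr_add)
    ultimately show ?thesis by (simp add: s_def[symmetric])
  qed
  finally show "wiener_norm (power_weight \<alpha> \<beta>) (\<lambda>p. inverse (1 - \<kappa> * fst p)) \<le> 2 * (1 / (1 - norm \<kappa>)) powr (1 + \<alpha>)"
    using n by (simp add: W_def k_def s_def)
qed

text \<open>Working with a polynomial truncation \<open>P\<close> of \<open>f\<close> keeps the difference quotient in \<open>z\<close> a polynomial and
  also covers points \<open>\<mu>\<close> on the circle.\<close>

theorem inverse_modulo_f:
  assumes \<alpha>: "\<alpha> \<ge> 0" and \<beta>: "0 < \<beta>" "\<beta> \<le> 1"
    and f: "f \<in> wiener_algebra (power_weight \<alpha> \<beta>)" and pos: "wiener_norm (power_weight \<alpha> \<beta>) f > 0"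
  obtains A K where "A > 0"
    "\<And>\<mu> \<delta>. norm \<mu> \<le> 1 \<Longrightarrow> \<delta> > 0 \<Longrightarrow> (\<And>w. norm w \<le> 1 \<Longrightarrow> norm (f (\<mu>, w)) \<ge> \<delta>) \<Longrightarrow>
      \<exists>c\<in>wiener_algebra (power_weight \<alpha> \<beta>). \<exists>h\<in>wiener_algebra (power_weight \<alpha> \<beta>).
        (\<forall>p\<in>closed_bidisc. (fst p - \<mu>) * c p = 1 + f p * h p) \<and>
        (norm \<mu> < 1 \<longrightarrow> wiener_norm (power_weight \<alpha> \<beta>) c \<le> A / ((1 - norm \<mu>) * \<delta> ^ K))"
proof -
  define W where "W = power_weight \<alpha> \<beta>"
  interpret weight W unfolding W_def using \<alpha> \<beta> by (intro power_weight_weight) auto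
  define M where "M = wiener_norm W f"
  have fW: "f \<in> wiener_algebra W" and M: "M > 0" using f pos by (auto simp: W_def M_def)
  show thesis
  proof (rule quantitative_inverse[OF \<alpha> \<beta> M, folded W_def])
    fix A K
    assume A: "A > 0"
      and inv: "\<And>(I :: (nat \<times> nat) set) c \<delta>. finite I \<Longrightarrow> (\<Sum>i\<in>I. norm (c i) * (1 + real (snd i)) powr \<beta>) \<le> M \<Longrightarrow> \<delta> > 0 \<Longrightarrow>
        (\<And>w. norm w \<le> 1 \<Longrightarrow> norm (\<Sum>i\<in>I. c i * w ^ snd i) \<ge> \<delta>) \<Longrightarrow>
        (\<lambda>p. inverse (\<Sum>i\<in>I. c i * snd p ^ snd i)) \<in> wiener_algebra W \<and>
        wiener_norm W (\<lambda>p. inverse (\<Sum>i\<in>I. c i * snd p ^ snd i)) \<le> A / \<delta> ^ K"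
    \<comment> \<open>Comes from \<open>(M / (1 - norm \<mu>)) * (2 * B)\<close> with
      \<open>B = A / (\<delta> / 2) ^ K\<close>.\<close>
    define A' where "A' = 2 * M * A * 2 ^ K"
    have W_mono: "W (i, m) \<le> W (n, m)" if "i \<le> n" for i n m
      using that \<alpha> by (auto simp: W_def power_weight_def intro!: mult_right_mono powr_mono2)
    have main: "\<exists>c\<in>wiener_algebra W. \<exists>h\<in>wiener_algebra W.
          (\<forall>p\<in>closed_bidisc. (fst p - \<mu>) * c p = 1 + f p * h p) \<and>
          (norm \<mu> < 1 \<longrightarrow> wiener_norm W c \<le> A' / ((1 - norm \<mu>) * \<delta> ^ K))"
      if \<mu>: "norm \<mu> \<le> 1" and \<delta>: "\<delta> > 0" and low: "\<And>w. norm w \<le> 1 \<Longrightarrow> norm (f (\<mu>, w)) \<ge> \<delta>" for \<mu> \<delta>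
    proof -
      define B where "B = A / (\<delta> / 2) ^ K"
      have B: "B > 0" using A \<delta> by (simp add: B_def)
      \<comment> \<open>The first bound keeps the modulus of the truncation at
        \<open>z = \<mu>\<close> above \<open>\<delta> / 2\<close>; the second makes the error
        \<open>E = (f - P) * g\<close> of norm at most 1/2, so that \<open>1 + E\<close> is inverted
        by a Neumann series.\<close>
      define \<tau> where "\<tau> = min (\<delta> / 2) (1 / (2 * B))"
      have \<tau>: "\<tau> > 0" "\<tau> \<le> \<delta> / 2" "\<tau> * B \<le> 1 / 2"
      proof -
        show "\<tau> > 0" "\<tau> \<le> \<delta> / 2" using \<delta> B by (auto simp: \<tau>_def)
        have "\<tau> * B \<le> 1 / (2 * B) * B" using B by (intro mult_right_mono) (auto simp: \<tau>_def)
        then show "\<tau> * B \<le> 1 / 2" using B by simp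
      qed
      show ?thesis
      proof (rule truncation[OF fW \<tau>(1), folded M_def])
        fix F a
        assume F: "finite F" and a: "power_series_of f a"
          and tr: "wiener_norm W (\<lambda>p. f p - (\<Sum>q\<in>F. a q * fst p ^ fst q * snd p ^ snd q)) < \<tau>"
          and aM: "(\<Sum>q\<in>F. norm (a q) * W q) \<le> M"
        define P where "P = (\<lambda>p. \<Sum>q\<in>F. a q * fst p ^ fst q * snd p ^ snd q)"
        \<comment> \<open>Coefficients of the slice of \<open>P\<close> at \<open>z = \<mu>\<close>,
          still indexed by pairs; \<open>quantitative_inverse\<close> is stated for such index sets,
          which spares a regrouping by powers of \<open>w\<close>.\<close>
        define c where "c q = a q * \<mu> ^ fst q" for q
        define g where "g = (\<lambda>p :: complex \<times> complex. inverse (\<Sum>q\<in>F. c q * snd p ^ snd q))"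
        have fP: "(\<lambda>p. f p - P p) \<in> wiener_algebra W" unfolding P_def by (rule diff(1)[OF fW polynomial(1)])
        have low': "norm (\<Sum>q\<in>F. c q * w ^ snd q) \<ge> \<delta> / 2" if w: "norm w \<le> 1" for w
        proof -
          have "norm (f (\<mu>, w) - P (\<mu>, w)) \<le> wiener_norm W (\<lambda>p. f p - P p)"
            by (rule closed_bidisc_le[OF fP]) (use \<mu> w in simp)
          then have "norm (f (\<mu>, w) - P (\<mu>, w)) \<le> \<delta> / 2" using tr \<tau>(2) by (simp add: P_def)
          moreover have "norm (f (\<mu>, w)) - norm (P (\<mu>, w)) \<le> norm (f (\<mu>, w) - P (\<mu>, w))" by (rule norm_triangle_ineq2)
          ultimately have "norm (P (\<mu>, w)) \<ge> \<delta> / 2" using low[OF w] by linarith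
          then show ?thesis by (simp add: P_def c_def)
        qed
        have cM: "(\<Sum>q\<in>F. norm (c q) * (1 + real (snd q)) powr \<beta>) \<le> M"
        proof (rule order_trans[OF sum_mono aM])
          fix q
          have "norm (c q) \<le> norm (a q) * 1"
            unfolding c_def norm_mult norm_power using \<mu> by (intro mult_left_mono power_le_one) auto
          moreover have "(1 + real (snd q)) powr \<beta> \<le> W q"
          proof -
            have "1 * (1 + real (snd q)) powr \<beta> \<le> (1 + real (fst q)) powr \<alpha> * (1 + real (snd q)) powr \<beta>"
              using \<alpha> by (intro mult_right_mono ge_one_powr_ge_zero) auto
            then show ?thesis by (simp add: W_def power_weight_def case_prod_unfold)
          qed
          ultimately show "norm (c q) * (1 + real (snd q)) powr \<beta> \<le> norm (a q) * W q"
            by (intro mult_mono) auto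
        qed
        have gW: "g \<in> wiener_algebra W" and gB: "wiener_norm W g \<le> B"
          using inv[OF F cM _ low'] \<delta> by (auto simp: g_def B_def)
        define E where "E = (\<lambda>p. (f p - P p) * g p)"
        have EW: "E \<in> wiener_algebra W" unfolding E_def by (rule mult(1)[OF fP gW])
        have "wiener_norm W E \<le> \<tau> * B"
          unfolding E_def by (rule norm_mult_le[OF fP gW _ gB]) (use tr in \<open>simp add: P_def\<close>)
        then have E_le: "wiener_norm W E \<le> 1 / 2" using \<tau>(3) by simp
        define x where "x = (\<lambda>p. (-1) * E p)"
        have xW: "x \<in> wiener_algebra W" and x_le: "wiener_norm W x \<le> 1 / 2"
          unfolding x_def using wiener_algebra_cmult[OF EW, of "-1"] E_le by auto
        then have x1: "wiener_norm W x < 1" by simp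
        note nm = neumann[OF xW x1]
        define y where "y = (\<lambda>p. inverse (1 - x p))"
        have yW: "y \<in> wiener_algebra W" and y2: "wiener_norm W y \<le> 2"
        proof -
          show "y \<in> wiener_algebra W" using nm(1) by (simp add: y_def)
          have "1 / (1 - wiener_norm W x) \<le> 1 / (1 / 2)" using x_le by (intro divide_left_mono) auto
          then show "wiener_norm W y \<le> 2" using nm(2) by (simp add: y_def)
        qed
        \<comment> \<open>The difference quotient at \<open>\<mu>\<close> of one monomial of
          \<open>P\<close>. Its norm involves a finite sum of powers of \<open>norm \<mu>\<close>,
          at most \<open>1 / (1 - norm \<mu>)\<close> inside the disc; on the circle only membership
          is claimed.\<close>
        define t where "t q = (\<lambda>p :: complex \<times> complex. \<Sum>i<fst q. (a q * \<mu> ^ (fst q - Suc i)) * fst p ^ i * snd p ^ snd q)" for q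
        define s where "s = (\<lambda>p. \<Sum>q\<in>F. t q p)"
        have tW: "t q \<in> wiener_algebra W" for q
          unfolding t_def by (rule polynomial(1)[where n = "\<lambda>i. i" and m = "\<lambda>i. snd q"])
        have sW: "s \<in> wiener_algebra W" unfolding s_def by (rule sum(1)[OF tW])
        have s_eq: "(fst p - \<mu>) * s p = P p - (\<Sum>q\<in>F. c q * snd p ^ snd q)" for p
        proof -
          have "(fst p - \<mu>) * t q p = a q * fst p ^ fst q * snd p ^ snd q - c q * snd p ^ snd q" for q
          proof -
            have "fst p ^ fst q - \<mu> ^ fst q = (fst p - \<mu>) * (\<Sum>i<fst q. \<mu> ^ (fst q - Suc i) * fst p ^ i)"
              by (rule power_diff_sumr2)
            moreover have "t q p = (a q * snd p ^ snd q) * (\<Sum>i<fst q. \<mu> ^ (fst q - Suc i) * fst p ^ i)"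
              by (simp add: t_def sum_distrib_left mult_ac)
            ultimately have "(fst p - \<mu>) * t q p = (a q * snd p ^ snd q) * (fst p ^ fst q - \<mu> ^ fst q)" by simp
            then show ?thesis by (simp add: c_def algebra_simps)
          qed
          then show ?thesis by (simp add: s_def P_def sum_distrib_left sum_subtractf)
        qed
        have s_le: "wiener_norm W s \<le> M / (1 - norm \<mu>)" if l1: "norm \<mu> < 1"
        proof -
          have "wiener_norm W s \<le> (\<Sum>q\<in>F. wiener_norm W (t q))" unfolding s_def by (rule sum(2)[OF tW])
          also have "\<dots> \<le> (\<Sum>q\<in>F. norm (a q) * W q * (1 / (1 - norm \<mu>)))"
          proof (rule sum_mono)
            fix q
            have "wiener_norm W (t q) \<le> (\<Sum>i<fst q. norm (a q * \<mu> ^ (fst q - Suc i)) * W (i, snd q))"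
              unfolding t_def by (rule polynomial(2)[where n = "\<lambda>i. i" and m = "\<lambda>i. snd q"])
            also have "\<dots> \<le> (\<Sum>i<fst q. (norm (a q) * W q) * norm \<mu> ^ (fst q - Suc i))"
            proof (rule sum_mono)
              fix i assume "i \<in> {..<fst q}"
              then have "W (i, snd q) \<le> W q" using W_mono[of i "fst q" "snd q"] by simp
              then have "norm (a q) * norm \<mu> ^ (fst q - Suc i) * W (i, snd q) \<le> norm (a q) * norm \<mu> ^ (fst q - Suc i) * W q"
                by (intro mult_left_mono) auto
              then show "norm (a q * \<mu> ^ (fst q - Suc i)) * W (i, snd q) \<le> (norm (a q) * W q) * norm \<mu> ^ (fst q - Suc i)"
                by (simp add: norm_mult norm_power mult_ac)
            qed
            also have "\<dots> = (norm (a q) * W q) * (\<Sum>i<fst q. norm \<mu> ^ (fst q - Suc i))" by (simp add: sum_distrib_left)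
            also have "(\<Sum>i<fst q. norm \<mu> ^ (fst q - Suc i)) = (\<Sum>i<fst q. norm \<mu> ^ i)"
              by (rule sum.nat_diff_reindex)
            also have "(norm (a q) * W q) * (\<Sum>i<fst q. norm \<mu> ^ i) \<le> (norm (a q) * W q) * (1 / (1 - norm \<mu>))"
            proof (rule mult_left_mono)
              show "(\<Sum>i<fst q. norm \<mu> ^ i) \<le> 1 / (1 - norm \<mu>)"
                using finite_sum_le_has_sum[OF geometric_has_sum[of "norm \<mu>"], of "{..<fst q}"] l1 by simp
            qed (simp add: nonneg)
            finally show "wiener_norm W (t q) \<le> norm (a q) * W q * (1 / (1 - norm \<mu>))" .
          qed
          also have "\<dots> = (\<Sum>q\<in>F. norm (a q) * W q) * (1 / (1 - norm \<mu>))" by (rule sum_distrib_right[symmetric])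
          also have "\<dots> \<le> M * (1 / (1 - norm \<mu>))" using aM l1 by (intro mult_right_mono) auto
          finally show ?thesis by simp
        qed
        define G where "G = (\<lambda>p. g p * y p)"
        have GW: "G \<in> wiener_algebra W" unfolding G_def by (rule mult(1)[OF gW yW])
        have G_le: "wiener_norm W G \<le> B * 2" unfolding G_def by (rule norm_mult_le[OF gW yW gB y2])
        \<comment> \<open>Multiplying \<open>f * g = 1 + (z - \<mu>) * s * g + E\<close> by
          \<open>y = 1 / (1 + E)\<close> gives \<open>f * G = 1 + (z - \<mu>) * s * G\<close>, which
          is the claim with inverse \<open>- s * G\<close> and cofactor \<open>- G\<close>.\<close>
        define C where "C = (\<lambda>p. (-1) * (s p * G p))"
        define H where "H = (\<lambda>p. (-1) * G p)"
        have CW: "C \<in> wiener_algebra W" unfolding C_def by (rule wiener_algebra_cmult(1)[OF mult(1)[OF sW GW]])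
        have HW: "H \<in> wiener_algebra W" unfolding H_def by (rule wiener_algebra_cmult(1)[OF GW])
        have eq: "(fst p - \<mu>) * C p = 1 + f p * H p" if p: "p \<in> closed_bidisc" for p
        proof -
          define L where "L = (\<Sum>q\<in>F. c q * snd p ^ snd q)"
          have "norm (snd p) \<le> 1" using p by (auto simp: mem_Times_iff)
          then have "norm L > 0" unfolding L_def using low'[of "snd p"] \<delta> by linarith
          then have Lg: "L * g p = 1" by (simp add: g_def L_def[symmetric])
          have "1 - x p \<noteq> 0" using nm(3)[OF p] by simp
          then have Ey: "(1 + E p) * y p = 1" by (simp add: y_def x_def)
          have "f p = L + (fst p - \<mu>) * s p + (f p - P p)" using s_eq[of p] by (simp add: L_def)
          from arg_cong[OF this, of "\<lambda>v. v * g p"]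
          have "f p * g p = L * g p + (fst p - \<mu>) * s p * g p + E p"
            unfolding E_def distrib_right .
          then have fg: "f p * g p = 1 + (fst p - \<mu>) * s p * g p + E p" unfolding Lg .
          have "f p * G p = (f p * g p) * y p" by (simp add: G_def)
          also have "\<dots> = (1 + E p) * y p + (fst p - \<mu>) * (s p * G p)" unfolding fg by (simp add: G_def algebra_simps)
          finally have "f p * G p = (1 + E p) * y p + (fst p - \<mu>) * (s p * G p)" .
          then show ?thesis unfolding Ey by (simp add: C_def H_def algebra_simps)
        qed
        have "wiener_norm W C \<le> A' / ((1 - norm \<mu>) * \<delta> ^ K)" if l1: "norm \<mu> < 1"
        proof -
          have "wiener_norm W C = wiener_norm W (\<lambda>p. s p * G p)"
            unfolding C_def using wiener_algebra_cmult(2)[OF mult(1)[OF sW GW], of "-1"] by simp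
          also have "\<dots> \<le> (M / (1 - norm \<mu>)) * (B * 2)" by (rule norm_mult_le[OF sW GW s_le[OF l1] G_le])
          also have "\<dots> = A' / ((1 - norm \<mu>) * \<delta> ^ K)" by (simp add: A'_def B_def power_divide)
          finally show ?thesis .
        qed
        then show ?thesis using CW HW eq by blast
      qed
    qed
    have "A' > 0" using A M by (simp add: A'_def)
    then show thesis by (rule that) (rule main[unfolded W_def])
  qed
qed

section \<open>The theorem\<close>

text \<open>Modulo \<open>f\<close>, an inverse at \<open>v\<close> is \<open>c * y\<close> with
  \<open>y = 1 / (1 - (u - v) * (z - 1) * c)\<close>. Two steps of the geometric expansion of
  \<open>y\<close> leave a remainder \<open>(u - v) ^ 2 * Z\<close> with \<open>Z\<close> bounded in
  norm, whence the derivative. Since \<open>\<phi>\<close> respects classes modulo \<open>f\<close>,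
  any choice of inverses may be used.\<close>

lemma resolvent_derivative:
  fixes \<phi> :: "(complex \<times> complex \<Rightarrow> complex) \<Rightarrow> complex"
  assumes W: "weight W"
    and f: "f \<in> wiener_algebra W"
    and \<phi>scale: "\<And>c x. x \<in> wiener_algebra W \<Longrightarrow> \<phi> (\<lambda>p. c * x p) = c * \<phi> x"
    and \<phi>add: "\<And>x y. x \<in> wiener_algebra W \<Longrightarrow> y \<in> wiener_algebra W \<Longrightarrow> \<phi> (\<lambda>p. x p + y p) = \<phi> x + \<phi> y"
    and \<phi>le: "\<And>x. x \<in> wiener_algebra W \<Longrightarrow> norm (\<phi> x) \<le> wiener_norm W x"
    and \<phi>cong: "\<And>x y h. x \<in> wiener_algebra W \<Longrightarrow> y \<in> wiener_algebra W \<Longrightarrow> h \<in> wiener_algebra W \<Longrightarrow>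
      (\<And>p. p \<in> closed_bidisc \<Longrightarrow> x p - y p = f p * h p) \<Longrightarrow> \<phi> x = \<phi> y"
    and E: "\<And>u c h. c \<in> wiener_algebra W \<Longrightarrow> h \<in> wiener_algebra W \<Longrightarrow>
      (\<And>p. p \<in> closed_bidisc \<Longrightarrow> (1 + u * (fst p - 1)) * c p = 1 + f p * h p) \<Longrightarrow> E u = \<phi> c"
    and c: "c \<in> wiener_algebra W" and h: "h \<in> wiener_algebra W"
    and eq: "\<And>p. p \<in> closed_bidisc \<Longrightarrow> (1 + u * (fst p - 1)) * c p = 1 + f p * h p"
  shows "(E has_field_derivative - \<phi> (\<lambda>p. (fst p - 1) * (c p * c p))) (at u)"
proof -
  interpret weight W by (rule W)
  define T where "T = (\<lambda>p :: complex \<times> complex. fst p - 1)"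
  have TW: "T \<in> wiener_algebra W" unfolding T_def by (rule coordinate_minus_one)
  define Tc where "Tc = (\<lambda>p. T p * c p)"
  have TcW: "Tc \<in> wiener_algebra W" unfolding Tc_def by (rule mult(1)[OF TW c])
  define Tcc where "Tcc = (\<lambda>p. Tc p * c p)"
  have TccW: "Tcc \<in> wiener_algebra W" unfolding Tcc_def by (rule mult(1)[OF TcW c])
  define X where "X = (\<lambda>p. Tc p * Tcc p)"
  have XW: "X \<in> wiener_algebra W" unfolding X_def by (rule mult(1)[OF TcW TccW])
  define C where "C = wiener_norm W X * 2"
  have C0: "C \<ge> 0" using norm_nonneg by (simp add: C_def)
  \<comment> \<open>Keeps the norm of \<open>(u - v) * (z - 1) * c\<close> at most 1/2, so that the
    Neumann series has norm at most 2.\<close>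
  define r where "r = 1 / (2 * (wiener_norm W Tc + 1))"
  have NT: "wiener_norm W Tc \<ge> 0" by (rule norm_nonneg)
  have r: "r > 0" using NT by (simp add: r_def)
  have est: "norm (E v - E u - (u - v) * \<phi> Tcc) \<le> norm (u - v) ^ 2 * C" if v: "norm (u - v) < r" for v
  proof -
    define x where "x = (\<lambda>p. (u - v) * Tc p)"
    have xW: "x \<in> wiener_algebra W" unfolding x_def by (rule wiener_algebra_cmult(1)[OF TcW])
    have "wiener_norm W x = norm (u - v) * wiener_norm W Tc" unfolding x_def by (rule wiener_algebra_cmult(2)[OF TcW])
    also have "\<dots> \<le> r * (wiener_norm W Tc + 1)" using v NT r by (intro mult_mono) auto
    also have "\<dots> = 1 / 2" using NT by (simp add: r_def)
    finally have x_le: "wiener_norm W x \<le> 1 / 2" .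
    then have x1: "wiener_norm W x < 1" by simp
    note nm = neumann[OF xW x1]
    define y where "y = (\<lambda>p. inverse (1 - x p))"
    have yW: "y \<in> wiener_algebra W" and y2: "wiener_norm W y \<le> 2"
    proof -
      show "y \<in> wiener_algebra W" using nm(1) by (simp add: y_def)
      have "1 / (1 - wiener_norm W x) \<le> 1 / (1 / 2)" using x_le by (intro divide_left_mono) auto
      then show "wiener_norm W y \<le> 2" using nm(2) by (simp add: y_def)
    qed
    have xy: "(1 - x p) * y p = 1" if "p \<in> closed_bidisc" for p using nm(3)[OF that] by (simp add: y_def)
    have Eu: "E u = \<phi> c" by (rule E[OF c h eq])
    have Ev: "E v = \<phi> (\<lambda>p. c p * y p)"
    proof (rule E[OF mult(1)[OF c yW] mult(1)[OF h yW]])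
      fix p assume p: "p \<in> closed_bidisc"
      have "(1 + v * (fst p - 1)) * c p = (1 + u * (fst p - 1)) * c p - x p"
        by (simp add: x_def Tc_def T_def algebra_simps)
      also have "\<dots> = (1 - x p) + f p * h p" using eq[OF p] by simp
      finally have "(1 + v * (fst p - 1)) * c p * y p = (1 - x p) * y p + f p * h p * y p"
        by (simp add: distrib_right)
      then show "(1 + v * (fst p - 1)) * (c p * y p) = 1 + f p * (h p * y p)"
        using xy[OF p] by (simp add: mult.assoc)
    qed
    define Z where "Z = (\<lambda>p. X p * y p)"
    have ZW: "Z \<in> wiener_algebra W" unfolding Z_def by (rule mult(1)[OF XW yW])
    define a where "a = (\<lambda>p. (u - v) * Tcc p)"
    define b where "b = (\<lambda>p. (u - v) ^ 2 * Z p)"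
    have aW: "a \<in> wiener_algebra W" unfolding a_def by (rule wiener_algebra_cmult(1)[OF TccW])
    have bW: "b \<in> wiener_algebra W" unfolding b_def by (rule wiener_algebra_cmult(1)[OF ZW])
    have "\<phi> (\<lambda>p. c p * y p) = \<phi> (\<lambda>p. c p + (a p + b p))"
    proof (rule \<phi>cong[OF mult(1)[OF c yW] add(1)[OF c add(1)[OF aW bW]] const(1)[of 0]])
      fix p assume p: "p \<in> closed_bidisc"
      have y_eq: "y p = 1 + x p * y p" using xy[OF p] by (simp add: algebra_simps)
      have "c p * y p = c p * (1 + x p * (1 + x p * y p))" using y_eq by metis
      also have "\<dots> = c p + (a p + b p)"
        by (simp add: a_def b_def x_def Z_def X_def Tcc_def power2_eq_square algebra_simps)
      finally show "c p * y p - (c p + (a p + b p)) = f p * 0" by simp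
    qed
    also have "\<dots> = \<phi> c + (\<phi> a + \<phi> b)" using \<phi>add[OF c add(1)[OF aW bW]] \<phi>add[OF aW bW] by simp
    finally have "E v - E u - (u - v) * \<phi> Tcc = (u - v) ^ 2 * \<phi> Z"
      unfolding Ev Eu using \<phi>scale[OF TccW, of "u - v"] \<phi>scale[OF ZW, of "(u - v) ^ 2"] by (simp add: a_def b_def)
    then have "norm (E v - E u - (u - v) * \<phi> Tcc) = norm (u - v) ^ 2 * norm (\<phi> Z)" by (simp add: norm_mult norm_power)
    also have "\<dots> \<le> norm (u - v) ^ 2 * C"
    proof (rule mult_left_mono)
      have "norm (\<phi> Z) \<le> wiener_norm W Z" by (rule \<phi>le[OF ZW])
      also have "\<dots> \<le> C" unfolding Z_def C_def by (rule norm_mult_le[OF XW yW order_refl y2])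
      finally show "norm (\<phi> Z) \<le> C" .
    qed simp
    finally show ?thesis .
  qed
  have "((\<lambda>k. (E (u + k) - E u) / k) \<longlongrightarrow> - \<phi> Tcc) (at 0)"
  proof (rule LIM_I)
    fix e :: real assume e: "e > 0"
    define s where "s = min r (e / (C + 1))"
    have s: "s > 0" using r e C0 by (simp add: s_def)
    show "\<exists>s>0. \<forall>k. k \<noteq> 0 \<and> norm (k - 0) < s \<longrightarrow> norm ((E (u + k) - E u) / k - - \<phi> Tcc) < e"
    proof (intro exI[of _ s] conjI allI impI s)
      fix k :: complex assume k: "k \<noteq> 0 \<and> norm (k - 0) < s"
      have "(E (u + k) - E u) / k - - \<phi> Tcc = (E (u + k) - E u - (u - (u + k)) * \<phi> Tcc) / k"
        using k by (simp add: field_simps)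
      then have "norm ((E (u + k) - E u) / k - - \<phi> Tcc) = norm (E (u + k) - E u - (u - (u + k)) * \<phi> Tcc) / norm k"
        by (simp only: norm_divide)
      also have "\<dots> \<le> (norm (u - (u + k)) ^ 2 * C) / norm k"
        using k est[of "u + k"] by (intro divide_right_mono) (auto simp: s_def)
      also have "\<dots> = norm k * C" using k by (simp add: power2_eq_square)
      also have "\<dots> \<le> norm k * (C + 1)" by (intro mult_left_mono) auto
      also have "\<dots> < e / (C + 1) * (C + 1)" using k C0 by (intro mult_strict_right_mono) (auto simp: s_def)
      finally show "norm ((E (u + k) - E u) / k - - \<phi> Tcc) < e" using C0 by simp
    qed
  qed
  then have "(E has_field_derivative - \<phi> Tcc) (at u)" by (simp add: DERIV_def)
  then show ?thesis by (simp add: Tcc_def Tc_def T_def mult.assoc)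
qed

theorem coordinate_in_closed_ideal:
  assumes \<alpha>: "0 \<le> \<alpha>" "\<alpha> < 1" and \<beta>: "0 < \<beta>" "\<beta> \<le> 1"
    and f: "f \<in> wiener_algebra (power_weight \<alpha> \<beta>)"
    and nz: "\<And>z w. norm z \<le> 1 \<Longrightarrow> norm w \<le> 1 \<Longrightarrow> z \<noteq> 1 \<Longrightarrow> f (z, w) \<noteq> 0"
    and outer: "\<And>w. norm w \<le> 1 \<Longrightarrow> outer_function (\<lambda>z. f (z, w))"
    and e: "e > 0"
  shows "\<exists>h\<in>wiener_algebra (power_weight \<alpha> \<beta>). wiener_norm (power_weight \<alpha> \<beta>) (\<lambda>p. fst p - 1 - f p * h p) < e"
proof (rule ccontr)
  assume no: "\<not> ?thesis"
  define W where "W = power_weight \<alpha> \<beta>"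
  interpret weight W unfolding W_def using \<alpha> \<beta> by (intro power_weight_weight) auto
  have fW: "f \<in> wiener_algebra W" using f by (simp add: W_def)
  have far: "e \<le> wiener_norm W (\<lambda>p. (fst p - 1) - f p * h p)" if "h \<in> wiener_algebra W" for h
  proof (rule ccontr)
    assume "\<not> ?thesis"
    then have "wiener_norm W (\<lambda>p. fst p - 1 - f p * h p) < e" by simp
    then show False using no that unfolding W_def by blast
  qed
  have f00: "f (0, 0) \<noteq> 0" using nz[of 0 0] by simp
  have "norm (f (0, 0)) \<le> wiener_norm W f" by (rule closed_bidisc_le[OF fW]) simp
  moreover have "norm (f (0, 0)) > 0" using f00 by simp
  ultimately have pos: "wiener_norm W f > 0" by linarith
  show False
  proof (rule ideal_functional[OF fW coordinate_minus_one e far])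
    fix \<phi> :: "(complex \<times> complex \<Rightarrow> complex) \<Rightarrow> complex"
    assume \<phi>add: "\<And>x y. x \<in> wiener_algebra W \<Longrightarrow> y \<in> wiener_algebra W \<Longrightarrow> \<phi> (\<lambda>p. x p + y p) = \<phi> x + \<phi> y"
      and \<phi>scale: "\<And>c x. x \<in> wiener_algebra W \<Longrightarrow> \<phi> (\<lambda>p. c * x p) = c * \<phi> x"
      and \<phi>le: "\<And>x. x \<in> wiener_algebra W \<Longrightarrow> norm (\<phi> x) \<le> wiener_norm W x"
      and \<phi>cong: "\<And>x y h. x \<in> wiener_algebra W \<Longrightarrow> y \<in> wiener_algebra W \<Longrightarrow> h \<in> wiener_algebra W \<Longrightarrow>
        (\<And>p. p \<in> closed_bidisc \<Longrightarrow> x p - y p = f p * h p) \<Longrightarrow> \<phi> x = \<phi> y"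
      and \<phi>nz: "\<phi> (\<lambda>p. fst p - 1) \<noteq> 0"
    define P where "P u c \<longleftrightarrow> c \<in> wiener_algebra W \<and>
      (\<exists>h\<in>wiener_algebra W. \<forall>p\<in>closed_bidisc. (1 + u * (fst p - 1)) * c p = 1 + f p * h p)" for u c
    define E where "E u = \<phi> (SOME c. P u c)" for u
    \<comment> \<open>Two inverses \<open>c\<close> and \<open>d\<close> with cofactors
      \<open>h\<close> and \<open>k\<close> differ by \<open>f * (d * h - c * k)\<close>, so
      \<open>E\<close> does not depend on the choice made by \<open>SOME\<close>.\<close>
    have \<phi>P: "\<phi> c = \<phi> d" if c: "P u c" and d: "P u d" for u c d
    proof -
      obtain h where h: "h \<in> wiener_algebra W" "\<And>p. p \<in> closed_bidisc \<Longrightarrow> (1 + u * (fst p - 1)) * c p = 1 + f p * h p"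
        using c unfolding P_def by blast
      obtain k where k: "k \<in> wiener_algebra W" "\<And>p. p \<in> closed_bidisc \<Longrightarrow> (1 + u * (fst p - 1)) * d p = 1 + f p * k p"
        using d unfolding P_def by blast
      have cW: "c \<in> wiener_algebra W" and dW: "d \<in> wiener_algebra W" using c d by (auto simp: P_def)
      show ?thesis
      proof (rule \<phi>cong[OF cW dW diff(1)[OF mult(1)[OF dW h(1)] mult(1)[OF cW k(1)]]])
        fix p :: "complex \<times> complex" assume p: "p \<in> closed_bidisc"
        have "c p * ((1 + u * (fst p - 1)) * d p) = d p * ((1 + u * (fst p - 1)) * c p)" by (simp add: mult_ac)
        then have "c p * (1 + f p * k p) = d p * (1 + f p * h p)" using h(2)[OF p] k(2)[OF p] by simp
        then show "c p - d p = f p * (d p * h p - c p * k p)" by (simp add: algebra_simps)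
      qed
    qed
    have E_eq: "E u = \<phi> c" if "P u c" for u c
      unfolding E_def by (rule \<phi>P[OF someI[of "P u", OF that] that])
    have E_le: "norm (E u) \<le> wiener_norm W c" if "P u c" for u c
      using E_eq[OF that] \<phi>le[of c] that by (simp add: P_def)
    \<comment> \<open>With \<open>\<kappa> = - u / (1 - u)\<close> one has
      \<open>1 + u * (z - 1) = (1 - u) * (1 - \<kappa> * z)\<close>, and
      \<open>norm \<kappa> < 1\<close> for \<open>Re u < 1/2\<close>. The inverse is then a genuine
      one, with cofactor 0.\<close>
    define Q where "Q u = (\<lambda>p :: complex \<times> complex. inverse (1 - u) * inverse (1 - (- u / (1 - u)) * fst p))" for u
    have left_gen: "P u (Q u)" "norm (- u / (1 - u)) < 1"
      "wiener_norm W (Q u) = wiener_norm W (\<lambda>p. inverse (1 - (- u / (1 - u)) * fst p)) / norm (1 - u)"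
      if u: "Re u < 1/2" for u
    proof -
      have u1: "1 - u \<noteq> 0" using u by auto
      have "norm u ^ 2 < norm (1 - u) ^ 2" using u unfolding cmod_power2 by (simp add: power2_eq_square algebra_simps)
      then have "norm u < norm (1 - u)" by (rule power2_less_imp_less) simp
      then show \<kappa>: "norm (- u / (1 - u)) < 1" using u1 by (simp add: norm_divide)
      have gW: "(\<lambda>p. inverse (1 - (- u / (1 - u)) * fst p)) \<in> wiener_algebra W"
        unfolding W_def by (rule geometric_fst(1)) (use \<alpha> \<beta> \<kappa> in auto)
      have QW: "Q u \<in> wiener_algebra W" unfolding Q_def by (rule wiener_algebra_cmult(1)[OF gW])
      show "wiener_norm W (Q u) = wiener_norm W (\<lambda>p. inverse (1 - (- u / (1 - u)) * fst p)) / norm (1 - u)"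
        unfolding Q_def wiener_algebra_cmult(2)[OF gW] by (simp add: norm_inverse divide_inverse)
      have "(1 + u * (fst p - 1)) * Q u p = 1 + f p * 0" if p: "p \<in> closed_bidisc" for p
      proof -
        define D where "D = 1 - (- u / (1 - u)) * fst p"
        have "D \<noteq> 0"
        proof
          assume "D = 0"
          then have "norm ((- u / (1 - u)) * fst p) = 1" unfolding D_def by (metis eq_iff_diff_eq_0 norm_one)
          moreover have "norm (- u / (1 - u)) * norm (fst p) \<le> norm (- u / (1 - u)) * 1"
            using p by (intro mult_left_mono) (auto simp: mem_Times_iff)
          ultimately show False using \<kappa> by (simp only: norm_mult)
        qed
        then have inv: "((1 - u) * D) * (inverse (1 - u) * inverse D) = 1" using u1 by (simp add: mult_ac)
        have "(1 - u) * (u / (1 - u) * fst p) = u * fst p" using u1 by simp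
        then have eqD: "1 + u * (fst p - 1) = (1 - u) * D" by (simp add: D_def algebra_simps)
        show ?thesis unfolding eqD Q_def D_def[symmetric] inv by simp
      qed
      then show "P u (Q u)" unfolding P_def by (intro conjI QW bexI[of _ "\<lambda>_. 0"] ballI const(1))
    qed
    have left: "norm (E u) \<le> 1 * (norm (1 - u) * (norm (1 - u) + norm u) ^ 2 / (1 - 2 * Re u) ^ 2)"
      if u: "Re u < 1/2" for u
    proof -
      define a where "a = norm (1 - u)"
      define b where "b = norm u"
      have sq: "a ^ 2 - b ^ 2 = 1 - 2 * Re u"
        unfolding a_def b_def cmod_power2 by (simp add: power2_eq_square algebra_simps)
      have "1 - u \<noteq> 0" using u by auto
      then have a: "a > 0" by (simp add: a_def)
      have b: "b \<ge> 0" by (simp add: b_def)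
      have \<kappa>: "norm (- u / (1 - u)) = b / a" by (simp add: norm_divide a_def b_def)
      have ba: "b < a" using left_gen(2)[OF u] a unfolding \<kappa> by (simp add: field_simps)
      have "norm (E u) \<le> wiener_norm W (\<lambda>p. inverse (1 - (- u / (1 - u)) * fst p)) / a"
        using E_le[OF left_gen(1)[OF u]] left_gen(3)[OF u] by (simp add: a_def)
      also have "\<dots> \<le> (1 / (1 - b / a)\<^sup>2) / a"
        using geometric_fst(2)[of \<alpha> \<beta>, OF _ _ _ left_gen(2)[OF u]] \<alpha> \<beta> a unfolding \<kappa> W_def
        by (intro divide_right_mono) auto
      also have "\<dots> = a / (a - b) ^ 2"
      proof -
        have "1 - b / a = (a - b) / a" using a by (simp add: field_simps)
        then show ?thesis using a by (simp add: power_divide power2_eq_square)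
      qed
      \<comment> \<open>Expanding the fraction by \<open>(a + b) ^ 2\<close> exhibits the explicit
        denominator, because \<open>a ^ 2 - b ^ 2 = 1 - 2 * Re u\<close>.\<close>
      also have "\<dots> = a * (a + b) ^ 2 / (1 - 2 * Re u) ^ 2"
      proof -
        have "1 - 2 * Re u = (a - b) * (a + b)" unfolding sq[symmetric] by (simp add: power2_eq_square algebra_simps)
        moreover have "a + b \<noteq> 0" using a b by simp
        ultimately show ?thesis by (simp add: power_mult_distrib)
      qed
      finally show ?thesis by (simp add: a_def b_def)
    qed
    have neg: "norm (E (- of_real t)) \<le> 2 * (1 + t) powr \<alpha>" if t: "t > 0" for t
    proof -
      define u where "u = - (of_real t :: complex)"
      have u: "Re u < 1/2" using t by (simp add: u_def)
      have nu: "norm (1 - u) = 1 + t"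
      proof -
        have "1 - u = of_real (1 + t)" by (simp add: u_def)
        then show ?thesis using t by (simp only: norm_of_real)
      qed
      have \<kappa>: "norm (- u / (1 - u)) = t / (1 + t)" unfolding norm_divide nu using t by (simp add: u_def)
      have "norm (E u) \<le> wiener_norm W (\<lambda>p. inverse (1 - (- u / (1 - u)) * fst p)) / (1 + t)"
        using E_le[OF left_gen(1)[OF u]] left_gen(3)[OF u] nu by simp
      also have "\<dots> \<le> (2 * (1 / (1 - t / (1 + t))) powr (1 + \<alpha>)) / (1 + t)"
        using geometric_fst(3)[of \<alpha> \<beta>, OF _ _ _ left_gen(2)[OF u]] \<alpha> \<beta> t unfolding \<kappa> W_def
        by (intro divide_right_mono) auto
      also have "1 / (1 - t / (1 + t)) = 1 + t" using t by (simp add: field_simps)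
      also have "(2 * (1 + t) powr (1 + \<alpha>)) / (1 + t) = 2 * (1 + t) powr \<alpha>" using t by (simp add: powr_add)
      finally show ?thesis by (simp add: u_def)
    qed
    show False
    proof (rule inverse_modulo_f[OF \<alpha>(1) \<beta> fW[unfolded W_def] pos[unfolded W_def], folded W_def])
      fix A K
      assume A: "A > 0" and inv: "\<And>\<mu> \<delta>. norm \<mu> \<le> 1 \<Longrightarrow> \<delta> > 0 \<Longrightarrow> (\<And>w. norm w \<le> 1 \<Longrightarrow> norm (f (\<mu>, w)) \<ge> \<delta>) \<Longrightarrow>
        \<exists>c\<in>wiener_algebra W. \<exists>h\<in>wiener_algebra W.
        (\<forall>p\<in>closed_bidisc. (fst p - \<mu>) * c p = 1 + f p * h p) \<and>
        (norm \<mu> < 1 \<longrightarrow> wiener_norm W c \<le> A / ((1 - norm \<mu>) * \<delta> ^ K))"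
      \<comment> \<open>With \<open>\<mu> = 1 - 1 / u\<close> one has
        \<open>1 + u * (z - 1) = u * (z - \<mu>)\<close>; the factor 2 bounds
        \<open>1 / norm u\<close>.\<close>
      have right_gen: "\<exists>c. P u c \<and> (norm (1 - 1 / u) < 1 \<longrightarrow>
          wiener_norm W c \<le> 2 * (A / ((1 - norm (1 - 1 / u)) * \<delta> ^ K)))"
        if u: "Re u \<ge> 1/2" and \<mu>1: "norm (1 - 1 / u) \<le> 1" and \<delta>: "\<delta> > 0"
          and low: "\<And>w. norm w \<le> 1 \<Longrightarrow> norm (f (1 - 1 / u, w)) \<ge> \<delta>" for u \<delta>
      proof -
        define \<mu> where "\<mu> = 1 - 1 / u"
        have nu: "norm u \<ge> 1/2" using complex_Re_le_cmod[of u] u by simp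
        then have u0: "u \<noteq> 0" by auto
        obtain c h where ch: "c \<in> wiener_algebra W" "h \<in> wiener_algebra W"
          "\<And>p. p \<in> closed_bidisc \<Longrightarrow> (fst p - \<mu>) * c p = 1 + f p * h p"
          "norm \<mu> < 1 \<Longrightarrow> wiener_norm W c \<le> A / ((1 - norm \<mu>) * \<delta> ^ K)"
          using inv[OF \<mu>1 \<delta> low] unfolding \<mu>_def by blast
        define d where "d = (\<lambda>p. inverse u * c p)"
        have dW: "d \<in> wiener_algebra W" unfolding d_def by (rule wiener_algebra_cmult(1)[OF ch(1)])
        have "(1 + u * (fst p - 1)) * d p = 1 + f p * h p" if p: "p \<in> closed_bidisc" for p
        proof -
          have "(1 + u * (fst p - 1)) * d p = (fst p - \<mu>) * c p" using u0 by (simp add: d_def \<mu>_def field_simps)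
          then show ?thesis using ch(3)[OF p] by simp
        qed
        then have "P u d" unfolding P_def using dW ch(2) by blast
        moreover have "wiener_norm W d \<le> 2 * (A / ((1 - norm \<mu>) * \<delta> ^ K))" if "norm \<mu> < 1"
        proof -
          have "wiener_norm W d = norm (inverse u) * wiener_norm W c" unfolding d_def by (rule wiener_algebra_cmult(2)[OF ch(1)])
          also have "\<dots> \<le> 2 * (A / ((1 - norm \<mu>) * \<delta> ^ K))"
          proof (rule mult_mono)
            have "inverse (norm u) \<le> inverse (1/2)" using nu by (intro le_imp_inverse_le) auto
            then show "norm (inverse u) \<le> 2" by (simp add: norm_inverse)
          qed (use ch(4)[OF that] norm_nonneg in auto)
          finally show ?thesis .
        qed
        ultimately show ?thesis unfolding \<mu>_def by blast
      qed
      \<comment> \<open>This relation is the source of the exponent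
        \<open>norm u ^ 2 / (2 * Re u - 1)\<close> in \<open>entire_constant\<close>.\<close>
      have mu_sq: "norm (1 - 1 / u) ^ 2 = 1 - (2 * Re u - 1) / norm u ^ 2" if "u \<noteq> 0" for u :: complex
      proof -
        have "norm (1 - 1 / u) = norm (u - 1) / norm u" using that by (simp add: norm_divide[symmetric] diff_divide_distrib)
        then have "norm (1 - 1 / u) ^ 2 = norm (u - 1) ^ 2 / norm u ^ 2" by (simp add: power_divide)
        also have "norm (u - 1) ^ 2 = norm u ^ 2 - (2 * Re u - 1)"
          unfolding cmod_power2 by (simp add: power2_eq_square algebra_simps)
        finally show ?thesis using that by (simp add: diff_divide_distrib)
      qed
      \<comment> \<open>For \<open>Re u \<ge> 1/2\<close> the point \<open>1 - 1 / u\<close> lies in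
        the closed disc, on the circle when \<open>Re u = 1/2\<close>, and differs from 1.
        Compactness gives a positive minimum of the modulus of the slice, and existence of an
        inverse at every \<open>u\<close>, without a bound, suffices to make \<open>E\<close>
        entire.\<close>
      have ex: "\<exists>c. P u c" for u
      proof (cases "Re u < 1/2")
        case True then show ?thesis using left_gen(1) by blast
      next
        case False
        then have u0: "u \<noteq> 0" by auto
        have "norm (1 - 1 / u) ^ 2 \<le> 1 ^ 2" unfolding mu_sq[OF u0] using False by simp
        then have m1: "norm (1 - 1 / u) \<le> 1" by (rule power2_le_imp_le) simp
        have ne: "1 - 1 / u \<noteq> 1" using u0 by simp
        have cont: "continuous_on (cball 0 1) (\<lambda>w. norm (f (1 - 1 / u, w)))"
        proof -
          have "f \<in> bidisc_algebra" using fW by (rule wiener_algebraE)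
          then show ?thesis
            by (intro continuous_on_norm continuous_on_compose2[OF bidisc_algebra_continuous] continuous_intros)
               (use m1 in auto)
        qed
        obtain w0 where w0: "w0 \<in> cball 0 1" "\<And>w. w \<in> cball 0 1 \<Longrightarrow> norm (f (1 - 1 / u, w0)) \<le> norm (f (1 - 1 / u, w))"
          using continuous_attains_inf[OF compact_cball _ cont] by auto
        have d0: "norm (f (1 - 1 / u, w0)) > 0" using nz[OF m1 _ ne, of w0] w0(1) by simp
        from right_gen[OF _ m1 d0] False w0(2) show ?thesis by auto
      qed
      have deriv: "(E has_field_derivative - \<phi> (\<lambda>p. (fst p - 1) * (c p * c p))) (at u)" if c: "P u c" for u c
      proof -
        obtain h where h: "c \<in> wiener_algebra W" "h \<in> wiener_algebra W"
          "\<And>p. p \<in> closed_bidisc \<Longrightarrow> (1 + u * (fst p - 1)) * c p = 1 + f p * h p"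
          using c unfolding P_def by blast
        show ?thesis
        proof (rule resolvent_derivative[OF weight_axioms fW \<phi>scale \<phi>add \<phi>le \<phi>cong _ h])
          show "E u = \<phi> c" if "c \<in> wiener_algebra W" "h \<in> wiener_algebra W"
            "\<And>p. p \<in> closed_bidisc \<Longrightarrow> (1 + u * (fst p - 1)) * c p = 1 + f p * h p" for u c h
            by (rule E_eq) (use that in \<open>auto simp: P_def\<close>)
        qed
      qed
      have hol: "E holomorphic_on UNIV"
      proof -
        have "\<exists>D. (E has_field_derivative D) (at u)" for u using ex[of u] deriv by blast
        then show ?thesis
          unfolding holomorphic_on_def field_differentiable_def using has_field_derivative_at_within by blast
      qed
      have right: "\<exists>C. \<forall>u. Re u > 1/2 \<longrightarrow> norm (E u) \<le> C * exp (\<epsilon> * norm u ^ 2 / (2 * Re u - 1))"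
        if \<epsilon>: "\<epsilon> > 0" for \<epsilon>
      proof -
        \<comment> \<open>There are \<open>K\<close> factors \<open>1 / \<delta>\<close> and one
          more exponential that absorbs \<open>q = 1 / (1 - norm \<mu>)\<close> through
          \<open>q \<le> exp (\<eta> * q) / \<eta>\<close>; the 2 comes from
          \<open>q \<le> 2 * (norm u ^ 2 / (2 * Re u - 1))\<close>.\<close>
        define \<eta> where "\<eta> = \<epsilon> / (2 * (real K + 1))"
        have \<eta>: "\<eta> > 0" using \<epsilon> by (simp add: \<eta>_def)
        have "f \<in> bidisc_algebra" using fW by (rule wiener_algebraE)
        then have cf: "continuous_on closed_bidisc f" by (rule bidisc_algebra_continuous)
        show ?thesis
        proof (rule outer_family_lower_bound[OF cf nz outer \<eta>])
          fix c0
          assume c0: "c0 > 0"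
            "\<And>z w. norm z < 1 \<Longrightarrow> norm w \<le> 1 \<Longrightarrow> norm (f (z, w)) \<ge> c0 * exp (- \<eta> / (1 - norm z))"
          define C where "C = 2 * A / (\<eta> * c0 ^ K)"
          have C: "C > 0" using A \<eta> c0(1) by (simp add: C_def)
          have "norm (E u) \<le> C * exp (\<epsilon> * norm u ^ 2 / (2 * Re u - 1))" if u: "Re u > 1/2" for u
          proof -
            define m where "m = norm (1 - 1 / u)"
            have u0: "u \<noteq> 0" using u by auto
            have pos: "(2 * Re u - 1) / norm u ^ 2 > 0" using u u0 by simp
            have msq: "m ^ 2 = 1 - (2 * Re u - 1) / norm u ^ 2" unfolding m_def by (rule mu_sq[OF u0])
            have "m ^ 2 < 1 ^ 2" using msq pos by simp
            then have m1: "m < 1" by (rule power2_less_imp_less) simp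
            have m0: "m \<ge> 0" by (simp add: m_def)
            define q where "q = 1 / (1 - m)"
            have q: "q > 0" using m1 by (simp add: q_def)
            have q_le: "q \<le> 2 * (norm u ^ 2 / (2 * Re u - 1))"
            proof -
              have "(1 - m) * (1 + m) = (2 * Re u - 1) / norm u ^ 2" using msq by (simp add: power2_eq_square algebra_simps)
              moreover have "(1 - m) * (1 + m) \<le> (1 - m) * 2" using m1 by (intro mult_left_mono) auto
              ultimately have "(2 * Re u - 1) / norm u ^ 2 \<le> 2 * (1 - m)" by simp
              then have "inverse (2 * (1 - m)) \<le> inverse ((2 * Re u - 1) / norm u ^ 2)" using pos by (rule le_imp_inverse_le)
              moreover have "inverse ((2 * Re u - 1) / norm u ^ 2) = norm u ^ 2 / (2 * Re u - 1)" by (rule inverse_divide)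
              moreover have "inverse (2 * x) = (1 / x) / 2" for x :: real by (simp add: inverse_eq_divide)
              from this[of "1 - m"] have "inverse (2 * (1 - m)) = q / 2" unfolding q_def .
              ultimately show ?thesis by simp
            qed
            define \<delta> where "\<delta> = c0 * exp (- \<eta> / (1 - m))"
            have \<delta>: "\<delta> > 0" using c0 by (simp add: \<delta>_def)
            have low: "norm (f (1 - 1 / u, w)) \<ge> \<delta>" if "norm w \<le> 1" for w
              using c0(2)[of "1 - 1 / u" w] m1 that by (simp add: \<delta>_def m_def)
            obtain c where c: "P u c" "wiener_norm W c \<le> 2 * (A / ((1 - m) * \<delta> ^ K))"
              using right_gen[of u \<delta>] u m1 \<delta> low unfolding m_def by auto
            have "norm (E u) \<le> 2 * (A / ((1 - m) * \<delta> ^ K))" using E_le[OF c(1)] c(2) by simp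
            also have "\<dots> = 2 * A / c0 ^ K * (q * exp (real K * (\<eta> * q)))"
            proof -
              have "\<delta> ^ K = c0 ^ K * exp (- (real K * (\<eta> * q)))"
                by (simp add: \<delta>_def q_def power_mult_distrib exp_of_nat_mult[symmetric])
              then have i: "inverse (\<delta> ^ K) = inverse (c0 ^ K) * exp (real K * (\<eta> * q))" by (simp add: exp_minus)
              have "2 * (A / ((1 - m) * \<delta> ^ K)) = 2 * (A * (q * inverse (\<delta> ^ K)))"
                by (simp add: q_def divide_inverse mult_ac)
              then show ?thesis unfolding i by (simp add: divide_inverse mult_ac)
            qed
            also have "\<dots> \<le> 2 * A / c0 ^ K * ((exp (\<eta> * q) / \<eta>) * exp (real K * (\<eta> * q)))"
            proof -
              have "\<eta> * q \<le> exp (\<eta> * q)" using exp_ge_add_one_self[of "\<eta> * q"] by linarith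
              then have "q \<le> exp (\<eta> * q) / \<eta>" using \<eta> by (simp add: field_simps)
              then show ?thesis using A c0(1) by (intro mult_left_mono mult_right_mono) auto
            qed
            also have "\<dots> = C * exp ((real K + 1) * (\<eta> * q))"
              by (simp add: C_def exp_add[symmetric] algebra_simps)
            also have "\<dots> \<le> C * exp (\<epsilon> * norm u ^ 2 / (2 * Re u - 1))"
            proof -
              have "(real K + 1) * (\<eta> * q) = \<epsilon> / 2 * q" by (simp add: \<eta>_def field_simps)
              also have "\<dots> \<le> \<epsilon> / 2 * (2 * (norm u ^ 2 / (2 * Re u - 1)))" using q_le \<epsilon> by (intro mult_left_mono) auto
              finally show ?thesis using C by simp
            qed
            finally show ?thesis .
          qed
          then show ?thesis by blast
        qed
      qed
      have const_E: "E u = E 0" for u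
        by (rule entire_constant[OF hol left neg right \<alpha>(2)]) auto
      \<comment> \<open>At \<open>u = 0\<close> the constant 1 is an inverse, so the derivative of
        the constant function \<open>E\<close> there is minus the value of the functional at
        \<open>z - 1\<close>, which was nonzero.\<close>
      have "P 0 (\<lambda>_. 1)" unfolding P_def using const(1) by (auto intro!: bexI[of _ "\<lambda>_. 0"])
      from deriv[OF this] have "(E has_field_derivative - \<phi> (\<lambda>p. fst p - 1)) (at 0)" by simp
      moreover have "E = (\<lambda>_. E 0)" using const_E by blast
      then have "(E has_field_derivative 0) (at 0)" by (metis DERIV_const)
      ultimately have "- \<phi> (\<lambda>p. fst p - 1) = 0" by (rule DERIV_unique)
      then show False using \<phi>nz by simp
    qed
  qed
qed

text \<open>A truncation \<open>P\<close> of \<open>g\<close> need not vanish at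
  \<open>z = 1\<close>, so its slice \<open>P1\<close> is subtracted. As \<open>g\<close> vanishes
  there, \<open>P1\<close> is minus the slice of \<open>g - P\<close> and is small by
  \<open>slice_at_one\<close>; and \<open>P - P1\<close> is divisible by \<open>z - 1\<close>
  monomial by monomial.\<close>

lemma (in weight) vanishing_approximation:
  assumes g: "g \<in> wiener_algebra W" and g0: "\<And>w. norm w \<le> 1 \<Longrightarrow> g (1, w) = 0"
    and mono: "\<And>n m. W (0, m) \<le> W (n, m)" and e: "e > 0"
  obtains q where "q \<in> wiener_algebra W" "wiener_norm W (\<lambda>p. g p - (fst p - 1) * q p) < e"
proof (rule truncation[OF g, of "e / 2"])
  show "e / 2 > 0" using e by simp
  fix F a
  assume F: "finite F" and tr: "wiener_norm W (\<lambda>p. g p - (\<Sum>q\<in>F. a q * fst p ^ fst q * snd p ^ snd q)) < e / 2"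
  define P where "P = (\<lambda>p :: complex \<times> complex. \<Sum>q\<in>F. a q * fst p ^ fst q * snd p ^ snd q)"
  define P1 where "P1 = (\<lambda>p :: complex \<times> complex. \<Sum>q\<in>F. a q * fst p ^ 0 * snd p ^ snd q)"
  have PW: "P \<in> wiener_algebra W" unfolding P_def by (rule polynomial(1))
  have P1W: "P1 \<in> wiener_algebra W" unfolding P1_def by (rule polynomial(1)[where n = "\<lambda>_. 0"])
  define D where "D = (\<lambda>p. g p - P p)"
  have DW: "D \<in> wiener_algebra W" unfolding D_def by (rule diff(1)[OF g PW])
  have "P1 \<in> bidisc_algebra" using P1W by (rule wiener_algebraE)
  then have "wiener_norm W P1 \<le> wiener_norm W (\<lambda>p. (-1) * D p)"
  proof (rule slice_at_one[OF wiener_algebra_cmult(1)[OF DW] _ _ mono])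
    fix z w :: complex assume "norm z < 1" "norm w < 1"
    then show "P1 (z, w) = (-1) * D (1, w)" using g0[of w] by (simp add: D_def P_def P1_def)
  qed
  then have P1_le: "wiener_norm W P1 < e / 2" using tr wiener_algebra_cmult(2)[OF DW, of "-1"] by (simp add: D_def P_def)
  define t where "t q = (\<lambda>p :: complex \<times> complex. \<Sum>i<fst q. a q * fst p ^ i * snd p ^ snd q)" for q
  define q where "q = (\<lambda>p. \<Sum>q\<in>F. t q p)"
  have tW: "t q \<in> wiener_algebra W" for q
    unfolding t_def by (rule polynomial(1)[where n = "\<lambda>i. i" and m = "\<lambda>i. snd q"])
  have qW: "q \<in> wiener_algebra W" unfolding q_def by (rule sum(1)[OF tW])
  have q_eq: "(fst p - 1) * q p = P p - P1 p" for p
  proof -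
    have "(fst p - 1) * t q p = a q * fst p ^ fst q * snd p ^ snd q - a q * fst p ^ 0 * snd p ^ snd q" for q
    proof -
      have "t q p = (a q * snd p ^ snd q) * (\<Sum>i<fst q. fst p ^ i)"
        by (simp add: t_def sum_distrib_left mult_ac)
      then have "(fst p - 1) * t q p = (a q * snd p ^ snd q) * ((fst p - 1) * (\<Sum>i<fst q. fst p ^ i))"
        by (simp add: mult_ac)
      also have "(fst p - 1) * (\<Sum>i<fst q. fst p ^ i) = fst p ^ fst q - 1" by (rule power_diff_1_eq[symmetric])
      finally show ?thesis by (simp add: algebra_simps)
    qed
    then show ?thesis by (simp add: q_def P_def P1_def sum_distrib_left sum_subtractf)
  qed
  show thesis
  proof (rule that[OF qW])
    have "(\<lambda>p. g p - (fst p - 1) * q p) = (\<lambda>p. D p + P1 p)" by (rule ext) (simp add: q_eq D_def)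
    then have "wiener_norm W (\<lambda>p. g p - (fst p - 1) * q p) \<le> wiener_norm W D + wiener_norm W P1"
      using add(2)[OF DW P1W] by simp
    also have "\<dots> < e" using tr P1_le by (simp add: D_def P_def)
    finally show "wiener_norm W (\<lambda>p. g p - (fst p - 1) * q p) < e" .
  qed
qed

theorem mainTheorem1:
  fixes \<alpha> \<beta> :: real and f :: "complex \<times> complex \<Rightarrow> complex"
  assumes "\<alpha> \<in> {0..<1}" and "\<beta> \<in> {0<..<1}"
    and "f \<in> weighted_algebra \<alpha> \<beta>"
    and "zero_set f = {1} \<times> cball 0 1"
  shows "closed_ideal_gen (weighted_algebra \<alpha> \<beta>) (weighted_norm \<alpha> \<beta>) f =
           vanishing_ideal (weighted_algebra \<alpha> \<beta>) ({1} \<times> cball 0 1) \<longleftrightarrow>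
         (\<forall>w\<in>cball 0 1. outer_function (\<lambda>z. f (z, w)))"
proof -
  define W where "W = power_weight \<alpha> \<beta>"
  have \<alpha>: "0 \<le> \<alpha>" "\<alpha> < 1" and \<beta>: "0 < \<beta>" "\<beta> \<le> 1" using assms(1,2) by auto
  interpret weight W unfolding W_def using \<alpha> \<beta> by (intro power_weight_weight) auto
  have f: "f \<in> wiener_algebra W" using assms(3) by (simp add: weighted_algebra_eq W_def)
  have zero: "f (z, w) = 0 \<longleftrightarrow> z = 1" if "norm z \<le> 1" "norm w \<le> 1" for z w
  proof -
    have "(z, w) \<in> zero_set f \<longleftrightarrow> (z, w) \<in> {1} \<times> cball 0 1" using assms(4) by simp
    then show ?thesis using that by (auto simp: zero_set_def)
  qed
  have mono: "W (0, m) \<le> W (n, m)" for n m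
    using \<alpha> by (auto simp: W_def power_weight_def intro!: mult_right_mono ge_one_powr_ge_zero)
  define I where "I = {g \<in> wiener_algebra W. \<forall>e>0. \<exists>h\<in>wiener_algebra W. wiener_norm W (\<lambda>p. g p - f p * h p) < e}"
  define J where "J = {g \<in> wiener_algebra W. \<forall>w. norm w \<le> 1 \<longrightarrow> g (1, w) = 0}"
  have I_eq: "closed_ideal_gen (weighted_algebra \<alpha> \<beta>) (weighted_norm \<alpha> \<beta>) f = I"
    by (auto simp: closed_ideal_gen_def closure_in_def I_def weighted_algebra_eq weighted_norm_eq W_def)
  have J_eq: "vanishing_ideal (weighted_algebra \<alpha> \<beta>) ({1} \<times> cball 0 1) = J"
    by (auto simp: vanishing_ideal_def J_def weighted_algebra_eq W_def)
  have T: "(\<lambda>p. fst p - 1) \<in> wiener_algebra W" by (rule coordinate_minus_one)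
  \<comment> \<open>Multiples of \<open>f\<close> vanish at \<open>z = 1\<close>, and point
    evaluations are bounded by the norm, so the vanishing passes to limits.\<close>
  have IJ: "I \<subseteq> J"
  proof
    fix g assume g: "g \<in> I"
    have "g (1, w) = 0" if w: "norm w \<le> 1" for w
    proof (rule ccontr)
      assume "g (1, w) \<noteq> 0"
      then have "norm (g (1, w)) > 0" by simp
      then obtain h where h: "h \<in> wiener_algebra W" "wiener_norm W (\<lambda>p. g p - f p * h p) < norm (g (1, w))"
        using g unfolding I_def by blast
      have "g \<in> wiener_algebra W" using g by (simp add: I_def)
      from closed_bidisc_le[OF diff(1)[OF this mult(1)[OF f h(1)]], of "(1, w)"]
      show False using h(2) w zero[of 1 w] by simp
    qed
    then show "g \<in> J" using g by (simp add: I_def J_def)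
  qed
  have "I = J \<longleftrightarrow> (\<forall>w\<in>cball 0 1. outer_function (\<lambda>z. f (z, w)))"
  proof
    assume "I = J"
    then have TI: "(\<lambda>p. fst p - 1) \<in> I" using T by (simp add: J_def)
    show "\<forall>w\<in>cball 0 1. outer_function (\<lambda>z. f (z, w))"
    proof
      fix w :: complex assume "w \<in> cball 0 1"
      then have w: "norm w \<le> 1" by simp
      show "outer_function (\<lambda>z. f (z, w))"
      proof (rule outer_if_dense_multiples[OF slice_disc_algebra[OF f w]])
        show "f (z, w) \<noteq> 0" if "norm z \<le> 1" "z \<noteq> 1" for z using zero w that by blast
        fix \<eta> :: real assume "\<eta> > 0"
        then obtain h where h: "h \<in> wiener_algebra W" "wiener_norm W (\<lambda>p. fst p - 1 - f p * h p) < \<eta>"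
          using TI unfolding I_def by blast
        show "\<exists>h\<in>disc_algebra. \<forall>z\<in>cball 0 1. norm (f (z, w) * h z - (z - 1)) \<le> \<eta>"
        proof (intro bexI[of _ "\<lambda>z. h (z, w)"] ballI slice_disc_algebra[OF h(1) w])
          fix z :: complex assume z: "z \<in> cball 0 1"
          have "norm (fst (z, w) - 1 - f (z, w) * h (z, w)) \<le> wiener_norm W (\<lambda>p. fst p - 1 - f p * h p)"
            by (rule closed_bidisc_le[OF diff(1)[OF T mult(1)[OF f h(1)]]]) (use z w in auto)
          then show "norm (f (z, w) * h (z, w) - (z - 1)) \<le> \<eta>" using h(2) by (simp add: norm_minus_commute)
        qed
      qed
    qed
  next
    assume outer: "\<forall>w\<in>cball 0 1. outer_function (\<lambda>z. f (z, w))"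
    have "J \<subseteq> I"
    proof
      fix g assume g: "g \<in> J"
      then have gW: "g \<in> wiener_algebra W" and g0: "\<And>w. norm w \<le> 1 \<Longrightarrow> g (1, w) = 0" by (auto simp: J_def)
      have "\<exists>h\<in>wiener_algebra W. wiener_norm W (\<lambda>p. g p - f p * h p) < e" if e: "e > 0" for e
      proof (rule vanishing_approximation[OF gW g0 mono, of "e / 2"])
        fix q assume q: "q \<in> wiener_algebra W" "wiener_norm W (\<lambda>p. g p - (fst p - 1) * q p) < e / 2"
        \<comment> \<open>Half of \<open>e\<close> is spent on replacing \<open>g\<close> by
          \<open>(z - 1) * q\<close>, the other half on replacing \<open>z - 1\<close> by a multiple
          of \<open>f\<close>, an error that gets multiplied by the norm of \<open>q\<close>; the
          added 1 avoids division by 0.\<close>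
        define d where "d = e / (2 * (wiener_norm W q + 1))"
        have d: "d > 0" using e norm_nonneg[of q] by (simp add: d_def)
        have "\<exists>h\<in>wiener_algebra (power_weight \<alpha> \<beta>). wiener_norm (power_weight \<alpha> \<beta>) (\<lambda>p. fst p - 1 - f p * h p) < d"
        proof (rule coordinate_in_closed_ideal[OF \<alpha> \<beta> _ _ _ d])
          show "f \<in> wiener_algebra (power_weight \<alpha> \<beta>)" using f by (simp add: W_def)
          show "f (z, w) \<noteq> 0" if "norm z \<le> 1" "norm w \<le> 1" "z \<noteq> 1" for z w using zero that by blast
          show "outer_function (\<lambda>z. f (z, w))" if "norm w \<le> 1" for w using outer that by simp
        qed
        then obtain h where h: "h \<in> wiener_algebra W" "wiener_norm W (\<lambda>p. fst p - 1 - f p * h p) < d"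
          by (auto simp: W_def)
        define k where "k = (\<lambda>p. h p * q p)"
        have kW: "k \<in> wiener_algebra W" unfolding k_def by (rule mult(1)[OF h(1) q(1)])
        define x where "x = (\<lambda>p. fst p - 1 - f p * h p)"
        define y where "y = (\<lambda>p. g p - (fst p - 1) * q p)"
        have xW: "x \<in> wiener_algebra W" unfolding x_def by (rule diff(1)[OF T mult(1)[OF f h(1)]])
        have yW: "y \<in> wiener_algebra W" unfolding y_def by (rule diff(1)[OF gW mult(1)[OF T q(1)]])
        have "(\<lambda>p. g p - f p * k p) = (\<lambda>p. y p + x p * q p)"
          by (rule ext) (simp add: x_def y_def k_def algebra_simps)
        then have "wiener_norm W (\<lambda>p. g p - f p * k p) \<le> wiener_norm W y + wiener_norm W (\<lambda>p. x p * q p)"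
          using add(2)[OF yW mult(1)[OF xW q(1)]] by simp
        also have "wiener_norm W (\<lambda>p. x p * q p) \<le> d * wiener_norm W q"
          by (rule norm_mult_le[OF xW q(1) _ order_refl]) (use h(2) in \<open>simp add: x_def\<close>)
        also have "d * wiener_norm W q \<le> d * (wiener_norm W q + 1)" using d by (intro mult_left_mono) auto
        also have "\<dots> = e / 2"
        proof -
          have "wiener_norm W q + 1 > 0" using norm_nonneg[of q] by simp
          moreover have "e / (2 * x) * x = e / 2" if "x > 0" for x using that by simp
          ultimately show ?thesis unfolding d_def by blast
        qed
        finally have "wiener_norm W (\<lambda>p. g p - f p * k p) < e" using q(2) by (simp add: y_def)
        then show ?thesis using kW by blast
      next
        show "e / 2 > 0" using e by simp
      qed
      then show "g \<in> I" using gW by (simp add: I_def)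
    qed
    then show "I = J" using IJ by blast
  qed
  then show ?thesis unfolding I_eq J_eq .
qed

end
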